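(* Let $s\in(0,1)$, $n>2s$, $p=\frac{n+2s}{n-2s}$, and let $\Omega\subset\mathbb{R}^n$ be a bounded domain of class $C^1$. Then for every $\epsilon>0$ there exists a constant $A(\epsilon)>0$ such that for any $u\in H^s_\Omega$, $$\left(\int_{\Omega}|u|^{p+1}\,dx\right)^{\frac{2}{p+1}}\le\left(\frac{2^{\frac{2s}{n}}}{S}+\epsilon\right)\frac{c_{n,s}}{2}\int_{T(\Omega)}\frac{|u(x)-u(y)|^2}{|x-y|^{n+2s}}\,dx\,dy+A(\epsilon)\int_\Omega u^2\,dx.$$
   Context: $c_{n,s}=\left(\int_{\mathbb{R}^n}\frac{1-\cos(\theta_1)}{|\theta|^{n+2s}}\,d\theta\right)^{-1}$, where $\theta_1$ is the first coordinate of $\theta$. $T(\Omega)=\mathbb{R}^{2n}\setminus(\mathbb{R}^n\setminus\Omega)^2$. $H^s_\Omega$ is the space of measurable functions $u:\mathbb{R}^n\to\mathbb{R}$ with $\|u\|_{H^s_\Omega}<\infty$, where $\|u\|_{H^s_\Omega}^2=\|u\|_{L^2(\Omega)}^2+\int_{T(\Omega)}\frac{|u(x)-u(y)|^2}{|x-y|^{n+2s}}\,dx\,dy$. $S$ is the best constant in the fractional Sobolev inequality $S\left(\int_{\mathbb{R}^n}|u|^{p+1}\,dx\right)^{\frac{2}{p+1}}\le\frac{c_{n,s}}{2}\int_{\mathbb{R}^n}\int_{\mathbb{R}^n}\frac{|u(x)-u(y)|^2}{|x-y|^{n+2s}}\,dx\,dy$ for all $u\in H^s(\mathbb{R}^n)$;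 explicitly $S=2^{2s}\pi^s\frac{\Gamma(\frac{n+2s}{2})}{\Gamma(\frac{n-2s}{2})}\left[\frac{\Gamma(\frac n2)}{\Gamma(n)}\right]^{\frac{2s}{n}}$. *)

theory Defs
  imports "HOL-Analysis.Analysis"
begin

text \<open>
  The ambient space is \<open>real^'n\<close> with \<open>n = CARD('n)\<close>. The order on the index type \<open>'n\<close> only
  serves to single out a first coordinate.
\<close>

definition c_const :: "'n::{finite,linorder} itself \<Rightarrow> real \<Rightarrow> real" where
  "c_const _ s = inverse (LINT \<theta>::real^'n::{finite,linorder}|lebesgue.
     (1 - cos (\<theta> $ Min UNIV)) / norm \<theta> powr (real CARD('n) + 2 * s))"

definition T_region :: "(real^'n) set \<Rightarrow> ((real^'n) \<times> (real^'n)) set" where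
  "T_region \<Omega> = UNIV - (UNIV - \<Omega>) \<times> (UNIV - \<Omega>)"

text \<open>
  On the diagonal, which is a null set, the quotient below is \<open>0\<close> by the convention \<open>x / 0 = 0\<close>.
\<close>

definition diff_quot :: "real \<Rightarrow> (real^'n::finite \<Rightarrow> real) \<Rightarrow> (real^'n) \<times> (real^'n) \<Rightarrow> real" where
  "diff_quot s u = (\<lambda>(x, y). \<bar>u x - u y\<bar>\<^sup>2 / norm (x - y) powr (real CARD('n) + 2 * s))"

text \<open>
  The squared norm takes values in \<open>[0,\<infinity>]\<close>, so that its finiteness is meaningful for every
  measurable function.
\<close>

definition Hs_norm_sq :: "real \<Rightarrow> (real^'n::finite) set \<Rightarrow> (real^'n \<Rightarrow> real) \<Rightarrow> ennreal" where
  "Hs_norm_sq s \<Omega> u =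
     (\<integral>\<^sup>+x\<in>\<Omega>. ennreal ((u x)\<^sup>2) \<partial>lebesgue) +
     (\<integral>\<^sup>+z\<in>T_region \<Omega>. ennreal (diff_quot s u z) \<partial>lebesgue)"

definition Hs_space :: "real \<Rightarrow> (real^'n::finite) set \<Rightarrow> (real^'n \<Rightarrow> real) set" where
  "Hs_space s \<Omega> = {u. u \<in> borel_measurable lebesgue \<and> Hs_norm_sq s \<Omega> u < \<infinity>}"

text \<open>
  Real-valued version of the double integral; for \<open>u \<in> Hs_space s \<Omega>\<close> the integrand is
  integrable over the region.
\<close>

definition energy :: "real \<Rightarrow> (real^'n::finite) set \<Rightarrow> (real^'n \<Rightarrow> real) \<Rightarrow> real" where
  "energy s \<Omega> u = (LINT z:T_region \<Omega>|lebesgue. diff_quot s u z)"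

text \<open>
  The exponent \<open>p = (n + 2s) / (n - 2s)\<close>.
\<close>

definition crit_exp :: "nat \<Rightarrow> real \<Rightarrow> real" where
  "crit_exp n s = (real n + 2 * s) / (real n - 2 * s)"

text \<open>
  The best (that is, largest) constant in the fractional Sobolev inequality on the whole space.
  Here \<open>T_region UNIV = UNIV\<close>, so \<open>Hs_space s UNIV\<close> is the usual space \<open>H\<^sup>s\<close>, and
  \<open>energy s UNIV u\<close> is the integral over all pairs. Integrability of \<open>\<bar>u\<bar>\<^sup>p\<^sup>+\<^sup>1\<close> is
  part of the inequality, since the Bochner integral of a non-integrable function is \<open>0\<close>.
\<close>

definition sobolev_const :: "'n::{finite,linorder} itself \<Rightarrow> real \<Rightarrow> real" where
  "sobolev_const _ s = Sup {C::real. \<forall>u :: real^'n::{finite,linorder} \<Rightarrow> real. u \<in> Hs_space s UNIV \<longrightarrow>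
     integrable lebesgue (\<lambda>x. \<bar>u x\<bar> powr (crit_exp CARD('n) s + 1)) \<and>
     C * (LINT x|lebesgue. \<bar>u x\<bar> powr (crit_exp CARD('n) s + 1)) powr (2 / (crit_exp CARD('n) s + 1))
       \<le> c_const TYPE('n) s / 2 * energy s UNIV u}"

text \<open>
  Near each of its boundary points, a set of class \<open>C\<^sup>1\<close> is the part of a ball lying above the
  graph of a \<open>C\<^sup>1\<close> function, with respect to some rotated coordinate system. The unit vector \<open>e\<close>
  is the vertical direction, and \<open>x - (x \<bullet> e) *\<^sub>R e\<close> is the horizontal part of \<open>x\<close>. The function
  \<open>\<gamma>\<close> is taken on the whole space but only its values on the hyperplane orthogonal to \<open>e\<close> matter;
  every \<open>C\<^sup>1\<close> function on that hyperplane arises by restriction of such a \<open>\<gamma>\<close>.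
\<close>

definition C1_function :: "('a::euclidean_space \<Rightarrow> real) \<Rightarrow> bool" where
  "C1_function \<gamma> \<longleftrightarrow> (\<exists>g. (\<forall>x. GDERIV \<gamma> x :> g x) \<and> continuous_on UNIV g)"

definition C1_boundary :: "'a::euclidean_space set \<Rightarrow> bool" where
  "C1_boundary \<Omega> \<longleftrightarrow> (\<forall>x0 \<in> frontier \<Omega>. \<exists>r>0. \<exists>e \<gamma>. norm e = 1 \<and> C1_function \<gamma> \<and>
     \<Omega> \<inter> ball x0 r = {x \<in> ball x0 r. x \<bullet> e > \<gamma> (x - (x \<bullet> e) *\<^sub>R e)})"

definition bounded_C1_domain :: "'a::euclidean_space set \<Rightarrow> bool" where
  "bounded_C1_domain \<Omega> \<longleftrightarrow>
     open \<Omega> \<and> connected \<Omega> \<and> \<Omega> \<noteq> {} \<and> bounded \<Omega> \<and> C1_boundary \<Omega>"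

end

theory Submission
  imports Defs "HOL-Probability.Characteristic_Functions" "HOL-Real_Asymp.Real_Asymp"
begin

text \<open>
  In a half-space, let \<open>w\<close> be the even reflection of \<open>u\<close> from the inside, let \<open>v\<close> be the reflected
  outside values of \<open>u\<close>, and let \<open>K*(x, y) = K(x - y*)\<close> be the reflected kernel. The pointwise identity
  \<open>(u x - v y)\<^sup>2 + (u y - v x)\<^sup>2 - (u x - u y)\<^sup>2 = (v x - v y)\<^sup>2 + 2 (u x - v x) (u y - v y)\<close> and the
  positive definiteness of \<open>K*\<close> (reflection positivity of \<open>\<bar>z\<bar>\<^sup>-\<^sup>n\<^sup>-\<^sup>2\<^sup>s\<close>) show that the energy of \<open>w\<close> on
  the whole space is at most twice the energy of \<open>u\<close> over \<open>T\<close>, while the integral of \<open>\<bar>w\<bar>\<^sup>p\<^sup>+\<^sup>1\<close> is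
  exactly doubled: this is the origin of the factor \<open>2\<^sup>2\<^sup>s\<^sup>/\<^sup>n\<close>. The inequality between forms
  persists when both variables are restricted to any bounded part of the half-space, so the values
  of \<open>u\<close> outside the domain, which are not controlled in \<open>L\<^sup>2\<close>, never enter an error term.

  Near a boundary point a measure-preserving shear, with derivative close to the identity, maps the domain to
  a half-space. A partition of unity with \<open>\<Sum> \<eta>\<^sub>i\<^sup>2 = 1\<close> and Minkowski's inequality for \<open>u\<^sup>2\<close> in
  \<open>L\<^bsup>(p+1)/2\<^esup>\<close> glue the local inequalities; the commutator terms carry the factor \<open>u(x)\<^sup>2\<close> with
  \<open>x \<in> \<Omega>\<close>.
\<close>

section \<open>The kernel and its integrals\<close>

text \<open>Reflection positivity has an explicit source. The distance from \<open>x\<close> to the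
  mirror image of \<open>y\<close> involves the two heights only through their sum, and the kernel
  is a superposition of terms exp(-t rho) cos(xi . z) with t equal to that sum. Exponential and
  cosine split into products of one function at \<open>x\<close> and the same function at
  \<open>y\<close>, so every frequency contributes a square. The numerical factor is 2^(1 -
  (n-2s)/n) = 2^(2s/n): the energy at most doubles, while the doubled integral enters with the power
  2/(p+1) = (n-2s)/n. The pointwise identity subtracts energies, which is meaningless when they are
  infinite. It is therefore integrated for bounded functions, a regularised kernel and a set of
  finite measure; Fatou's lemma on one side and monotonicity on the other remove these restrictions.
  The best constant is a supremum. A crude Sobolev inequality puts a positive number into the set of
  admissible constants, a test function bounds that set, and then the supremum is itself
  admissible.\<close>

definition rker :: "real \<Rightarrow> 'a::euclidean_space \<Rightarrow> real" where
  "rker s z = norm z powr - (real DIM('a) + 2 * s)"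

lemma rker_nonneg [simp]: "0 \<le> rker s z"
  by (simp add: rker_def)

lemma rker_zero [simp]: "rker s 0 = 0"
  by (simp add: rker_def)

lemma rker_minus [simp]: "rker s (- z) = rker s z"
  by (simp add: rker_def)

lemma rker_commute: "rker s (x - y) = rker s (y - x)"
  by (simp add: rker_def norm_minus_commute)

lemma measurable_rker [measurable]: "rker s \<in> borel_measurable borel"
  unfolding rker_def by measurable

section \<open>Integrability of the kernel near the origin and at infinity\<close>

text \<open>Near 0 the integrand is t^(1 - 2s), integrable because s < 1; near infinity it is t^(-1
  - 2s), integrable because s > 0.\<close>

lemma radial_moment_finite:
  fixes s :: real
  assumes "0 < s" "s < 1"
  shows "(\<integral>\<^sup>+t. ennreal (t powr (- 1 - 2 * s) * min 1 (t\<^sup>2)) * indicator {0<..} t \<partial>lborel) < \<infinity>"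
proof -
  have "(\<integral>\<^sup>+t. ennreal (t powr (- 1 - 2 * s) * min 1 (t\<^sup>2)) * indicator {0<..} t \<partial>lborel)
    \<le> (\<integral>\<^sup>+t. ennreal (t powr (1 - 2 * s)) * indicator {0..1} t
          + ennreal (t powr (- 1 - 2 * s)) * indicator {1..} t \<partial>lborel)"
  proof (rule nn_integral_mono)
    fix t :: real
    show "ennreal (t powr (- 1 - 2 * s) * min 1 (t\<^sup>2)) * indicator {0<..} t
      \<le> ennreal (t powr (1 - 2 * s)) * indicator {0..1} t + ennreal (t powr (- 1 - 2 * s)) * indicator {1..} t"
    proof (cases "0 < t \<and> t < 1")
      case True
      have "t powr (- 1 - 2 * s) * t\<^sup>2 = t powr (- 1 - 2 * s) * t powr 2"
        using True by simp
      also have "\<dots> = t powr (1 - 2 * s)"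
        by (simp flip: powr_add)
      finally have "t powr (- 1 - 2 * s) * t\<^sup>2 = t powr (1 - 2 * s)" .
      moreover have "t powr (- 1 - 2 * s) * min 1 (t\<^sup>2) \<le> t powr (- 1 - 2 * s) * t\<^sup>2"
        by (intro mult_left_mono) auto
      ultimately show ?thesis using True by (auto intro!: ennreal_leI)
    next
      case False
      have "t powr (- 1 - 2 * s) * min 1 (t\<^sup>2) \<le> t powr (- 1 - 2 * s) * 1"
        by (intro mult_left_mono) auto
      then show ?thesis using False
        by (auto simp: indicator_def intro!: ennreal_leI order_trans[OF _ le_add2])
    qed
  qed
  also have "\<dots> = (\<integral>\<^sup>+t. ennreal (t powr (1 - 2 * s)) * indicator {0..1} t \<partial>lborel)
          + (\<integral>\<^sup>+t. ennreal (t powr (- 1 - 2 * s)) * indicator {1..} t \<partial>lborel)"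
    by (rule nn_integral_add) measurable
  finally have le: "(\<integral>\<^sup>+t. ennreal (t powr (- 1 - 2 * s) * min 1 (t\<^sup>2)) * indicator {0<..} t \<partial>lborel)
    \<le> (\<integral>\<^sup>+t. ennreal (t powr (1 - 2 * s)) * indicator {0..1} t \<partial>lborel)
          + (\<integral>\<^sup>+t. ennreal (t powr (- 1 - 2 * s)) * indicator {1..} t \<partial>lborel)" .
  have "(\<integral>\<^sup>+t. ennreal (t powr (1 - 2 * s)) * indicator {0..1} t \<partial>lborel) < \<infinity>"
  proof -
    have "((\<lambda>t. t powr (1 - 2 * s)) has_integral (1 powr (1 - 2 * s + 1) / (1 - 2 * s + 1))) {0..1}"
      using assms by (intro has_integral_powr_from_0) auto
    then have "((\<lambda>t. if t \<in> {0..1} then t powr (1 - 2 * s) else 0) has_integral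
        (1 powr (1 - 2 * s + 1) / (1 - 2 * s + 1))) UNIV"
      by (simp only: has_integral_restrict_UNIV)
    moreover have *: "(\<lambda>t. if t \<in> {0..1} then t powr (1 - 2 * s) else 0) = (\<lambda>t. indicator {0..1} t * t powr (1 - 2 * s))"
      by (auto simp: indicator_def)
    ultimately have "(\<integral>\<^sup>+t. ennreal (indicator {0..1} t * t powr (1 - 2 * s)) \<partial>lborel)
      = ennreal (1 powr (1 - 2 * s + 1) / (1 - 2 * s + 1))"
      by (intro nn_integral_has_integral_lborel) auto
    moreover have "ennreal (indicator {0..1} t * t powr (1 - 2 * s))
        = ennreal (t powr (1 - 2 * s)) * indicator {0..1} t" for t
      by (simp add: indicator_def)
    ultimately show ?thesis by simp
  qed
  moreover have "(\<integral>\<^sup>+t. ennreal (t powr (- 1 - 2 * s)) * indicator {1..} t \<partial>lborel) < \<infinity>"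
  proof -
    have "(\<integral>\<^sup>+t. ennreal (t powr (- 1 - 2 * s)) * indicator {1..} t \<partial>lborel)
      = 0 - (- (1 powr (- 2 * s) / (2 * s)))"
    proof (rule nn_integral_FTC_atLeast)
      show "((\<lambda>t. - (t powr (- 2 * s) / (2 * s))) has_real_derivative t powr (- 1 - 2 * s)) (at t)"
        if "1 \<le> t" for t
        using that assms by (auto intro!: derivative_eq_intros simp: minus_diff_commute mult.commute)
      have "((\<lambda>t::real. t powr (- 2 * s)) \<longlongrightarrow> 0) at_top"
        using assms by (intro tendsto_neg_powr filterlim_ident) auto
      from tendsto_minus[OF tendsto_divide[OF this tendsto_const, of "2 * s"]]
      show "((\<lambda>t. - (t powr (- 2 * s) / (2 * s))) \<longlongrightarrow> 0) at_top" using assms by simp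
    qed auto
    then show ?thesis by simp
  qed
  ultimately show ?thesis
    using le by (simp add: le_less_trans)
qed

text \<open>Layer cake over the shells \<open>t \<in> [\<bar>z\<bar>, 2\<bar>z\<bar>]\<close> reduces the claim to a radial integral.\<close>

lemma kernel_moment_finite:
  fixes s :: real
  assumes "0 < s" "s < 1"
  shows "(\<integral>\<^sup>+z. ennreal (min 1 ((norm z)\<^sup>2) * rker s (z::'a::euclidean_space)) \<partial>lborel) < \<infinity>"
proof -
  define l where "l = real DIM('a) + 2 * s"
  \<comment> \<open>On the shell [r, 2r], of length r, the factor t^(-l - 1) is at least (2r)^(-l -
    1); \<open>C\<close> compensates for the 2 in this bound.\<close>
  define C where "C = 2 powr (l + 1)"
  define h where "h t = t powr (- l - 1) * min 1 (t\<^sup>2)" for t :: real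
  have h_meas [measurable]: "h \<in> borel_measurable borel"
    unfolding h_def by measurable
  define B where "B = {p::'a \<times> real. norm (fst p) \<le> snd p \<and> snd p \<le> 2 * norm (fst p) \<and> 0 < snd p}"
  have B_meas [measurable]: "B \<in> sets (lborel \<Otimes>\<^sub>M lborel)"
    
  proof -
    have "closed {p::'a \<times> real. norm (fst p) \<le> snd p}" "closed {p::'a \<times> real. snd p \<le> 2 * norm (fst p)}"
      "open {p::'a \<times> real. 0 < snd p}"
      by (intro closed_Collect_le open_Collect_less continuous_intros)+
    then have "{p::'a \<times> real. norm (fst p) \<le> snd p} \<inter> {p. snd p \<le> 2 * norm (fst p)} \<inter> {p. 0 < snd p} \<in> sets borel"
      by (intro sets.Int borel_closed borel_open)
    then show ?thesis
      unfolding B_def lborel_prod sets_lborel by (simp add: Collect_conj_eq Int_assoc)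
  qed
  have lpos: "0 < l" unfolding l_def using assms by simp
  have shell: "ennreal (min 1 ((norm z)\<^sup>2) * rker s z)
      \<le> ennreal C * (\<integral>\<^sup>+t. ennreal (h t) * indicator B (z, t) \<partial>lborel)"
    for z :: 'a
  proof (cases "z = 0")
    case False
    define r where "r = norm z"
    have r: "0 < r" using False by (simp add: r_def)
    have "ennreal (min 1 (r\<^sup>2) * r powr - l) = ennreal C * (ennreal ((2 * r) powr (- l - 1) * min 1 (r\<^sup>2)) * ennreal r)"
    proof -
      have "(2 * r) powr (- l - 1) * r = 2 powr (- (l + 1)) * (r powr (- l - 1) * r powr 1)"
        using r by (simp add: powr_mult)
      also have "r powr (- l - 1) * r powr 1 = r powr - l"
        by (simp only: powr_add[symmetric]) simp
      finally have "C * ((2 * r) powr (- l - 1) * r) = (2 powr (l + 1) * 2 powr - (l + 1)) * r powr - l"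
        by (simp only: C_def mult.assoc)
      also have "2 powr (l + 1) * 2 powr - (l + 1) = (1::real)"
        by (simp only: powr_add[symmetric]) simp
      finally have "C * ((2 * r) powr (- l - 1) * r) = r powr - l" by simp
      then have "min 1 (r\<^sup>2) * r powr - l = C * ((2 * r) powr (- l - 1) * min 1 (r\<^sup>2) * r)"
        by (simp add: mult_ac)
      then show ?thesis
        using r by (simp add: C_def ennreal_mult[symmetric])
    qed
    also have "ennreal ((2 * r) powr (- l - 1) * min 1 (r\<^sup>2)) * ennreal r
        = (\<integral>\<^sup>+t. ennreal ((2 * r) powr (- l - 1) * min 1 (r\<^sup>2)) * indicator {r..2 * r} t \<partial>lborel)"
      using r by (subst nn_integral_cmult_indicator) auto
    also have "\<dots> \<le> (\<integral>\<^sup>+t. ennreal (h t) * indicator B (z, t) \<partial>lborel)"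
    proof (rule nn_integral_mono)
      fix t :: real
      have "(2 * r) powr (- l - 1) * min 1 (r\<^sup>2) \<le> h t" if "r \<le> t" "t \<le> 2 * r"
      proof -
        have "r\<^sup>2 \<le> t\<^sup>2" using that r by (intro power_mono) auto
        then have "min 1 (r\<^sup>2) \<le> min 1 (t\<^sup>2)" by (intro min.mono) auto
        moreover have "(2 * r) powr (- l - 1) \<le> t powr (- l - 1)"
          using that r lpos by (intro powr_mono2') auto
        ultimately show ?thesis
          unfolding h_def by (intro mult_mono) auto
      qed
      then show "ennreal ((2 * r) powr (- l - 1) * min 1 (r\<^sup>2)) * indicator {r..2 * r} t
        \<le> ennreal (h t) * indicator B (z, t)"
        using r by (auto simp: indicator_def B_def simp flip: r_def intro!: ennreal_leI)
    qed
    finally show ?thesis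
      by (simp add: rker_def r_def l_def mult_left_mono)
  qed auto
  have "(\<integral>\<^sup>+z. ennreal (min 1 ((norm z)\<^sup>2) * rker s (z::'a)) \<partial>lborel)
    \<le> (\<integral>\<^sup>+z. ennreal C * (\<integral>\<^sup>+t. ennreal (h t) * indicator B (z, t) \<partial>lborel) \<partial>lborel)"
    by (intro nn_integral_mono shell)
  also have "\<dots> = ennreal C * (\<integral>\<^sup>+t. (\<integral>\<^sup>+z. ennreal (h t) * indicator B (z, t) \<partial>lborel) \<partial>lborel)"
  proof -
    have m: "(\<lambda>(z, t). ennreal (h t) * indicator B (z, t)) \<in> borel_measurable (lborel \<Otimes>\<^sub>M lborel)"
      by (simp add: case_prod_beta')
    show ?thesis
      using m lborel.borel_measurable_nn_integral[OF m]
      by (subst nn_integral_cmult) (simp_all add: lborel_pair.Fubini'[OF m])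
  qed
  also have "(\<integral>\<^sup>+t. (\<integral>\<^sup>+z. ennreal (h t) * indicator B (z, t) \<partial>lborel) \<partial>lborel)
     \<le> (\<integral>\<^sup>+t. ennreal (unit_ball_vol (real DIM('a))) * (ennreal (t powr (- 1 - 2 * s) * min 1 (t\<^sup>2)) * indicator {0<..} t) \<partial>lborel)"
  proof (rule nn_integral_mono)
    fix t :: real
    show "(\<integral>\<^sup>+z. ennreal (h t) * indicator B (z, t) \<partial>lborel)
      \<le> ennreal (unit_ball_vol (real DIM('a))) * (ennreal (t powr (- 1 - 2 * s) * min 1 (t\<^sup>2)) * indicator {0<..} t)"
    proof (cases "0 < t")
      case True
      have "(\<integral>\<^sup>+z. ennreal (h t) * indicator B (z, t) \<partial>lborel)
         \<le> (\<integral>\<^sup>+z. ennreal (h t) * indicator (cball (0::'a) t) z \<partial>lborel)"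
        by (intro nn_integral_mono) (auto simp: indicator_def B_def)
      also have "\<dots> = ennreal (h t) * emeasure lborel (cball (0::'a) t)"
        by (subst nn_integral_cmult_indicator) auto
      also have "\<dots> = ennreal (h t) * ennreal (unit_ball_vol (real DIM('a)) * t ^ DIM('a))"
        using True by (simp add: emeasure_cball)
      also have "\<dots> = ennreal (unit_ball_vol (real DIM('a))) * ennreal (h t * t ^ DIM('a))"
        using True by (simp add: h_def ennreal_mult[symmetric] mult_ac)
      \<comment> \<open>The slice of \<open>B\<close> at \<open>t\<close> lies in a ball of volume
        proportional to t^n, which cancels the dimension contained in \<open>l\<close>.\<close>
      also have "h t * t ^ DIM('a) = t powr (- 1 - 2 * s) * min 1 (t\<^sup>2)"
      proof -
        have "t powr (- l - 1) * t powr real DIM('a) = t powr (- 1 - 2 * s)"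
          by (simp flip: powr_add add: l_def minus_diff_commute)
        moreover have "t ^ DIM('a) = t powr real DIM('a)"
          using True by (simp add: powr_realpow)
        ultimately show ?thesis by (simp add: h_def mult_ac)
      qed
      finally show ?thesis using True by simp
    qed (auto simp: B_def)
  qed
  also have "\<dots> = ennreal (unit_ball_vol (real DIM('a))) * (\<integral>\<^sup>+t. ennreal (t powr (- 1 - 2 * s) * min 1 (t\<^sup>2)) * indicator {0<..} t \<partial>lborel)"
    by (rule nn_integral_cmult) measurable
  finally have "(\<integral>\<^sup>+z. ennreal (min 1 ((norm z)\<^sup>2) * rker s (z::'a)) \<partial>lborel)
    \<le> ennreal C * (ennreal (unit_ball_vol (real DIM('a))) * (\<integral>\<^sup>+t. ennreal (t powr (- 1 - 2 * s) * min 1 (t\<^sup>2)) * indicator {0<..} t \<partial>lborel))"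
    by (simp add: mult_left_mono)
  also have "\<dots> < \<infinity>"
    using radial_moment_finite[OF assms] by (simp add: ennreal_mult_less_top)
  finally show ?thesis .
qed

text \<open>Away from the origin min(1, |z|^2) is bounded below, so the tail is dominated by the
  moment above.\<close>

lemma kernel_tail_finite:
  fixes s r :: real
  assumes "0 < s" "s < 1" "0 < r"
  shows "(\<integral>\<^sup>+z. ennreal (rker s (z::'a::euclidean_space)) * indicator {z. r \<le> norm z} z \<partial>lborel) < \<infinity>"
proof -
  have "(\<integral>\<^sup>+z. ennreal (rker s (z::'a)) * indicator {z. r \<le> norm z} z \<partial>lborel)
    \<le> (\<integral>\<^sup>+z. ennreal (max 1 (1 / r\<^sup>2)) * ennreal (min 1 ((norm z)\<^sup>2) * rker s (z::'a)) \<partial>lborel)"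
  proof (rule nn_integral_mono)
    fix z :: 'a
    have "1 \<le> max 1 (1 / r\<^sup>2) * min 1 ((norm z)\<^sup>2)" if "r \<le> norm z"
    proof -
      have *: "1 \<le> max 1 (1 / r\<^sup>2) * (norm z)\<^sup>2"
      proof -
        have "1 = 1 / r\<^sup>2 * r\<^sup>2" using assms by simp
        also have "\<dots> \<le> max 1 (1 / r\<^sup>2) * (norm z)\<^sup>2"
          using assms that by (intro mult_mono power_mono) auto
        finally show ?thesis .
      qed
      show ?thesis
      proof (cases "1 \<le> (norm z)\<^sup>2")
        case False
        then have "min 1 ((norm z)\<^sup>2) = (norm z)\<^sup>2" by simp
        then show ?thesis using * by (simp only:)
      qed simp
    qed
    then have "1 * rker s z \<le> max 1 (1 / r\<^sup>2) * min 1 ((norm z)\<^sup>2) * rker s z" if "r \<le> norm z"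
      using that by (intro mult_right_mono) auto
    then show "ennreal (rker s z) * indicator {z. r \<le> norm z} z \<le> ennreal (max 1 (1 / r\<^sup>2)) * ennreal (min 1 ((norm z)\<^sup>2) * rker s z)"
      by (auto simp: indicator_def ennreal_mult[symmetric] mult_ac intro!: ennreal_leI)
  qed
  also have "\<dots> = ennreal (max 1 (1 / r\<^sup>2)) * (\<integral>\<^sup>+z. ennreal (min 1 ((norm z)\<^sup>2) * rker s (z::'a)) \<partial>lborel)"
    by (rule nn_integral_cmult) measurable
  also have "\<dots> < \<infinity>"
    using kernel_moment_finite[OF assms(1,2), where 'a='a] by (simp add: ennreal_mult_less_top)
  finally show ?thesis .
qed

section \<open>A fractional Sobolev inequality on the whole space\<close>

text \<open>An iterated integral with values in [0, infinity], so that no finiteness has to be known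
  in advance. Two functions are allowed because the reflection argument compares inside values with
  reflected outside values.\<close>

definition gform :: "('a::euclidean_space \<Rightarrow> 'a \<Rightarrow> real) \<Rightarrow> 'a set \<Rightarrow> ('a \<Rightarrow> real) \<Rightarrow> 'a set \<Rightarrow> ('a \<Rightarrow> real) \<Rightarrow> ennreal" where
  "gform k A f B g = (\<integral>\<^sup>+x. (\<integral>\<^sup>+y. ennreal ((f x - g y)\<^sup>2 * k x y) * indicator B y \<partial>lborel) * indicator A x \<partial>lborel)"

abbreviation seminorm_sq :: "real \<Rightarrow> ('a::euclidean_space \<Rightarrow> real) \<Rightarrow> ennreal" where
  "seminorm_sq s u \<equiv> gform (\<lambda>x y. rker s (x - y)) UNIV u UNIV u"

text \<open>Fatou's lemma in the form that removes truncations and regularisations from an estimate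
  with a fixed bound.\<close>

lemma nn_integral_le_of_tendsto:
  fixes f :: "nat \<Rightarrow> 'b \<Rightarrow> ennreal"
  assumes [measurable]: "\<And>i. f i \<in> borel_measurable M"
    and lim: "\<And>x. (\<lambda>i. f i x) \<longlonglongrightarrow> F x" and le: "\<And>i. (\<integral>\<^sup>+x. f i x \<partial>M) \<le> B"
  shows "(\<integral>\<^sup>+x. F x \<partial>M) \<le> B"
proof -
  have "(\<integral>\<^sup>+x. F x \<partial>M) = (\<integral>\<^sup>+x. liminf (\<lambda>i. f i x) \<partial>M)"
    by (intro nn_integral_cong) (metis lim lim_imp_Liminf sequentially_bot)
  also have "\<dots> \<le> liminf (\<lambda>i. \<integral>\<^sup>+x. f i x \<partial>M)"
    by (rule nn_integral_liminf) measurable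
  also have "\<dots> \<le> B"
    using Liminf_mono[of "\<lambda>i. \<integral>\<^sup>+x. f i x \<partial>M" "\<lambda>_. B" sequentially] le by (simp add: Liminf_const)
  finally show ?thesis .
qed

section \<open>A crude Sobolev constant by averaging over balls\<close>

text \<open>If |b| <= a/2, then b is far from c and the difference alone suffices. Otherwise b^2 is
  controlled by |b|^q, since |b|^(2 - q) is decreasing in |b|.\<close>

lemma sobolev_pointwise_quadratic:
  fixes a b c q :: real
  assumes "0 < a" "2 < q" "a = \<bar>c\<bar>"
  shows "a\<^sup>2 / 2 \<le> 2 * (c - b)\<^sup>2 + 2 * (a / 2) powr (2 - q) * \<bar>b\<bar> powr q"
proof -
  have 1: "c\<^sup>2 \<le> 2 * (c - b)\<^sup>2 + 2 * b\<^sup>2"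
    using zero_le_power2[of "c - 2 * b"] by (simp add: power2_eq_square algebra_simps)
  have 2: "b\<^sup>2 \<le> (a / 2)\<^sup>2 + (a / 2) powr (2 - q) * \<bar>b\<bar> powr q"
  proof (cases "\<bar>b\<bar> \<le> a / 2")
    case True
    then have "b\<^sup>2 \<le> (a / 2)\<^sup>2" by (simp add: abs_le_square_iff[symmetric])
    then show ?thesis by (simp add: add_increasing2)
  next
    case False
    then have b: "0 < \<bar>b\<bar>" using assms by linarith
    have "\<bar>b\<bar> powr (2 - q) \<le> (a / 2) powr (2 - q)"
      using False assms by (intro powr_mono2') auto
    then have "\<bar>b\<bar> powr (2 - q) * \<bar>b\<bar> powr q \<le> (a / 2) powr (2 - q) * \<bar>b\<bar> powr q"
      by (intro mult_right_mono) auto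
    moreover have "\<bar>b\<bar> powr (2 - q) * \<bar>b\<bar> powr q = b\<^sup>2"
      using b by (simp flip: powr_add)
    ultimately show ?thesis by (simp add: add_increasing)
  qed
  show ?thesis using 1 2 assms(3) by (simp add: power2_eq_square field_simps)
qed

text \<open>The quadratic estimate is averaged over a ball around \<open>x\<close> whose radius
  depends on \<open>u x\<close>: large enough that the L^q mass of \<open>u\<close> can account for
  only half of the average, so that the rest must come from the energy density at
  \<open>x\<close>.\<close>

lemma sobolev_pointwise:
  fixes s :: real and u :: "'a::euclidean_space \<Rightarrow> real"
  defines "n \<equiv> real DIM('a)"
  defines "q \<equiv> 2 * n / (n - 2 * s)"
  defines "V \<equiv> unit_ball_vol n"
  assumes s: "0 < s" "2 * s < n"
    and u [measurable]: "u \<in> borel_measurable borel"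
    and I: "(\<integral>\<^sup>+y. ennreal (\<bar>u y\<bar> powr q) \<partial>lborel) = ennreal I" "0 < I"
  shows "ennreal (\<bar>u x\<bar> powr q) \<le> ennreal (8 / V * (2 powr (q + 1) / V) powr (2 * s / n) * I powr (2 * s / n))
      * (\<integral>\<^sup>+y. ennreal ((u x - u y)\<^sup>2 * rker s (x - y)) \<partial>lborel)"
proof -
  define a where "a = \<bar>u x\<bar>"
  define g where "g = (\<integral>\<^sup>+y. ennreal ((u x - u y)\<^sup>2 * rker s (x - y)) \<partial>lborel)"
  define C where "C = 8 / V * (2 powr (q + 1) / V) powr (2 * s / n)"
  have n: "0 < n" by (simp add: n_def)
  have q: "2 < q" using s n by (simp add: q_def field_simps)
  have V: "0 < V" using n by (simp add: V_def)
  have C: "0 < C" using V by (simp add: C_def)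
  have "ennreal (a powr q) \<le> ennreal (C * I powr (2 * s / n)) * g"
  proof (cases "a = 0")
    case False
    then have a: "0 < a" by (simp add: a_def)
    show ?thesis
    proof (cases g)
      case top
      then show ?thesis using C I(2) by (simp add: ennreal_mult_top)
    next
      case (real G)
      \<comment> \<open>\<open>m\<close> is the n-th power of the radius, chosen to make
        \<open>w * I\<close> equal to a quarter of a^2 V m, that is, half of the left side below;
        this part is then absorbed.\<close>
      define m where "m = 2 powr (q + 1) / V * (I * a powr - q)"
      define r where "r = m powr (1 / n)"
      have m: "0 < m" unfolding m_def using V I(2) a by (auto intro!: mult_pos_pos divide_pos_pos)
      have r: "0 < r" using m by (simp add: r_def)
      have rn: "r powr n = m" using m n by (simp add: r_def powr_powr)
      define w where "w = 2 * (a / 2) powr (2 - q)"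
      have wI: "w * I = V * m * a\<^sup>2 / 4"
      proof -
        have "V * m * a\<^sup>2 / 4 = (2 powr (q + 1) / 4) * (a powr - q * a powr 2) * I"
          using V a by (simp add: m_def)
        also have "a powr - q * a powr 2 = a powr (2 - q)" by (simp flip: powr_add)
        also have "2 powr (q + 1) / 4 = 2 * 2 powr (q - 2)"
          by (simp add: powr_add powr_diff)
        also have "2 * 2 powr (q - 2) * a powr (2 - q) = w"
          using a by (simp add: w_def powr_divide powr_diff field_simps)
        finally show ?thesis by simp
      qed
      have "ennreal (a\<^sup>2 / 2 * (V * m)) = (\<integral>\<^sup>+y. ennreal (a\<^sup>2 / 2) * indicator (ball x r) y \<partial>lborel)"
      proof -
        have "emeasure lborel (ball x r) = ennreal (V * m)"
          using r rn by (simp add: emeasure_ball V_def n_def powr_realpow)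
        moreover have "ennreal (a\<^sup>2 / 2 * (V * m)) = ennreal (a\<^sup>2 / 2) * ennreal (V * m)"
          using V m by (intro ennreal_mult) auto
        ultimately show ?thesis by (subst nn_integral_cmult_indicator) auto
      qed
      also have "\<dots> \<le> (\<integral>\<^sup>+y. ennreal (2 * r powr (n + 2 * s)) * ennreal ((u x - u y)\<^sup>2 * rker s (x - y))
           + ennreal w * ennreal (\<bar>u y\<bar> powr q) \<partial>lborel)"
      proof (rule nn_integral_mono)
        fix y
        have "a\<^sup>2 / 2 \<le> 2 * r powr (n + 2 * s) * ((u x - u y)\<^sup>2 * rker s (x - y)) + w * \<bar>u y\<bar> powr q"
          if "dist x y < r"
        proof -
          have "(u x - u y)\<^sup>2 \<le> r powr (n + 2 * s) * ((u x - u y)\<^sup>2 * rker s (x - y))"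
          proof (cases "x = y")
            case False
            then have d: "0 < norm (x - y)" by simp
            have "r powr - (n + 2 * s) \<le> rker s (x - y)"
              unfolding rker_def n_def[symmetric] using d that s n
              by (intro powr_mono2') (auto simp: dist_norm)
            then have "r powr (n + 2 * s) * r powr - (n + 2 * s) \<le> r powr (n + 2 * s) * rker s (x - y)"
              by (intro mult_left_mono) auto
            moreover have "r powr (n + 2 * s) * r powr - (n + 2 * s) = 1"
              using r by (simp only: powr_add[symmetric]) simp
            ultimately have "1 * (u x - u y)\<^sup>2 \<le> r powr (n + 2 * s) * rker s (x - y) * (u x - u y)\<^sup>2"
              by (intro mult_right_mono) auto
            then show ?thesis by (simp add: mult_ac)
          qed simp
          moreover have "a\<^sup>2 / 2 \<le> 2 * (u x - u y)\<^sup>2 + w * \<bar>u y\<bar> powr q"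
            unfolding w_def by (rule sobolev_pointwise_quadratic[OF a q]) (simp add: a_def)
          ultimately show ?thesis by simp
        qed
        then show "ennreal (a\<^sup>2 / 2) * indicator (ball x r) y \<le> ennreal (2 * r powr (n + 2 * s)) * ennreal ((u x - u y)\<^sup>2 * rker s (x - y))
           + ennreal w * ennreal (\<bar>u y\<bar> powr q)"
          by (auto simp: indicator_def w_def ennreal_mult[symmetric] ennreal_plus[symmetric] simp del: ennreal_plus intro!: ennreal_leI)
      qed
      also have "\<dots> = ennreal (2 * r powr (n + 2 * s)) * g + ennreal w * ennreal I"
        unfolding I(1)[symmetric] g_def
        by (subst nn_integral_add) (simp_all add: nn_integral_cmult)
      also have "\<dots> = ennreal (2 * r powr (n + 2 * s) * G + w * I)"
        using real I(2) by (simp add: ennreal_mult w_def)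
      finally have "a\<^sup>2 / 2 * (V * m) \<le> 2 * r powr (n + 2 * s) * G + w * I"
        using real I(2) by (subst (asm) ennreal_le_iff) (auto simp: w_def)
      moreover have "w * I = a\<^sup>2 * (V * m) / 4" using wI by (simp add: mult_ac)
      moreover have "r powr (n + 2 * s) = m * r powr (2 * s)" using rn by (simp add: powr_add)
      moreover have "a\<^sup>2 / 2 * (V * m) = a\<^sup>2 * (V * m) / 2" by simp
      ultimately have "a\<^sup>2 * (V * m) \<le> 8 * (m * r powr (2 * s) * G)" by (simp only:)
      then have "m * (a\<^sup>2 * V) \<le> m * (8 * r powr (2 * s) * G)" by (simp only: mult_ac)
      then have "a\<^sup>2 * V \<le> 8 * r powr (2 * s) * G"
        using m by (simp only: mult_le_cancel_left_pos)
      then have a2: "a\<^sup>2 \<le> 8 / V * r powr (2 * s) * G"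
        using V by (simp add: field_simps)
      have r2s: "r powr (2 * s) = (2 powr (q + 1) / V) powr (2 * s / n) * I powr (2 * s / n) * a powr (- q * (2 * s / n))"
        using V I(2) a by (simp add: r_def m_def powr_powr powr_mult powr_divide)
      have "a powr q = a\<^sup>2 * a powr (q * (2 * s / n))"
      proof -
        \<comment> \<open>The critical exponent is characterised by this balance: with it the powers
          of \<open>a\<close> hidden in the radius cancel.\<close>
        have "q = 2 + q * (2 * s / n)"
          using s n by (simp add: q_def field_simps)
        then have "a powr q = a powr 2 * a powr (q * (2 * s / n))"
          by (metis powr_add)
        then show ?thesis using a by simp
      qed
      also have "\<dots> \<le> (8 / V * r powr (2 * s) * G) * a powr (q * (2 * s / n))"
        using a2 by (intro mult_right_mono) auto
      also have "\<dots> = C * I powr (2 * s / n) * G * (a powr (- q * (2 * s / n)) * a powr (q * (2 * s / n)))"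
        by (simp add: r2s C_def)
      also have "a powr (- q * (2 * s / n)) * a powr (q * (2 * s / n)) = 1"
        using a by (simp flip: powr_add)
      finally show ?thesis
        using real C by (simp add: ennreal_mult[symmetric] ennreal_leI)
    qed
  qed simp
  then show ?thesis by (simp add: a_def g_def C_def)
qed

text \<open>The inequality "squared L^q norm at most C times squared seminorm", raised to the power
  q/2 = n/(n - 2s) so that no root of a possibly infinite integral is taken; the real number
  \<open>e\<close> bounds the seminorm for the same reason.\<close>

definition sobolev_bound :: "'a::euclidean_space itself \<Rightarrow> real \<Rightarrow> real \<Rightarrow> bool" where
  "sobolev_bound _ s C \<longleftrightarrow> (\<forall>u\<in>borel_measurable borel. \<forall>e\<ge>0.
     (\<integral>\<^sup>+x. ennreal ((u x)\<^sup>2) \<partial>lborel) < \<infinity> \<longrightarrow> seminorm_sq s (u :: 'a \<Rightarrow> real) \<le> ennreal e \<longrightarrow>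
     (\<integral>\<^sup>+x. ennreal (\<bar>u x\<bar> powr (2 * real DIM('a) / (real DIM('a) - 2 * s))) \<partial>lborel)
       \<le> ennreal ((C * e) powr (real DIM('a) / (real DIM('a) - 2 * s))))"

lemma measurable_gagliardo_inner [measurable]:
  fixes u v :: "'a::euclidean_space \<Rightarrow> real"
  assumes [measurable]: "u \<in> borel_measurable borel" "v \<in> borel_measurable borel"
  shows "(\<lambda>x. \<integral>\<^sup>+y. ennreal ((u x - v y)\<^sup>2 * rker s (x - y)) \<partial>lborel) \<in> borel_measurable borel"
proof -
  have "(\<lambda>(x, y). ennreal ((u x - v y)\<^sup>2 * rker s (x - y))) \<in> borel_measurable (borel \<Otimes>\<^sub>M lborel)"
    by (simp add: case_prod_beta')
  then show ?thesis by (rule lborel.borel_measurable_nn_integral)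
qed

text \<open>Integrating the pointwise bound gives I <= C I^(2s/n) e for I the integral of |u|^q.
  Boundedness together with square integrability makes I finite, so the power of I can be moved to
  the left.\<close>

lemma sobolev_bounded_functions:
  fixes s :: real and u :: "'a::euclidean_space \<Rightarrow> real"
  defines "n \<equiv> real DIM('a)"
  defines "q \<equiv> 2 * n / (n - 2 * s)"
  defines "V \<equiv> unit_ball_vol n"
  assumes s: "0 < s" "2 * s < n"
    and u [measurable]: "u \<in> borel_measurable borel"
    and L2: "(\<integral>\<^sup>+x. ennreal ((u x)\<^sup>2) \<partial>lborel) < \<infinity>"
    and bd: "\<And>x. \<bar>u x\<bar> \<le> N"
    and e: "seminorm_sq s u \<le> ennreal e" "0 \<le> e"
  shows "(\<integral>\<^sup>+y. ennreal (\<bar>u y\<bar> powr q) \<partial>lborel) \<le> ennreal ((8 / V * (2 powr (q + 1) / V) powr (2 * s / n) * e) powr (n / (n - 2 * s)))"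
proof -
  define C where "C = 8 / V * (2 powr (q + 1) / V) powr (2 * s / n)"
  have n: "0 < n" by (simp add: n_def)
  have q: "2 < q" using s n by (simp add: q_def field_simps)
  have V: "0 < V" using n by (simp add: V_def)
  have C: "0 < C" using V by (simp add: C_def)
  have "(\<integral>\<^sup>+y. ennreal (\<bar>u y\<bar> powr q) \<partial>lborel) \<le> (\<integral>\<^sup>+y. ennreal (N powr (q - 2)) * ennreal ((u y)\<^sup>2) \<partial>lborel)"
  proof (rule nn_integral_mono)
    fix y
    have "\<bar>u y\<bar> powr q = \<bar>u y\<bar> powr (q - 2) * (u y)\<^sup>2"
    proof (cases "u y = 0")
      case False
      have "\<bar>u y\<bar> powr q = \<bar>u y\<bar> powr (q - 2) * \<bar>u y\<bar> powr 2" by (simp only: powr_add[symmetric]) simp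
      then show ?thesis using False by simp
    qed simp
    also have "\<dots> \<le> N powr (q - 2) * (u y)\<^sup>2"
      using bd q by (intro mult_right_mono powr_mono2) auto
    finally show "ennreal (\<bar>u y\<bar> powr q) \<le> ennreal (N powr (q - 2)) * ennreal ((u y)\<^sup>2)"
      by (simp add: ennreal_mult[symmetric] ennreal_leI)
  qed
  also have "\<dots> < \<infinity>"
    using L2 by (simp add: nn_integral_cmult ennreal_mult_less_top)
  finally obtain I where I: "(\<integral>\<^sup>+y. ennreal (\<bar>u y\<bar> powr q) \<partial>lborel) = ennreal I" "0 \<le> I"
    by (cases "\<integral>\<^sup>+y. ennreal (\<bar>u y\<bar> powr q) \<partial>lborel") auto
  have "I \<le> (C * e) powr (n / (n - 2 * s))"
  proof (cases "I = 0")
    case False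
    then have Ipos: "0 < I" using I by simp
    note pw = sobolev_pointwise[OF s[unfolded n_def] u I(1)[unfolded q_def n_def] Ipos, folded n_def, folded q_def V_def, folded C_def]
    have "ennreal I \<le> (\<integral>\<^sup>+x. ennreal (C * I powr (2 * s / n)) * (\<integral>\<^sup>+y. ennreal ((u x - u y)\<^sup>2 * rker s (x - y)) \<partial>lborel) \<partial>lborel)"
      unfolding I(1)[symmetric]
      by (rule nn_integral_mono) (rule pw)
    also have "\<dots> = ennreal (C * I powr (2 * s / n)) * seminorm_sq s u"
      by (subst nn_integral_cmult) (simp_all add: gform_def)
    also have "\<dots> \<le> ennreal (C * I powr (2 * s / n)) * ennreal e"
      by (intro mult_left_mono e) auto
    finally have "I \<le> C * I powr (2 * s / n) * e"
      using C e by (simp add: ennreal_mult[symmetric])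
    then have "I * I powr - (2 * s / n) \<le> C * I powr (2 * s / n) * e * I powr - (2 * s / n)"
      by (intro mult_right_mono) auto
    also have "\<dots> = C * e * (I powr (2 * s / n) * I powr - (2 * s / n))"
      by (simp only: mult_ac)
    also have "I powr (2 * s / n) * I powr - (2 * s / n) = 1"
      using Ipos by (simp only: powr_add[symmetric]) simp
    also have "I * I powr - (2 * s / n) = I powr (1 - 2 * s / n)"
      using Ipos by (simp add: powr_diff powr_minus_divide)
    finally have "(I powr (1 - 2 * s / n)) powr (n / (n - 2 * s)) \<le> (C * e) powr (n / (n - 2 * s))"
      using s by (intro powr_mono2) auto
    moreover have "(1 - 2 * s / n) * (n / (n - 2 * s)) = 1"
      using s n by (simp add: field_simps)
    ultimately show ?thesis using Ipos by (simp only: powr_powr) simp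
  qed simp
  then show ?thesis unfolding I(1) C_def by (rule ennreal_leI)
qed

text \<open>For N >= 0 a 1-Lipschitz truncation fixing 0: it increases neither the L^2 norm nor the
  seminorm of a function.\<close>

definition clamp_abs :: "real \<Rightarrow> real \<Rightarrow> real" where
  "clamp_abs N t = max (- N) (min N t)"

lemma measurable_clamp_abs [measurable]: "clamp_abs N \<in> borel_measurable borel"
  unfolding clamp_abs_def by measurable

lemma clamp_abs_bound: "0 \<le> N \<Longrightarrow> \<bar>clamp_abs N t\<bar> \<le> N"
  by (auto simp: clamp_abs_def)

lemma clamp_abs_le: "0 \<le> N \<Longrightarrow> \<bar>clamp_abs N t\<bar> \<le> \<bar>t\<bar>"
  by (auto simp: clamp_abs_def)

lemma clamp_abs_contraction: "\<bar>clamp_abs N t - clamp_abs N r\<bar> \<le> \<bar>t - r\<bar>"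
  by (auto simp: clamp_abs_def max_def min_def)

lemma clamp_abs_contraction_sq: "(clamp_abs N t - clamp_abs N r)\<^sup>2 \<le> (t - r)\<^sup>2"
  using clamp_abs_contraction by (simp add: abs_le_square_iff)

lemma eventually_clamp_abs: "\<forall>\<^sub>F i in sequentially. clamp_abs (real i) t = t"
proof -
  obtain i0 :: nat where "\<bar>t\<bar> \<le> real i0" using real_arch_simple by blast
  then have "clamp_abs (real i) t = t" if "i0 \<le> i" for i
  proof -
    have "real i0 \<le> real i" using that by simp
    then show ?thesis using \<open>\<bar>t\<bar> \<le> real i0\<close> by (auto simp: clamp_abs_def max_def min_def)
  qed
  then show ?thesis unfolding eventually_sequentially by blast
qed

text \<open>The bound for truncations does not depend on the truncation level, so Fatou's lemma
  removes it. Any positive constant will do here: it serves to show that the supremum defining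
  \<open>sobolev_const\<close> is taken over a set with a positive element.\<close>

lemma sobolev_bound_exists:
  fixes s :: real
  assumes s: "0 < s" "2 * s < real DIM('a::euclidean_space)"
  shows "\<exists>C>0. sobolev_bound TYPE('a) s C"
proof -
  define n where "n = real DIM('a)"
  define q where "q = 2 * n / (n - 2 * s)"
  define V where "V = unit_ball_vol n"
  define C where "C = 8 / V * (2 powr (q + 1) / V) powr (2 * s / n)"
  have n: "0 < n" by (simp add: n_def)
  have V: "0 < V" using n by (simp add: V_def)
  have C: "0 < C" using V by (simp add: C_def)
  have *: "(\<integral>\<^sup>+x. ennreal (\<bar>u x\<bar> powr q) \<partial>lborel) \<le> ennreal ((C * e) powr (n / (n - 2 * s)))"
    if u [measurable]: "u \<in> borel_measurable borel" and e: "0 \<le> e" "seminorm_sq s u \<le> ennreal e"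
      and L2: "(\<integral>\<^sup>+x. ennreal ((u x)\<^sup>2) \<partial>lborel) < \<infinity>" for u :: "'a \<Rightarrow> real" and e
  proof (rule nn_integral_le_of_tendsto[where f="\<lambda>i x. ennreal (\<bar>clamp_abs (real i) (u x)\<bar> powr q)"])
    fix i :: nat
    have "(\<integral>\<^sup>+x. ennreal ((clamp_abs (real i) (u x))\<^sup>2) \<partial>lborel) \<le> (\<integral>\<^sup>+x. ennreal ((u x)\<^sup>2) \<partial>lborel)"
      by (intro nn_integral_mono ennreal_leI) (simp add: clamp_abs_le abs_le_square_iff[symmetric])
    also note L2
    finally have 1: "(\<integral>\<^sup>+x. ennreal ((clamp_abs (real i) (u x))\<^sup>2) \<partial>lborel) < \<infinity>" .
    have "seminorm_sq s (\<lambda>x. clamp_abs (real i) (u x)) \<le> seminorm_sq s u"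
      unfolding gform_def
      by (intro nn_integral_mono mult_right_mono ennreal_leI clamp_abs_contraction_sq) auto
    also note e(2)
    finally have 2: "seminorm_sq s (\<lambda>x. clamp_abs (real i) (u x)) \<le> ennreal e" .
    show "(\<integral>\<^sup>+x. ennreal (\<bar>clamp_abs (real i) (u x)\<bar> powr q) \<partial>lborel) \<le> ennreal ((C * e) powr (n / (n - 2 * s)))"
      unfolding C_def q_def V_def n_def
      by (rule sobolev_bounded_functions[where N="real i", OF s _ 1 _ 2 e(1)]) (simp_all add: clamp_abs_bound)
  next
    fix x
    show "(\<lambda>i. ennreal (\<bar>clamp_abs (real i) (u x)\<bar> powr q)) \<longlonglongrightarrow> ennreal (\<bar>u x\<bar> powr q)"
      by (intro tendsto_eventually eventually_mono[OF eventually_clamp_abs[of "u x"]]) simp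
  qed simp
  show ?thesis
    unfolding sobolev_bound_def n_def[symmetric] q_def[symmetric]
    by (intro exI[of _ C] conjI C ballI allI impI *)
qed

section \<open>Positive definiteness of the reflected kernel\<close>

text \<open>The characteristic function of the standard normal distribution, rescaled by
  \<open>c = 1 / sqrt (2 * w)\<close>.\<close>

lemma gaussian_fourier_1d:
  fixes w t :: real
  assumes w: "0 < w"
  shows "has_bochner_integral lborel (\<lambda>x. complex_of_real (exp (- (x\<^sup>2 / (4 * w)))) * iexp (x * t))
    (complex_of_real (sqrt (4 * pi * w) * exp (- (w * t\<^sup>2))))"
proof -
  define c where "c = 1 / sqrt (2 * w)"
  define f where "f r x = complex_of_real (std_normal_density x) * iexp (r * x)" for r x
  have c: "c \<noteq> 0" "\<bar>c\<bar> = 1 / sqrt (2 * w)" using w by (auto simp: c_def)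
  have [measurable]: "f r \<in> borel_measurable borel" for r
    unfolding f_def by (intro borel_measurable_times borel_measurable_continuous_onI[of "\<lambda>x. iexp (r * x)"]) (auto intro!: continuous_intros)
  have "integrable lborel (f r)" for r
    by (rule Bochner_Integration.integrable_bound[of _ std_normal_density])
      (auto simp: f_def norm_mult intro!: AE_I2)
  moreover have "(LINT x|lborel. f r x) = complex_of_real (exp (- (r\<^sup>2) / 2))" for r
  proof -
    have "char std_normal_distribution r = (LINT x|lborel. f r x)"
      unfolding char_def f_def by (subst integral_density) (auto simp: scaleR_conv_of_real)
    then show ?thesis by (simp add: char_std_normal_distribution)
  qed
  ultimately have "has_bochner_integral lborel (f r) (complex_of_real (exp (- (r\<^sup>2) / 2)))" for r
    by (simp add: has_bochner_integral_iff)
  from lborel_has_bochner_integral_real_affine_iff[OF c(1), THEN iffD1, OF this[of "t * sqrt (2 * w)"], of 0]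
  have "has_bochner_integral lborel (\<lambda>x. complex_of_real (sqrt (2 * pi)) * f (t * sqrt (2 * w)) (0 + c * x))
      (complex_of_real (sqrt (2 * pi)) * (complex_of_real (exp (- ((t * sqrt (2 * w))\<^sup>2) / 2)) /\<^sub>R \<bar>c\<bar>))"
    by (rule has_bochner_integral_mult_right)
  moreover have "complex_of_real (sqrt (2 * pi)) * f (t * sqrt (2 * w)) (0 + c * x)
      = complex_of_real (exp (- (x\<^sup>2 / (4 * w)))) * iexp (x * t)" for x
  proof -
    have 1: "t * sqrt (2 * w) * (c * x) = x * t" using w by (simp add: c_def)
    have 2: "sqrt (2 * pi) * std_normal_density (c * x) = exp (- (x\<^sup>2 / (4 * w)))"
      using w by (simp add: std_normal_density_def c_def power_mult_distrib power_divide)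
    show ?thesis unfolding f_def add_0_left 1 2[symmetric] by (simp add: mult_ac)
  qed
  moreover have "complex_of_real (sqrt (2 * pi)) * (complex_of_real (exp (- ((t * sqrt (2 * w))\<^sup>2) / 2)) /\<^sub>R \<bar>c\<bar>)
      = complex_of_real (sqrt (4 * pi * w) * exp (- (w * t\<^sup>2)))"
  proof -
    have "sqrt (2 * pi) * sqrt (2 * w) = sqrt (4 * pi * w)"
      by (simp only: real_sqrt_mult[symmetric]) (simp add: mult_ac)
    moreover have "- ((t * sqrt (2 * w))\<^sup>2) / 2 = - (w * t\<^sup>2)" using w by (simp add: power_mult_distrib)
    ultimately show ?thesis
      unfolding c(2) by (simp add: scaleR_conv_of_real mult_ac flip: of_real_mult)
  qed
  ultimately show ?thesis by simp
qed

text \<open>Gaussian and character both factor over the coordinates, so the complex integral is a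
  product of one-dimensional ones; its value is real, and taking real parts turns the character into
  a cosine.\<close>

lemma gaussian_fourier:
  fixes z :: "'a::euclidean_space"
  assumes w: "0 < w"
  shows "has_bochner_integral lborel (\<lambda>\<xi>. exp (- ((norm \<xi>)\<^sup>2 / (4 * w))) * cos (\<xi> \<bullet> z))
    ((4 * pi * w) powr (real DIM('a) / 2) * exp (- (w * (norm z)\<^sup>2)))"
proof -
  interpret product_sigma_finite "\<lambda>_::'a. lborel :: real measure" ..
  let ?f = "\<lambda>b x. complex_of_real (exp (- (x\<^sup>2 / (4 * w)))) * iexp (x * (z \<bullet> b))"
  let ?e = "\<lambda>g::'a \<Rightarrow> real. \<Sum>b\<in>Basis. g b *\<^sub>R b"
  let ?F = "\<lambda>\<xi>. complex_of_real (exp (- ((norm \<xi>)\<^sup>2 / (4 * w)))) * iexp (\<xi> \<bullet> z)"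
  have int: "integrable lborel (?f b)" and val: "(LINT x|lborel. ?f b x) = complex_of_real (sqrt (4 * pi * w) * exp (- (w * (z \<bullet> b)\<^sup>2)))" for b
    using gaussian_fourier_1d[OF w, of "z \<bullet> b"] by (simp_all add: has_bochner_integral_iff)
  have prod: "?F (?e g) = (\<Prod>b\<in>Basis. ?f b (g b))" for g
  proof -
    have "(norm (?e g))\<^sup>2 = (\<Sum>b\<in>Basis. (g b)\<^sup>2)"
      unfolding norm_eq_sqrt_inner by (subst real_sqrt_pow2) (auto simp: inner_sum_left inner_sum_right inner_Basis if_distrib[of "\<lambda>x. _ * x"] sum.If_cases power2_eq_square sum.delta sum_nonneg cong: if_cong)
    moreover have "?e g \<bullet> z = (\<Sum>b\<in>Basis. g b * (z \<bullet> b))"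
      by (simp add: inner_sum_left) (simp add: inner_commute)
    ultimately show ?thesis
      by (simp add: prod.distrib exp_sum sum_divide_distrib sum_negf[symmetric] sum_distrib_left of_real_prod[symmetric] flip: exp_of_real)
  qed
  have "has_bochner_integral (\<Pi>\<^sub>M b\<in>(Basis::'a set). lborel) (\<lambda>g. ?F (?e g)) (\<Prod>b\<in>Basis. complex_of_real (sqrt (4 * pi * w) * exp (- (w * (z \<bullet> b)\<^sup>2))))"
    unfolding has_bochner_integral_iff prod
    using product_integrable_prod[of Basis ?f] product_integral_prod[of Basis ?f] int val by simp
  then have "has_bochner_integral (distr (\<Pi>\<^sub>M b\<in>(Basis::'a set). lborel) borel ?e) ?F (\<Prod>b\<in>Basis. complex_of_real (sqrt (4 * pi * w) * exp (- (w * (z \<bullet> b)\<^sup>2))))"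
    by (subst has_bochner_integral_distr) auto
  then have "has_bochner_integral lborel ?F (\<Prod>b\<in>(Basis::'a set). complex_of_real (sqrt (4 * pi * w) * exp (- (w * (z \<bullet> b)\<^sup>2))))"
    by (simp add: lborel_eq[symmetric])
  from has_bochner_integral_Re[OF this]
  have "has_bochner_integral lborel (\<lambda>\<xi>. exp (- ((norm \<xi>)\<^sup>2 / (4 * w))) * cos (\<xi> \<bullet> z))
      (\<Prod>b\<in>(Basis::'a set). sqrt (4 * pi * w) * exp (- (w * (z \<bullet> b)\<^sup>2)))"
    unfolding of_real_prod[symmetric] Re_complex_of_real
    by (simp add: cis_conv_exp[symmetric])
  moreover have "(\<Prod>b\<in>(Basis::'a set). sqrt (4 * pi * w) * exp (- (w * (z \<bullet> b)\<^sup>2)))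
     = (4 * pi * w) powr (real DIM('a) / 2) * exp (- (w * (norm z)\<^sup>2))"
  proof -
    have "(norm z)\<^sup>2 = (\<Sum>b\<in>Basis. (z \<bullet> b)\<^sup>2)"
      by (simp add: norm_eq_sqrt_inner euclidean_inner[of z z] sum_nonneg power2_eq_square)
    moreover have "sqrt (4 * pi * w) ^ DIM('a) = (4 * pi * w) powr (real DIM('a) / 2)"
      using w by (simp add: powr_half_sqrt[symmetric] powr_realpow[symmetric] powr_powr)
    ultimately show ?thesis
      by (simp add: prod.distrib exp_sum[symmetric] sum_negf sum_distrib_left)
  qed
  ultimately show ?thesis by simp
qed

text \<open>Euler's integral for Gamma after the substitution of \<open>A * t\<close> for
  \<open>t\<close>.\<close>

lemma gamma_laplace:
  fixes a A :: real
  assumes "0 < a" "0 < A"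
  shows "has_bochner_integral lborel (\<lambda>t. indicator {0<..} t * (t powr (a - 1) * exp (- (A * t)))) (Gamma a * A powr - a)"
proof -
  have "has_bochner_integral lborel (\<lambda>t. indicator {0..} t * t powr (a - 1) / exp t) (Gamma a)"
    using assms by (intro has_bochner_integral_nn_integral) (auto simp: Gamma_conv_nn_integral_real[symmetric] Gamma_real_nonneg)
  from lborel_has_bochner_integral_real_affine_iff[of A, THEN iffD1, OF _ this, of 0]
  have "has_bochner_integral lborel (\<lambda>t. A powr (1 - a) * (indicator {0..} (A * t) * (A * t) powr (a - 1) / exp (A * t)))
     (A powr (1 - a) * (Gamma a /\<^sub>R A))"
    using assms by (intro has_bochner_integral_mult_right) auto
  moreover have "A powr (1 - a) * (indicator {0..} (A * t) * (A * t) powr (a - 1) / exp (A * t))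
     = indicator {0<..} t * (t powr (a - 1) * exp (- (A * t)))" for t
  proof (cases "0 < t")
    case True
    have "A powr (1 - a) * A powr (a - 1) = 1" using assms by (simp flip: powr_add)
    moreover have "A powr (1 - a) * (indicator {0..} (A * t) * (A * t) powr (a - 1) / exp (A * t))
       = (A powr (1 - a) * A powr (a - 1)) * (t powr (a - 1) / exp (A * t))"
      using True assms by (simp add: powr_mult mult_ac)
    ultimately show ?thesis using True by (simp add: exp_minus divide_inverse)
  next
    \<comment> \<open>At t = 0 the indicators of \<open>{0..}\<close> and \<open>{0<..}\<close>
      differ, but the convention \<open>0 powr (a - 1) = 0\<close> removes the discrepancy.\<close>
    case False
    then show ?thesis using assms by (auto simp: indicator_def zero_le_mult_iff)
  qed
  moreover have "A powr (1 - a) * (Gamma a /\<^sub>R A) = Gamma a * A powr - a"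
    using assms by (simp add: powr_diff powr_minus field_simps)
  ultimately show ?thesis by (simp only:)
qed

text \<open>The density is continuous and has an antiderivative; the distribution has no atoms, so
  the distribution function differs from that antiderivative by a constant.\<close>

lemma std_normal_cdf_derivative:
  "(cdf std_normal_distribution has_real_derivative std_normal_density x) (at x)"
proof -
  interpret real_distribution std_normal_distribution by (rule real_dist_normal_dist)
  let ?M = "std_normal_distribution"
  have cont: "isCont std_normal_density x" for x
    unfolding std_normal_density_def by (intro continuous_intros) auto
  obtain F where F: "\<And>x. (F has_vector_derivative std_normal_density x) (at x)"
    using einterval_antiderivative[of "-\<infinity>" "\<infinity>" std_normal_density] cont by auto
  have diff: "cdf ?M u - cdf ?M v = F u - F v" if "v < u" for u v
  proof -
    have nn: "emeasure ?M {v..u} = ennreal (F u - F v)"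
      using that F
      by (subst emeasure_density)
         (auto intro!: nn_integral_FTC_Icc simp: has_real_derivative_iff_has_vector_derivative
           intro: has_vector_derivative_at_within)
    have mono: "F v \<le> F u"
      using that F by (intro DERIV_nonneg_imp_nondecreasing[of v u F])
        (auto simp: has_real_derivative_iff_has_vector_derivative[symmetric] intro!: exI)
    have "emeasure ?M {v} = 0"
      by (subst emeasure_density) (auto simp: nn_integral_indicator_singleton')
    then have "measure ?M {v} = 0" by (simp add: measure_def)
    moreover have "{v..u} = {v<..u} \<union> {v}" using that by auto
    ultimately have "measure ?M {v..u} = measure ?M {v<..u}"
      using finite_measure_Union[of "{v<..u}" "{v}"] by simp
    then show ?thesis
      using that nn mono by (simp add: cdf_diff_eq measure_def)
  qed
  have eq: "cdf ?M = (\<lambda>u. F u + (cdf ?M 0 - F 0))"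
  proof
    fix u show "cdf ?M u = F u + (cdf ?M 0 - F 0)"
      using diff[of 0 u] diff[of u 0] by (cases u "0::real" rule: linorder_cases) auto
  qed
  have "((\<lambda>u. F u + (cdf ?M 0 - F 0)) has_real_derivative std_normal_density x) (at x)"
    using F[of x] by (auto intro!: derivative_eq_intros simp: has_real_derivative_iff_has_vector_derivative[symmetric])
  then show ?thesis by (subst eq)
qed

text \<open>Subordination: integrating heat-type exponentials in w against the Levy weight produces
  exp(-t rho), in which t^2 has become t. An explicit antiderivative exists in terms of the normal
  distribution function.\<close>

lemma levy_laplace:
  fixes t \<rho> :: real
  assumes t: "0 < t" and rho: "0 < \<rho>"
  shows "has_bochner_integral lborel (\<lambda>w. indicator {0<..} w * (w powr (- 3 / 2) * exp (- (w * t\<^sup>2) - \<rho>\<^sup>2 / (4 * w))))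
    (2 * sqrt pi / \<rho> * exp (- (t * \<rho>)))"
proof -
  interpret real_distribution std_normal_distribution by (rule real_dist_normal_dist)
  define \<Phi> where "\<Phi> = cdf std_normal_distribution"
  define A where "A w = sqrt 2 * (t * sqrt w - \<rho> / (2 * sqrt w))" for w
  define B where "B w = sqrt 2 * (t * sqrt w + \<rho> / (2 * sqrt w))" for w
  define c where "c = 2 * sqrt pi / \<rho>"
  \<comment> \<open>Found by completing the square: \<open>(A w)\<^sup>2 / 2\<close> is w t^2 +
    rho^2 / (4 w) minus t rho, and for \<open>B\<close> plus t rho, so the outer exponentials leave
    the same Gaussian twice. In the difference the t-parts of the derivatives of \<open>A\<close>
    and \<open>B\<close> cancel and the rho-parts add up to the power w^(-3/2).\<close>
  define F where "F w = c * (exp (- (t * \<rho>)) * \<Phi> (A w) - exp (t * \<rho>) * \<Phi> (B w))" for w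
  define f where "f w = w powr (- 3 / 2) * exp (- (w * t\<^sup>2) - \<rho>\<^sup>2 / (4 * w))" for w
  have Phi: "(\<Phi> has_real_derivative std_normal_density x) (at x)" for x
    unfolding \<Phi>_def by (rule std_normal_cdf_derivative)
  have top: "(\<Phi> \<longlongrightarrow> 1) at_top" and bot: "(\<Phi> \<longlongrightarrow> 0) at_bot"
    unfolding \<Phi>_def by (rule cdf_lim_at_top_prob, rule cdf_lim_at_bot)
  have dF: "(F has_real_derivative f w) (at w)" if w: "0 < w" for w
  proof -
    have dA: "(A has_real_derivative sqrt 2 * (t / (2 * sqrt w) + \<rho> / (4 * w * sqrt w))) (at w)"
      unfolding A_def using w by (auto intro!: derivative_eq_intros simp: field_simps)
    have dB: "(B has_real_derivative sqrt 2 * (t / (2 * sqrt w) - \<rho> / (4 * w * sqrt w))) (at w)"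
      unfolding B_def using w by (auto intro!: derivative_eq_intros simp: field_simps)
    define h where "h = exp (- (w * t\<^sup>2) - \<rho>\<^sup>2 / (4 * w)) / sqrt (2 * pi)"
    have hA: "exp (- (t * \<rho>)) * std_normal_density (A w) = h"
    proof -
      have "- (A w)\<^sup>2 / 2 = - (w * t\<^sup>2) - \<rho>\<^sup>2 / (4 * w) + t * \<rho>"
        using w by (simp add: A_def power_mult_distrib power2_diff power_divide field_simps)
      then show ?thesis by (simp add: std_normal_density_def h_def exp_add[symmetric])
    qed
    have hB: "exp (t * \<rho>) * std_normal_density (B w) = h"
    proof -
      have "- (B w)\<^sup>2 / 2 = - (w * t\<^sup>2) - \<rho>\<^sup>2 / (4 * w) - t * \<rho>"
        using w by (simp add: B_def power_mult_distrib power2_sum power_divide field_simps)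
      then show ?thesis by (simp add: std_normal_density_def h_def exp_add[symmetric])
    qed
    have "(F has_real_derivative c * (exp (- (t * \<rho>)) * (std_normal_density (A w) * (sqrt 2 * (t / (2 * sqrt w) + \<rho> / (4 * w * sqrt w))))
        - exp (t * \<rho>) * (std_normal_density (B w) * (sqrt 2 * (t / (2 * sqrt w) - \<rho> / (4 * w * sqrt w)))))) (at w)"
      unfolding F_def
      by (intro DERIV_cmult DERIV_diff DERIV_chain2[OF Phi] dA dB)
    also have "c * (exp (- (t * \<rho>)) * (std_normal_density (A w) * (sqrt 2 * (t / (2 * sqrt w) + \<rho> / (4 * w * sqrt w))))
        - exp (t * \<rho>) * (std_normal_density (B w) * (sqrt 2 * (t / (2 * sqrt w) - \<rho> / (4 * w * sqrt w)))))
       = c * (h * sqrt 2 * (\<rho> / (2 * w * sqrt w)))"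
      unfolding mult.assoc[symmetric] hA hB by (simp add: algebra_simps)
    also have "\<dots> = f w"
    proof -
      have "w powr (- 3 / 2) = 1 / (w * sqrt w)"
      proof -
        have "w powr (3 / 2) = w powr 1 * w powr (1 / 2)" by (simp only: powr_add[symmetric]) simp
        also have "\<dots> = w * sqrt w" using w by (simp add: powr_half_sqrt)
        finally show ?thesis by (simp add: powr_minus_divide)
      qed
      then show ?thesis
        using w rho by (simp add: c_def h_def f_def real_sqrt_mult field_simps)
    qed
    finally show ?thesis .
  qed
  \<comment> \<open>\<open>F\<close> rises from -c exp(t rho) at 0 to c (exp(-t rho) - exp(t rho))
    at infinity; the increment is the claimed value.\<close>
  have A0: "filterlim A at_bot (at_right 0)" and B0: "filterlim B at_top (at_right 0)"
    and A1: "filterlim A at_top at_top" and B1: "filterlim B at_top at_top"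
    unfolding A_def B_def using t rho by real_asymp+
  have lim0: "(F \<longlongrightarrow> c * (exp (- (t * \<rho>)) * 0 - exp (t * \<rho>) * 1)) (at_right 0)"
    unfolding F_def by (intro tendsto_intros filterlim_compose[OF bot A0] filterlim_compose[OF top B0])
  have lim1: "(F \<longlongrightarrow> c * (exp (- (t * \<rho>)) * 1 - exp (t * \<rho>) * 1)) at_top"
    unfolding F_def by (intro tendsto_intros filterlim_compose[OF top A1] filterlim_compose[OF top B1])
  have ein: "einterval 0 \<infinity> = {0<..}" by (auto simp: einterval_def)
  have d: "(F has_real_derivative f w) (at w)" "isCont f w" "0 \<le> f w" if "0 < ereal w" "ereal w < \<infinity>" for w
    using that dF unfolding f_def by (auto intro!: continuous_intros)
  have l0: "((F \<circ> real_of_ereal) \<longlongrightarrow> c * (exp (- (t * \<rho>)) * 0 - exp (t * \<rho>) * 1)) (at_right 0)"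
    using lim0 unfolding zero_ereal_def by (simp add: ereal_tendsto_simps1)
  have l1: "((F \<circ> real_of_ereal) \<longlongrightarrow> c * (exp (- (t * \<rho>)) * 1 - exp (t * \<rho>) * 1)) (at_left \<infinity>)"
    using lim1 by (simp add: ereal_tendsto_simps1)
  have "AE w in lborel. 0 < ereal w \<longrightarrow> ereal w < \<infinity> \<longrightarrow> 0 \<le> f w"
    using d(3) by auto
  note interval_integral_FTC_nonneg[OF _ d(1,2) this l0 l1]
  then have "has_bochner_integral lborel (\<lambda>w. indicator {0<..} w * f w) (c * exp (- (t * \<rho>)))"
    unfolding set_integrable_def interval_lebesgue_integral_def set_lebesgue_integral_def ein has_bochner_integral_iff
    by (simp add: algebra_simps)
  then show ?thesis by (simp add: f_def c_def)
qed

lemma has_bochner_integral_prod: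
  fixes f :: "'a::euclidean_space \<Rightarrow> real" and g :: "'b::euclidean_space \<Rightarrow> real"
  assumes f: "has_bochner_integral lborel f a" and g: "has_bochner_integral lborel g b"
  shows "has_bochner_integral lborel (\<lambda>p. f (fst p) * g (snd p)) (a * b)"
proof -
  have fi: "integrable lborel f" "integrable lborel g" and val: "integral\<^sup>L lborel f = a" "integral\<^sup>L lborel g = b"
    using f g by (auto simp: has_bochner_integral_iff)
  have [measurable]: "f \<in> borel_measurable borel" "g \<in> borel_measurable borel"
    using fi by auto
  have int: "integrable (lborel \<Otimes>\<^sub>M lborel) (\<lambda>p. f (fst p) * g (snd p))"
    by (rule lborel_pair.Fubini_integrable) (use fi in \<open>auto simp: abs_mult\<close>)
  have "integral\<^sup>L (lborel \<Otimes>\<^sub>M lborel) (\<lambda>p. f (fst p) * g (snd p)) = a * b"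
    by (subst lborel_pair.integral_fst'[OF int, symmetric]) (simp add: val)
  with int show ?thesis by (simp add: has_bochner_integral_iff lborel_prod)
qed

section \<open>Spectral representation of the kernel\<close>

text \<open>The first component of \<open>p\<close> is a frequency, the second a mass q > 0. For
  fixed q, integrating exp(-t rho) / rho against cos(xi . z), with rho^2 = |xi|^2 + q, gives a
  multiple of the Green function of -Laplace + q in n + 1 variables at (t, z); the weight q^(s -
  1/2) superposes these into a pure power.\<close>

definition spectral_density :: "real \<Rightarrow> real \<Rightarrow> 'a::euclidean_space \<times> real \<Rightarrow> real" where
  "spectral_density s t p = indicator {0<..} (snd p) * (snd p powr (s - 1 / 2) *
     (exp (- (t * sqrt ((norm (fst p))\<^sup>2 + snd p))) / sqrt ((norm (fst p))\<^sup>2 + snd p)))"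

lemma spectral_density_nonneg: "0 \<le> spectral_density s t p"
  by (auto simp: spectral_density_def indicator_def)

lemma measurable_spectral_density [measurable]: "spectral_density s t \<in> borel_measurable borel"
  unfolding spectral_density_def borel_prod[symmetric] by measurable

text \<open>The inner kernel is an integral of \<open>e\<^sup>-\<^sup>t\<^sup>\<rho> cos (\<xi> \<bullet> z)\<close>, in which \<open>t\<close> enters only
  through an exponential. This is what makes the reflected kernel positive definite.\<close>

lemma kernel_spectral_representation:
  fixes s :: real
  assumes s: "0 < s"
  obtains C where "0 < C"
    "\<And>t (z::'a::euclidean_space). 0 < t \<Longrightarrow>
      has_bochner_integral lborel (\<lambda>p. spectral_density s t p * cos (fst p \<bullet> z))
        (C * (t\<^sup>2 + (norm z)\<^sup>2) powr - (real DIM('a) / 2 + s))"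
proof -
  define n where "n = real DIM('a)"
  \<comment> \<open>\<open>K\<close> collects the constants of the Gaussian transform and of the
    Gamma integral over the mass. \<open>C\<close> adds the outer Gamma integral and divides by the
    constant 2 sqrt(pi) from the Levy integral.\<close>
  define K where "K = (4 * pi) powr (n / 2) * (Gamma (s + 1 / 2) * 4 powr (s + 1 / 2))"
  define C where "C = K * Gamma (n / 2 + s) / (2 * sqrt pi)"
  have npos: "0 < n" by (simp add: n_def)
  have K: "0 < K" unfolding K_def using s by (intro mult_pos_pos Gamma_real_pos) auto
  have C: "0 < C" unfolding C_def using s npos K by (intro mult_pos_pos divide_pos_pos Gamma_real_pos) auto
  have main: "has_bochner_integral lborel (\<lambda>p. spectral_density s t p * cos (fst p \<bullet> z))
        (C * (t\<^sup>2 + (norm z)\<^sup>2) powr - (n / 2 + s))" if t: "0 < t" for t and z :: 'a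
  proof -
    \<comment> \<open>A common integrand in (w, frequency, mass), integrated in two orders.
      Frequency and mass first leaves a Gamma integral in w, which is the power of t^2 + |z|^2; w
      first is the Levy integral and leaves the spectral density.\<close>
    define f where "f z p = indicator {0<..} (fst p) * (fst p powr (- 3 / 2) * exp (- (fst p * t\<^sup>2))) *
        (exp (- ((norm (fst (snd p)))\<^sup>2 / (4 * fst p))) * cos (fst (snd p) \<bullet> z) *
         (indicator {0<..} (snd (snd p)) * (snd (snd p) powr (s - 1 / 2) * exp (- (snd (snd p) / (4 * fst p))))))"
      for z :: 'a and p :: "real \<times> 'a \<times> real"
    have fm [measurable]: "f z \<in> borel_measurable (lborel \<Otimes>\<^sub>M lborel)" for z
      unfolding f_def lborel_prod[symmetric] by measurable
    have inner: "has_bochner_integral lborel (\<lambda>\<omega>. f z (w, \<omega>))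
        (K * (indicator {0<..} w * (w powr (n / 2 + s - 1) * exp (- ((t\<^sup>2 + (norm z)\<^sup>2) * w)))))" for w z
    proof (cases "0 < w")
      case True
      have "has_bochner_integral lborel (\<lambda>q. indicator {0<..} q * (q powr (s - 1 / 2) * exp (- (q / (4 * w)))))
         (Gamma (s + 1 / 2) * (4 * w) powr (s + 1 / 2))"
      proof -
        have pw: "(1 / x) powr - a = x powr a" if "0 < x" for x a :: real
          using that by (simp add: powr_divide powr_minus_divide)
        have "(1 / (4 * w)) powr - (s + 1 / 2) = (4 * w) powr (s + 1 / 2)" using True by (intro pw) simp
        then show ?thesis
          using gamma_laplace[of "s + 1 / 2" "1 / (4 * w)"] True s by (simp del: minus_add_distrib)
      qed
      from has_bochner_integral_prod[OF gaussian_fourier[OF True, of z] this]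
      have "has_bochner_integral lborel (\<lambda>\<omega>. f z (w, \<omega>))
         (w powr (- 3 / 2) * exp (- (w * t\<^sup>2)) * (((4 * pi * w) powr (n / 2) * exp (- (w * (norm z)\<^sup>2))) *
           (Gamma (s + 1 / 2) * (4 * w) powr (s + 1 / 2))))"
        unfolding f_def n_def using True by (simp add: has_bochner_integral_mult_right)
      moreover have "w powr (- 3 / 2) * exp (- (w * t\<^sup>2)) * (((4 * pi * w) powr (n / 2) * exp (- (w * (norm z)\<^sup>2))) *
           (Gamma (s + 1 / 2) * (4 * w) powr (s + 1 / 2)))
          = K * (w powr (- 3 / 2) * w powr (n / 2) * w powr (s + 1 / 2)) * (exp (- (w * t\<^sup>2)) * exp (- (w * (norm z)\<^sup>2)))"
        using True by (simp add: K_def powr_mult mult_ac)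
      moreover have "w powr (- 3 / 2) * w powr (n / 2) * w powr (s + 1 / 2) = w powr (n / 2 + s - 1)"
        by (simp only: powr_add[symmetric]) (rule arg_cong[where f="(powr) w"], simp)
      moreover have "exp (- (w * t\<^sup>2)) * exp (- (w * (norm z)\<^sup>2)) = exp (- ((t\<^sup>2 + (norm z)\<^sup>2) * w))"
        by (simp add: exp_add[symmetric] algebra_simps)
      ultimately have "has_bochner_integral lborel (\<lambda>\<omega>. f z (w, \<omega>)) (K * w powr (n / 2 + s - 1) * exp (- ((t\<^sup>2 + (norm z)\<^sup>2) * w)))"
        by (simp only:)
      then show ?thesis using True by (simp add: mult.assoc)
    qed (simp add: f_def has_bochner_integral_zero)
    have outer: "has_bochner_integral lborel
        (\<lambda>w. K * (indicator {0<..} w * (w powr (n / 2 + s - 1) * exp (- ((t\<^sup>2 + (norm z)\<^sup>2) * w)))))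
        (K * (Gamma (n / 2 + s) * (t\<^sup>2 + (norm z)\<^sup>2) powr - (n / 2 + s)))" for z :: 'a
      using s npos t by (intro has_bochner_integral_mult_right gamma_laplace) (auto intro: add_pos_nonneg)
    \<comment> \<open>At z = 0 the cosine is 1, so the integrand is nonnegative and dominates the
      one for every other z. Integrability at z = 0 thus justifies Fubini for all z.\<close>
    have f0: "0 \<le> f 0 p" for p by (auto simp: f_def)
    have "integrable (lborel \<Otimes>\<^sub>M lborel) (f 0)"
    proof (rule lborel_pair.Fubini_integrable[OF fm])
      have "(LINT \<omega>|lborel. norm (f 0 (w, \<omega>))) = K * (indicator {0<..} w * (w powr (n / 2 + s - 1) * exp (- ((t\<^sup>2 + (norm (0::'a))\<^sup>2) * w))))" for w
        using inner[where z=0] f0 by (simp add: has_bochner_integral_iff)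
      then show "integrable lborel (\<lambda>w. LINT \<omega>|lborel. norm (f 0 (w, \<omega>)))"
        using outer[of 0] by (simp only: has_bochner_integral_iff)
      show "AE w in lborel. integrable lborel (\<lambda>\<omega>. f 0 (w, \<omega>))"
        using inner[where z=0] by (auto simp: has_bochner_integral_iff)
    qed
    then have fint: "integrable (lborel \<Otimes>\<^sub>M lborel) (f z)"
      by (rule Bochner_Integration.integrable_bound[OF _ fm])
        (auto simp: f_def abs_mult intro!: AE_I2 mult_left_mono mult_right_mono mult_left_le)
    have swap: "(LINT w|lborel. f z (w, \<omega>)) = 2 * sqrt pi * (spectral_density s t \<omega> * cos (fst \<omega> \<bullet> z))" for \<omega>
    proof (cases "0 < snd \<omega>")
      case True
      define \<rho> where "\<rho> = sqrt ((norm (fst \<omega>))\<^sup>2 + snd \<omega>)"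
      have rho: "0 < \<rho>" "\<rho>\<^sup>2 = (norm (fst \<omega>))\<^sup>2 + snd \<omega>" using True by (auto simp: \<rho>_def add_nonneg_pos)
      have "f z (w, \<omega>) = snd \<omega> powr (s - 1 / 2) * cos (fst \<omega> \<bullet> z) *
          (indicator {0<..} w * (w powr (- 3 / 2) * exp (- (w * t\<^sup>2) - \<rho>\<^sup>2 / (4 * w))))" for w
      proof -
        have "exp (- (w * t\<^sup>2) - \<rho>\<^sup>2 / (4 * w)) = exp (- (w * t\<^sup>2)) * (exp (- ((norm (fst \<omega>))\<^sup>2 / (4 * w))) * exp (- (snd \<omega> / (4 * w))))"
          unfolding rho by (simp add: exp_add[symmetric] add_divide_distrib)
        then show ?thesis using True by (simp add: f_def mult_ac)
      qed
      then have "(LINT w|lborel. f z (w, \<omega>)) = snd \<omega> powr (s - 1 / 2) * cos (fst \<omega> \<bullet> z) * (2 * sqrt pi / \<rho> * exp (- (t * \<rho>)))"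
        using levy_laplace[OF t rho(1)] by (simp add: has_bochner_integral_iff)
      then show ?thesis using True by (simp add: spectral_density_def \<rho>_def[symmetric] mult_ac)
    qed (simp add: f_def spectral_density_def)
    have "has_bochner_integral lborel (\<lambda>\<omega>. LINT w|lborel. f z (w, \<omega>)) (K * (Gamma (n / 2 + s) * (t\<^sup>2 + (norm z)\<^sup>2) powr - (n / 2 + s)))"
      using lborel_pair.Fubini_integral[of "\<lambda>w \<omega>. f z (w, \<omega>)"] lborel_pair.integrable_snd[of "\<lambda>w \<omega>. f z (w, \<omega>)"] fint inner[of z] outer[of z]
      by (simp add: has_bochner_integral_iff)
    then have "has_bochner_integral lborel (\<lambda>\<omega>. 1 / (2 * sqrt pi) * (2 * sqrt pi * (spectral_density s t \<omega> * cos (fst \<omega> \<bullet> z))))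
       (1 / (2 * sqrt pi) * (K * (Gamma (n / 2 + s) * (t\<^sup>2 + (norm z)\<^sup>2) powr - (n / 2 + s))))"
      unfolding swap by (rule has_bochner_integral_mult_right)
    then show ?thesis by (simp add: C_def mult.assoc)
  qed
  show ?thesis by (rule that[OF C main[unfolded n_def]])
qed

section \<open>Positive definite forms from the spectral representation\<close>

text \<open>After exchanging the integrals, each spectral parameter contributes its weight times the
  sum of the squares of the integrals of f a and f b. The bounds by 1 make the exchange
  legitimate.\<close>

lemma symmetric_exponential_form_nonneg:
  fixes f :: "'a::euclidean_space \<Rightarrow> real" and G :: "'b::euclidean_space \<Rightarrow> real"
  assumes f: "integrable lborel f" and G: "integrable lborel G" "\<And>\<omega>. 0 \<le> G \<omega>"
    and a: "(\<lambda>p. a (fst p) (snd p)) \<in> borel_measurable borel" "\<And>\<omega> x. \<bar>a \<omega> x\<bar> \<le> 1"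
    and b: "(\<lambda>p. b (fst p) (snd p)) \<in> borel_measurable borel" "\<And>\<omega> x. \<bar>b \<omega> x\<bar> \<le> (1::real)"
    and h: "\<And>x y. h x y = (LINT \<omega>|lborel. G \<omega> * (a \<omega> x * a \<omega> y + b \<omega> x * b \<omega> y))"
  shows "0 \<le> (LINT p|lborel. f (fst p) * f (snd p) * h (fst p) (snd p))"
proof -
  have [measurable]: "f \<in> borel_measurable borel" "G \<in> borel_measurable borel" using f G by auto
  have am [measurable]: "(\<lambda>q. a (g q) (k q)) \<in> borel_measurable M" if [measurable]: "g \<in> borel_measurable M" "k \<in> borel_measurable M" for g k and M :: "'c measure"
    using measurable_compose[OF _ a(1), of "\<lambda>q. (g q, k q)" M] by simp
  have bm [measurable]: "(\<lambda>q. b (g q) (k q)) \<in> borel_measurable M" if [measurable]: "g \<in> borel_measurable M" "k \<in> borel_measurable M" for g k and M :: "'c measure"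
    using measurable_compose[OF _ b(1), of "\<lambda>q. (g q, k q)" M] by simp
  define H where "H \<omega> p = f (fst p) * f (snd p) * (G \<omega> * (a \<omega> (fst p) * a \<omega> (snd p) + b \<omega> (fst p) * b \<omega> (snd p)))"
    for \<omega> and p :: "'a \<times> 'a"
  have ff: "integrable lborel (\<lambda>p. \<bar>f (fst p)\<bar> * \<bar>f (snd p)\<bar>)"
    using has_bochner_integral_prod[of "\<lambda>x. \<bar>f x\<bar>" _ "\<lambda>x. \<bar>f x\<bar>"] f by (auto simp: has_bochner_integral_iff)
  have "integrable lborel (\<lambda>q. G (fst q) * (2 * (\<bar>f (fst (snd q))\<bar> * \<bar>f (snd (snd q))\<bar>)))"
    using has_bochner_integral_prod[of G _ "\<lambda>p. 2 * (\<bar>f (fst p)\<bar> * \<bar>f (snd p)\<bar>)"] G ff by (auto simp: has_bochner_integral_iff)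
  then have int: "integrable (lborel \<Otimes>\<^sub>M lborel) (\<lambda>(\<omega>, p). H \<omega> p)"
    unfolding lborel_prod
  proof (rule Bochner_Integration.integrable_bound)
    show "(\<lambda>(\<omega>, p). H \<omega> p) \<in> borel_measurable lborel"
      unfolding H_def case_prod_beta' lborel_prod[symmetric] by measurable
    have "\<bar>a \<omega> x * a \<omega> y + b \<omega> x * b \<omega> y\<bar> \<le> 2" for \<omega> x y
    proof -
      have "\<bar>a \<omega> x * a \<omega> y\<bar> \<le> 1 * 1" "\<bar>b \<omega> x * b \<omega> y\<bar> \<le> 1 * 1"
        unfolding abs_mult by (intro mult_mono a b; simp)+
      then show ?thesis by linarith
    qed
    then have "\<bar>H \<omega> p\<bar> \<le> G \<omega> * (2 * (\<bar>f (fst p)\<bar> * \<bar>f (snd p)\<bar>))" for \<omega> p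
    proof -
      have "\<bar>H \<omega> p\<bar> = \<bar>f (fst p)\<bar> * \<bar>f (snd p)\<bar> * (G \<omega> * \<bar>a \<omega> (fst p) * a \<omega> (snd p) + b \<omega> (fst p) * b \<omega> (snd p)\<bar>)"
        using G by (simp add: H_def abs_mult)
      also have "\<dots> \<le> \<bar>f (fst p)\<bar> * \<bar>f (snd p)\<bar> * (G \<omega> * 2)"
        using G \<open>\<And>\<omega> x y. \<bar>a \<omega> x * a \<omega> y + b \<omega> x * b \<omega> y\<bar> \<le> 2\<close> by (intro mult_left_mono) auto
      finally show ?thesis by (simp add: mult_ac)
    qed
    then show "AE q in lborel. norm (case q of (\<omega>, p) \<Rightarrow> H \<omega> p) \<le> norm (G (fst q) * (2 * (\<bar>f (fst (snd q))\<bar> * \<bar>f (snd (snd q))\<bar>)))"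
      using G by (auto simp: case_prod_beta' abs_mult)
  qed
  have inner: "0 \<le> (LINT p|lborel. H \<omega> p)" for \<omega>
  proof -
    have fa: "integrable lborel (\<lambda>x. f x * a \<omega> x)" "integrable lborel (\<lambda>x. f x * b \<omega> x)"
      using a(2) b(2) by (auto intro!: Bochner_Integration.integrable_bound[OF f] AE_I2 simp: abs_mult mult_left_le)
    have A: "has_bochner_integral lborel (\<lambda>p. (f (fst p) * a \<omega> (fst p)) * (f (snd p) * a \<omega> (snd p))) ((LINT x|lborel. f x * a \<omega> x) * (LINT x|lborel. f x * a \<omega> x))"
      and B: "has_bochner_integral lborel (\<lambda>p. (f (fst p) * b \<omega> (fst p)) * (f (snd p) * b \<omega> (snd p))) ((LINT x|lborel. f x * b \<omega> x) * (LINT x|lborel. f x * b \<omega> x))"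
      by (rule has_bochner_integral_prod[OF fa(1)[THEN has_bochner_integral_integrable] fa(1)[THEN has_bochner_integral_integrable]],
          rule has_bochner_integral_prod[OF fa(2)[THEN has_bochner_integral_integrable] fa(2)[THEN has_bochner_integral_integrable]])
    have "has_bochner_integral lborel (H \<omega>) (G \<omega> * ((LINT x|lborel. f x * a \<omega> x) * (LINT x|lborel. f x * a \<omega> x) + (LINT x|lborel. f x * b \<omega> x) * (LINT x|lborel. f x * b \<omega> x)))"
    proof -
      have eq: "H \<omega> = (\<lambda>p. G \<omega> * ((f (fst p) * a \<omega> (fst p)) * (f (snd p) * a \<omega> (snd p)) + (f (fst p) * b \<omega> (fst p)) * (f (snd p) * b \<omega> (snd p))))"
        by (rule ext) (simp add: H_def algebra_simps)
      show ?thesis unfolding eq by (intro has_bochner_integral_mult_right has_bochner_integral_add A B)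
    qed
    then show ?thesis using G by (simp add: has_bochner_integral_iff)
  qed
  have "(LINT p|lborel. f (fst p) * f (snd p) * h (fst p) (snd p)) = (LINT p|lborel. LINT \<omega>|lborel. H \<omega> p)"
    by (simp add: H_def h)
  also have "\<dots> = (LINT \<omega>|lborel. LINT p|lborel. H \<omega> p)"
    using lborel_pair.Fubini_integral[OF int] .
  also have "0 \<le> \<dots>" by (intro integral_nonneg_AE AE_I2 inner)
  finally show ?thesis .
qed

text \<open>With \<open>\<alpha>\<close> a height, \<open>P\<close> the tangential projection and
  \<open>\<delta> = 0\<close> this is the kernel at \<open>x\<close> minus the mirror image of
  \<open>y\<close>. A positive \<open>\<delta>\<close> keeps it bounded when the heights are
  nonnegative.\<close>

definition shifted_kernel :: "real \<Rightarrow> ('a::euclidean_space \<Rightarrow> real) \<Rightarrow> ('a \<Rightarrow> 'a) \<Rightarrow> real \<Rightarrow> 'a \<Rightarrow> 'a \<Rightarrow> real" where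
  "shifted_kernel s \<alpha> P \<delta> x y = ((\<alpha> x + \<alpha> y + \<delta>)\<^sup>2 + (norm (P x - P y))\<^sup>2) powr - (real DIM('a) / 2 + s)"

text \<open>In the representation with t = \<open>\<alpha> x + \<alpha> y + \<delta>\<close> the
  exponential splits into a \<open>\<delta>\<close>-part, kept in the weight, and one factor for
  each point; the addition theorem splits the cosine. Nonnegative heights bound these factors by
  1.\<close>

lemma shifted_kernel_positive_definite:
  fixes f :: "'a::euclidean_space \<Rightarrow> real"
  assumes s: "0 < s" and d: "0 < \<delta>" and f: "integrable lborel f"
    and \<alpha> [measurable]: "\<alpha> \<in> borel_measurable borel" "\<And>x. 0 \<le> \<alpha> x"
    and P [measurable]: "P \<in> borel_measurable borel"
  shows "0 \<le> (LINT p|lborel. f (fst p) * f (snd p) * shifted_kernel s \<alpha> P \<delta> (fst p) (snd p))"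
proof -
  obtain C where C: "0 < C"
    "\<And>t (z::'a). 0 < t \<Longrightarrow>
      has_bochner_integral lborel (\<lambda>p. spectral_density s t p * cos (fst p \<bullet> z))
        (C * (t\<^sup>2 + (norm z)\<^sup>2) powr - (real DIM('a) / 2 + s))"
    by (rule kernel_spectral_representation[OF s, where 'a='a]) blast
  define \<rho> where "\<rho> p = sqrt ((norm (fst p))\<^sup>2 + snd p)" for p :: "'a \<times> real"
  define G :: "'a \<times> real \<Rightarrow> real" where "G = spectral_density s \<delta>"
  define a where "a p x = indicator {0<..} (snd p) * exp (- (\<alpha> x * \<rho> p)) * cos (fst p \<bullet> P x)" for p :: "'a \<times> real" and x
  define b where "b p x = indicator {0<..} (snd p) * exp (- (\<alpha> x * \<rho> p)) * sin (fst p \<bullet> P x)" for p :: "'a \<times> real" and x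
  have [measurable]: "\<rho> \<in> borel_measurable (borel \<Otimes>\<^sub>M borel)"
    unfolding \<rho>_def by measurable
  have "0 \<le> (LINT p|lborel. f (fst p) * f (snd p) * (C * shifted_kernel s \<alpha> P \<delta> (fst p) (snd p)))"
  proof (rule symmetric_exponential_form_nonneg[OF f, where G=G and a=a and b=b])
    show "integrable lborel G"
      using C(2)[OF d, of 0] by (simp add: has_bochner_integral_iff G_def)
    show "0 \<le> G p" for p by (simp add: G_def spectral_density_nonneg)
    show "(\<lambda>p. a (fst p) (snd p)) \<in> borel_measurable borel" "(\<lambda>p. b (fst p) (snd p)) \<in> borel_measurable borel"
      unfolding a_def b_def borel_prod[symmetric] by measurable
    have le: "indicator {0<..} (snd p) * exp (- (\<alpha> x * \<rho> p)) \<le> 1" for p x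
      using \<alpha>(2)[of x] by (auto simp: indicator_def \<rho>_def intro!: mult_nonneg_nonneg)
    show "\<bar>a p x\<bar> \<le> 1" "\<bar>b p x\<bar> \<le> 1" for p x
      unfolding a_def b_def abs_mult[of _ "cos _"] abs_mult[of _ "sin _"]
      by (intro mult_le_one; use le[of p x] in \<open>simp add: abs_le_iff\<close>)+
    fix x y
    have pos: "0 < \<alpha> x + \<alpha> y + \<delta>" using \<alpha>(2)[of x] \<alpha>(2)[of y] d by simp
    have "spectral_density s (\<alpha> x + \<alpha> y + \<delta>) p * cos (fst p \<bullet> (P x - P y)) = G p * (a p x * a p y + b p x * b p y)" for p
    proof (cases "0 < snd p")
      case True
      have sd: "spectral_density s t p = snd p powr (s - 1 / 2) * (exp (- (t * \<rho> p)) / \<rho> p)" for t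
        using True by (simp add: spectral_density_def \<rho>_def)
      have ex: "exp (- ((\<alpha> x + \<alpha> y + \<delta>) * \<rho> p)) = exp (- (\<delta> * \<rho> p)) * exp (- (\<alpha> x * \<rho> p)) * exp (- (\<alpha> y * \<rho> p))"
        by (simp add: exp_add[symmetric] algebra_simps)
      show ?thesis
        unfolding G_def a_def b_def sd ex inner_diff_right cos_diff using True by (simp add: field_simps)
    qed (simp add: spectral_density_def G_def)
    then show "C * shifted_kernel s \<alpha> P \<delta> x y = (LINT p|lborel. G p * (a p x * a p y + b p x * b p y))"
      using C(2)[OF pos, of "P x - P y"] by (simp add: has_bochner_integral_iff shifted_kernel_def)
  qed
  also have "\<dots> = C * (LINT p|lborel. f (fst p) * f (snd p) * shifted_kernel s \<alpha> P \<delta> (fst p) (snd p))"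
    by (simp flip: integral_mult_right_zero add: mult_ac)
  finally show ?thesis using C(1) by (simp add: zero_le_mult_iff)
qed

section \<open>The reflection inequality for forms\<close>

lemma gform_swap:
  assumes [measurable]: "f \<in> borel_measurable borel" "g \<in> borel_measurable borel" "A \<in> sets borel" "B \<in> sets borel"
    and k: "(\<lambda>p. k (fst p) (snd p)) \<in> borel_measurable (borel \<Otimes>\<^sub>M borel)"
    and symk: "\<And>x y. k x y = k' y x"
  shows "gform k A f B g = gform k' B g A f"
proof -
  have [measurable]: "(\<lambda>p. k (fst p) (snd p)) \<in> borel_measurable (lborel \<Otimes>\<^sub>M lborel)"
    using k by (simp add: measurable_def space_pair_measure sets_pair_measure)
  have m: "(\<lambda>(x, y). ennreal ((f x - g y)\<^sup>2 * k x y) * indicator B y * indicator A x) \<in> borel_measurable (lborel \<Otimes>\<^sub>M lborel)"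
    unfolding case_prod_beta' by measurable
  have [measurable]: "(\<lambda>y. k x y) \<in> borel_measurable borel" "(\<lambda>y. k y x) \<in> borel_measurable borel" for x
    using measurable_compose[OF measurable_Pair1', of x borel, OF _ k] measurable_compose[OF measurable_Pair2', of x borel, OF _ k] by simp_all
  have "gform k A f B g = (\<integral>\<^sup>+x. \<integral>\<^sup>+y. ennreal ((f x - g y)\<^sup>2 * k x y) * indicator B y * indicator A x \<partial>lborel \<partial>lborel)"
    unfolding gform_def by (simp add: nn_integral_multc)
  also have "\<dots> = (\<integral>\<^sup>+y. \<integral>\<^sup>+x. ennreal ((f x - g y)\<^sup>2 * k x y) * indicator B y * indicator A x \<partial>lborel \<partial>lborel)"
    using lborel_pair.Fubini'[OF m] by (rule sym)
  also have "\<dots> = (\<integral>\<^sup>+y. (\<integral>\<^sup>+x. ennreal ((g y - f x)\<^sup>2 * k' y x) * indicator A x \<partial>lborel) * indicator B y \<partial>lborel)"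
  proof (rule nn_integral_cong)
    fix y
    have "(\<integral>\<^sup>+x. ennreal ((f x - g y)\<^sup>2 * k x y) * indicator B y * indicator A x \<partial>lborel)
      = (\<integral>\<^sup>+x. (ennreal ((g y - f x)\<^sup>2 * k x y) * indicator A x) * indicator B y \<partial>lborel)"
      by (intro nn_integral_cong) (simp add: mult_ac power2_commute)
    also have "\<dots> = (\<integral>\<^sup>+x. ennreal ((g y - f x)\<^sup>2 * k x y) * indicator A x \<partial>lborel) * indicator B y"
      by (rule nn_integral_multc) measurable
    finally show "(\<integral>\<^sup>+x. ennreal ((f x - g y)\<^sup>2 * k x y) * indicator B y * indicator A x \<partial>lborel)
      = (\<integral>\<^sup>+x. ennreal ((g y - f x)\<^sup>2 * k' y x) * indicator A x \<partial>lborel) * indicator B y"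
      by (simp add: symk)
  qed
  finally show ?thesis unfolding gform_def .
qed

lemma gform_eq_nn_integral_prod:
  assumes [measurable]: "f \<in> borel_measurable borel" "g \<in> borel_measurable borel" "A \<in> sets borel" "B \<in> sets borel"
    and k: "(\<lambda>p. k (fst p) (snd p)) \<in> borel_measurable (borel \<Otimes>\<^sub>M borel)"
  shows "gform k A f B g = (\<integral>\<^sup>+p. ennreal ((f (fst p) - g (snd p))\<^sup>2 * k (fst p) (snd p)) * indicator (A \<times> B) p \<partial>lborel)"
proof -
  have [measurable]: "(\<lambda>p. k (fst p) (snd p)) \<in> borel_measurable (lborel \<Otimes>\<^sub>M lborel)"
    using k by (simp add: measurable_def space_pair_measure sets_pair_measure)
  have m: "(\<lambda>p. ennreal ((f (fst p) - g (snd p))\<^sup>2 * k (fst p) (snd p)) * indicator (A \<times> B) p) \<in> borel_measurable (lborel \<Otimes>\<^sub>M lborel)"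
    by measurable
  have [measurable]: "(\<lambda>y. k x y) \<in> borel_measurable borel" for x
    using measurable_compose[OF measurable_Pair1', of x borel, OF _ k] by simp
  show ?thesis
    unfolding gform_def lborel_prod[symmetric]
    by (subst lborel.nn_integral_fst[OF m, symmetric])
      (simp add: nn_integral_cmult indicator_times mult_ac)
qed

lemma shifted_kernel_nonneg [simp]: "0 \<le> shifted_kernel s \<alpha> P \<delta> x y"
  by (simp add: shifted_kernel_def)

lemma shifted_kernel_sym: "shifted_kernel s \<alpha> P \<delta> x y = shifted_kernel s \<alpha> P \<delta> y x"
  by (simp add: shifted_kernel_def norm_minus_commute add_ac)

lemma measurable_shifted_kernel:
  assumes [measurable]: "\<alpha> \<in> borel_measurable borel" "P \<in> borel_measurable borel"
  shows "(\<lambda>p. shifted_kernel s \<alpha> P \<delta> (fst p) (snd p)) \<in> borel_measurable (borel \<Otimes>\<^sub>M borel)"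
  unfolding shifted_kernel_def by measurable

lemma shifted_kernel_mono:
  assumes "0 < s" "0 \<le> \<delta>" "\<delta> \<le> \<delta>'" "0 < \<alpha> x + \<alpha> y + \<delta>"
  shows "shifted_kernel s \<alpha> P \<delta>' x y \<le> shifted_kernel s \<alpha> P \<delta> x y"
  unfolding shifted_kernel_def using assms
  by (intro powr_mono2' add_mono power_mono) (auto intro: add_pos_nonneg)

text \<open>The pointwise identity of the overview is integrated over D x D: the cross term is
  nonnegative by positive definiteness and the leftover square is dropped. The bounds on
  \<open>f\<close> and \<open>v\<close>, the finite measure and \<open>\<delta> > 0\<close> make
  every integral finite. The two mixed terms agree by symmetry, hence the factor 2.\<close>

lemma reflection_inequality_bounded:
  fixes f v :: "'a::euclidean_space \<Rightarrow> real"
  assumes s: "0 < s" and d: "0 < \<delta>"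
    and \<alpha> [measurable]: "\<alpha> \<in> borel_measurable borel" and \<alpha>0: "\<And>x. 0 \<le> \<alpha> x"
    and P [measurable]: "P \<in> borel_measurable borel"
    and D [measurable]: "D \<in> sets borel" and Dfin: "emeasure lborel D < \<infinity>"
    and f [measurable]: "f \<in> borel_measurable borel" and v [measurable]: "v \<in> borel_measurable borel"
    and fN: "\<And>x. \<bar>f x\<bar> \<le> N" and vN: "\<And>x. \<bar>v x\<bar> \<le> N"
  shows "gform (shifted_kernel s \<alpha> P \<delta>) D f D f \<le> 2 * gform (shifted_kernel s \<alpha> P \<delta>) D f D v"
proof -
  define k where "k = shifted_kernel s \<alpha> P \<delta>"
  have k0: "0 \<le> k x y" and ksym: "k x y = k y x" for x y
    by (auto simp: k_def shifted_kernel_sym)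
  have km [measurable]: "(\<lambda>p. k (fst p) (snd p)) \<in> borel_measurable (borel \<Otimes>\<^sub>M borel)"
    unfolding k_def by (rule measurable_shifted_kernel) measurable
  define M where "M = (\<delta>\<^sup>2) powr - (real DIM('a) / 2 + s)"
  have kM: "k x y \<le> M" for x y
  proof -
    have "\<delta>\<^sup>2 \<le> (\<alpha> x + \<alpha> y + \<delta>)\<^sup>2" using \<alpha>0[of x] \<alpha>0[of y] d by (intro power_mono) auto
    then have "\<delta>\<^sup>2 \<le> (\<alpha> x + \<alpha> y + \<delta>)\<^sup>2 + (norm (P x - P y))\<^sup>2" by (simp add: add_increasing2)
    then show ?thesis
      unfolding k_def M_def shifted_kernel_def using d s by (intro powr_mono2') auto
  qed
  have M0: "0 \<le> M" by (simp add: M_def)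
  have N0: "0 \<le> N" using fN[of undefined] by linarith
  have DD [measurable]: "D \<times> D \<in> sets borel" unfolding borel_prod[symmetric] by measurable
  have DDfin: "emeasure lborel (D \<times> D) < \<infinity>"
    using Dfin by (simp add: lborel_prod[symmetric] lborel.emeasure_pair_measure_Times ennreal_mult_less_top)
  define I where "I p = indicat_real (D \<times> D) p" for p
  have Iint: "integrable lborel I"
    unfolding I_def using DDfin by (intro integrable_real_indicator) auto
  have bdd_int: "integrable lborel (\<lambda>p. I p * (h p * k (fst p) (snd p)))"
    if [measurable]: "h \<in> borel_measurable borel" and hB: "\<And>p. \<bar>h p\<bar> \<le> H" for h H
  proof (rule Bochner_Integration.integrable_bound[of _ "\<lambda>p. H * M * I p"])
    show "integrable lborel (\<lambda>p. H * M * I p)" using Iint by simp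
    have "k' \<in> borel_measurable borel" if "k' \<in> borel_measurable (borel \<Otimes>\<^sub>M borel)" for k' :: "'a \<times> 'a \<Rightarrow> real"
      using that by (simp add: borel_prod)
    from this[OF km] show "(\<lambda>p. I p * (h p * k (fst p) (snd p))) \<in> borel_measurable lborel"
      unfolding I_def by measurable
    have H0: "0 \<le> H" using hB[of undefined] by linarith
    have "\<bar>h p * k (fst p) (snd p)\<bar> \<le> H * M" for p
      unfolding abs_mult using hB[of p] kM k0 H0 by (intro mult_mono) (auto simp: abs_of_nonneg)
    then show "AE p in lborel. norm (I p * (h p * k (fst p) (snd p))) \<le> norm (H * M * I p)"
      using H0 M0 by (intro AE_I2) (auto simp: I_def indicator_def)
  qed
  have sq: "\<bar>(a - b)\<^sup>2\<bar> \<le> (2 * N)\<^sup>2" if "\<bar>a\<bar> \<le> N" "\<bar>b\<bar> \<le> N" for a b :: real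
  proof -
    have "\<bar>a - b\<bar> \<le> 2 * N" using that by linarith
    then have "\<bar>a - b\<bar>\<^sup>2 \<le> (2 * N)\<^sup>2" by (intro power_mono) auto
    then show ?thesis by simp
  qed
  have comp [measurable]: "(\<lambda>p::'a \<times> 'a. g (fst p)) \<in> borel_measurable borel" "(\<lambda>p::'a \<times> 'a. g (snd p)) \<in> borel_measurable borel"
    if [measurable]: "g \<in> borel_measurable borel" for g :: "'a \<Rightarrow> real"
    unfolding borel_prod[symmetric] by measurable
  define A where "A p = I p * ((f (fst p) - f (snd p))\<^sup>2 * k (fst p) (snd p))" for p
  define B1 where "B1 p = I p * ((f (fst p) - v (snd p))\<^sup>2 * k (fst p) (snd p))" for p
  define B2 where "B2 p = I p * ((v (fst p) - f (snd p))\<^sup>2 * k (fst p) (snd p))" for p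
  \<comment> \<open>Cutting off to \<open>D\<close> turns the positive definite form over the whole
    space into one over D x D.\<close>
  define g where "g x = indicat_real D x * (f x - v x)" for x
  define E where "E p = I p * (((f (fst p) - v (fst p)) * (f (snd p) - v (snd p))) * k (fst p) (snd p))" for p
  have intA: "integrable lborel A" and intB1: "integrable lborel B1" and intB2: "integrable lborel B2"
    unfolding A_def B1_def B2_def by (rule bdd_int[where H="(2 * N)\<^sup>2"], measurable, intro sq fN vN)+
  have intE: "integrable lborel E"
    unfolding E_def
  proof (rule bdd_int[where H="2 * N * (2 * N)"])
    show "\<bar>(f (fst p) - v (fst p)) * (f (snd p) - v (snd p))\<bar> \<le> 2 * N * (2 * N)" for p
    proof -
      have "\<bar>f (fst p) - v (fst p)\<bar> \<le> 2 * N" "\<bar>f (snd p) - v (snd p)\<bar> \<le> 2 * N"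
        using fN[of "fst p"] vN[of "fst p"] fN[of "snd p"] vN[of "snd p"] by linarith+
      then show ?thesis unfolding abs_mult by (rule mult_mono) (use N0 in auto)
    qed
  qed measurable
  have [measurable]: "g \<in> borel_measurable borel" unfolding g_def by measurable
  have gint: "integrable lborel g"
  proof (rule Bochner_Integration.integrable_bound[of _ "\<lambda>x. 2 * N * indicator D x"])
    show "integrable lborel (\<lambda>x. 2 * N * indicat_real D x)" using Dfin by simp
    have "\<bar>f x - v x\<bar> \<le> 2 * N" for x using fN[of x] vN[of x] by linarith
    then show "AE x in lborel. norm (g x) \<le> norm (2 * N * indicat_real D x)"
      using N0 by (auto simp: g_def indicator_def)
  qed measurable
  have "0 \<le> (LINT p|lborel. g (fst p) * g (snd p) * k (fst p) (snd p))"
    unfolding k_def by (rule shifted_kernel_positive_definite[OF s d gint]) (use \<alpha>0 in auto)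
  also have "\<dots> = (LINT p|lborel. E p)"
    by (intro Bochner_Integration.integral_cong) (auto simp: E_def g_def I_def indicator_def)
  finally have E0: "0 \<le> (LINT p|lborel. E p)" .
  have "A p + 2 * E p \<le> B1 p + B2 p" for p
  proof -
    \<comment> \<open>Right side minus left side is exactly \<open>(c - d)\<^sup>2\<close>; here
      \<open>a\<close>, \<open>b\<close> are the values of \<open>f\<close> at the two points and
      \<open>c\<close>, \<open>d\<close> those of \<open>v\<close>.\<close>
    have "(a - b)\<^sup>2 + 2 * ((a - c) * (b - d)) \<le> (a - d)\<^sup>2 + (c - b)\<^sup>2" for a b c d :: real
      using zero_le_power2[of "c - d"] by (simp add: power2_eq_square algebra_simps)
    then have "((f (fst p) - f (snd p))\<^sup>2 + 2 * ((f (fst p) - v (fst p)) * (f (snd p) - v (snd p)))) * (k (fst p) (snd p) * I p)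
        \<le> ((f (fst p) - v (snd p))\<^sup>2 + (v (fst p) - f (snd p))\<^sup>2) * (k (fst p) (snd p) * I p)"
      using k0 by (intro mult_right_mono) (auto simp: I_def)
    then show ?thesis unfolding A_def B1_def B2_def E_def by (simp add: algebra_simps)
  qed
  then have "(LINT p|lborel. A p + 2 * E p) \<le> (LINT p|lborel. B1 p + B2 p)"
    using intA intB1 intB2 intE by (intro integral_mono) auto
  then have le: "(LINT p|lborel. A p) \<le> (LINT p|lborel. B1 p) + (LINT p|lborel. B2 p)"
    using intA intB1 intB2 intE E0 by simp
  have nn: "gform k D h D h' = ennreal (LINT p|lborel. I p * ((h (fst p) - h' (snd p))\<^sup>2 * k (fst p) (snd p)))"
    if "integrable lborel (\<lambda>p. I p * ((h (fst p) - h' (snd p))\<^sup>2 * k (fst p) (snd p)))"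
      and [measurable]: "h \<in> borel_measurable borel" "h' \<in> borel_measurable borel" for h h' :: "'a \<Rightarrow> real"
  proof -
    have "gform k D h D h' = (\<integral>\<^sup>+p. ennreal (I p * ((h (fst p) - h' (snd p))\<^sup>2 * k (fst p) (snd p))) \<partial>lborel)"
      by (subst gform_eq_nn_integral_prod[OF that(2,3) D D km])
        (auto intro!: nn_integral_cong simp: I_def indicator_def)
    also have "\<dots> = ennreal (LINT p|lborel. I p * ((h (fst p) - h' (snd p))\<^sup>2 * k (fst p) (snd p)))"
      using that(1) k0 by (intro nn_integral_eq_integral) (auto simp: I_def)
    finally show ?thesis .
  qed
  have pos: "0 \<le> (LINT p|lborel. B1 p)" "0 \<le> (LINT p|lborel. B2 p)"
    using k0 by (auto intro!: integral_nonneg_AE AE_I2 simp: B1_def B2_def I_def)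
  have "gform k D f D f \<le> ennreal ((LINT p|lborel. B1 p) + (LINT p|lborel. B2 p))"
    using nn[of f f] intA le unfolding A_def by (simp add: ennreal_leI)
  also have "\<dots> = gform k D f D v + gform k D v D f"
    using nn[of f v] nn[of v f] intB1 intB2 pos unfolding B1_def B2_def by simp
  also have "gform k D v D f = gform k D f D v"
    by (rule gform_swap[OF v f D D km]) (rule ksym)
  finally show ?thesis by (simp add: k_def mult_2)
qed

text \<open>Truncation heights tend to infinity while the shift 1/(i + 1) tends to 0. The right side
  of the bounded case never exceeds its limit, since truncation contracts differences and the shift
  lowers the kernel; the left side is handled by Fatou's lemma.\<close>

lemma reflection_inequality:
  fixes f v :: "'a::euclidean_space \<Rightarrow> real"
  assumes s: "0 < s"
    and \<alpha> [measurable]: "\<alpha> \<in> borel_measurable borel" and \<alpha>0: "\<And>x. 0 \<le> \<alpha> x"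
    and P [measurable]: "P \<in> borel_measurable borel"
    and D [measurable]: "D \<in> sets borel" and Dfin: "emeasure lborel D < \<infinity>"
    and \<alpha>D: "\<And>x. x \<in> D \<Longrightarrow> 0 < \<alpha> x"
    and f [measurable]: "f \<in> borel_measurable borel" and v [measurable]: "v \<in> borel_measurable borel"
  shows "gform (shifted_kernel s \<alpha> P 0) D f D f \<le> 2 * gform (shifted_kernel s \<alpha> P 0) D f D v"
proof -
  define c where "c i h x = clamp_abs (real i) (h x)" for i and h :: "'a \<Rightarrow> real" and x
  have cm [measurable]: "c i h \<in> borel_measurable borel" if [measurable]: "h \<in> borel_measurable borel" for i h
    unfolding c_def by measurable
  have km: "(\<lambda>p. shifted_kernel s \<alpha> P \<delta> (fst p) (snd p)) \<in> borel_measurable (borel \<Otimes>\<^sub>M borel)" for \<delta>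
    by (rule measurable_shifted_kernel) measurable
  have comp [measurable]: "(\<lambda>p::'a \<times> 'a. g (fst p)) \<in> borel_measurable borel" "(\<lambda>p::'a \<times> 'a. g (snd p)) \<in> borel_measurable borel"
    if [measurable]: "g \<in> borel_measurable borel" for g :: "'a \<Rightarrow> real"
    unfolding borel_prod[symmetric] by measurable
  have km' [measurable]: "(\<lambda>p. shifted_kernel s \<alpha> P \<delta> (fst p) (snd p)) \<in> borel_measurable borel" for \<delta>
    using km by (simp add: borel_prod)
  have DD [measurable]: "D \<times> D \<in> sets borel" unfolding borel_prod[symmetric] by measurable
  define F where "F i p = ennreal ((c i f (fst p) - c i f (snd p))\<^sup>2 * shifted_kernel s \<alpha> P (inverse (real (Suc i))) (fst p) (snd p)) * indicator (D \<times> D) p" for i p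
  have "gform (shifted_kernel s \<alpha> P 0) D f D f
     = (\<integral>\<^sup>+p. ennreal ((f (fst p) - f (snd p))\<^sup>2 * shifted_kernel s \<alpha> P 0 (fst p) (snd p)) * indicator (D \<times> D) p \<partial>lborel)"
    by (rule gform_eq_nn_integral_prod[OF f f D D km])
  also have "\<dots> \<le> 2 * gform (shifted_kernel s \<alpha> P 0) D f D v"
  proof (rule nn_integral_le_of_tendsto[where f=F])
    show "F i \<in> borel_measurable lborel" for i unfolding F_def by measurable
    fix i
    have "(\<integral>\<^sup>+p. F i p \<partial>lborel) = gform (shifted_kernel s \<alpha> P (inverse (real (Suc i)))) D (c i f) D (c i f)"
      unfolding F_def by (rule gform_eq_nn_integral_prod[symmetric, OF _ _ D D km]) measurable
    also have "\<dots> \<le> 2 * gform (shifted_kernel s \<alpha> P (inverse (real (Suc i)))) D (c i f) D (c i v)"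
      by (rule reflection_inequality_bounded[where N="real i", OF s _ \<alpha> \<alpha>0 P D Dfin]) (auto simp: c_def clamp_abs_bound)
    also have "gform (shifted_kernel s \<alpha> P (inverse (real (Suc i)))) D (c i f) D (c i v) \<le> gform (shifted_kernel s \<alpha> P 0) D f D v"
      unfolding gform_def
    proof (intro nn_integral_mono)
      fix x
      have "(\<integral>\<^sup>+y. ennreal ((c i f x - c i v y)\<^sup>2 * shifted_kernel s \<alpha> P (inverse (real (Suc i))) x y) * indicator D y \<partial>lborel)
        \<le> (\<integral>\<^sup>+y. ennreal ((f x - v y)\<^sup>2 * shifted_kernel s \<alpha> P 0 x y) * indicator D y \<partial>lborel)" if "x \<in> D"
      proof (intro nn_integral_mono)
        fix y
        show "ennreal ((c i f x - c i v y)\<^sup>2 * shifted_kernel s \<alpha> P (inverse (real (Suc i))) x y) * indicator D y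
          \<le> ennreal ((f x - v y)\<^sup>2 * shifted_kernel s \<alpha> P 0 x y) * indicator D y"
        proof (cases "y \<in> D")
          case True
          \<comment> \<open>Strict positivity matters: a zero base raised to a negative power is 0
            by convention, which would destroy monotonicity in the shift.\<close>
          have "0 < \<alpha> x + \<alpha> y" using \<alpha>D[OF that] \<alpha>D[OF True] by simp
          then have "shifted_kernel s \<alpha> P (inverse (real (Suc i))) x y \<le> shifted_kernel s \<alpha> P 0 x y"
            using s by (intro shifted_kernel_mono) auto
          then show ?thesis
            unfolding c_def by (intro mult_right_mono ennreal_leI mult_mono clamp_abs_contraction_sq) auto
        qed simp
      qed
      then show "(\<integral>\<^sup>+y. ennreal ((c i f x - c i v y)\<^sup>2 * shifted_kernel s \<alpha> P (inverse (real (Suc i))) x y) * indicator D y \<partial>lborel) * indicator D x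
        \<le> (\<integral>\<^sup>+y. ennreal ((f x - v y)\<^sup>2 * shifted_kernel s \<alpha> P 0 x y) * indicator D y \<partial>lborel) * indicator D x"
        by (auto simp: indicator_def)
    qed
    finally show "(\<integral>\<^sup>+p. F i p \<partial>lborel) \<le> 2 * gform (shifted_kernel s \<alpha> P 0) D f D v"
      by (simp add: mult_left_mono)
  next
    fix p :: "'a \<times> 'a"
    show "(\<lambda>i. F i p) \<longlonglongrightarrow> ennreal ((f (fst p) - f (snd p))\<^sup>2 * shifted_kernel s \<alpha> P 0 (fst p) (snd p)) * indicator (D \<times> D) p"
    proof (cases "p \<in> D \<times> D")
      case True
      then have pos: "0 < \<alpha> (fst p) + \<alpha> (snd p)" using \<alpha>D[of "fst p"] \<alpha>D[of "snd p"] by auto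
      have cl: "(\<lambda>i. c i f x) \<longlonglongrightarrow> f x" for x
        unfolding c_def by (intro tendsto_eventually eventually_clamp_abs)
      have "(\<lambda>i. shifted_kernel s \<alpha> P (inverse (real (Suc i))) (fst p) (snd p)) \<longlonglongrightarrow> shifted_kernel s \<alpha> P 0 (fst p) (snd p)"
        unfolding shifted_kernel_def
        using pos by (intro tendsto_intros LIMSEQ_inverse_real_of_nat) (auto simp: add_nonneg_eq_0_iff)
      then have "(\<lambda>i. (c i f (fst p) - c i f (snd p))\<^sup>2 * shifted_kernel s \<alpha> P (inverse (real (Suc i))) (fst p) (snd p))
         \<longlonglongrightarrow> (f (fst p) - f (snd p))\<^sup>2 * shifted_kernel s \<alpha> P 0 (fst p) (snd p)"
        by (intro tendsto_intros cl)
      then show ?thesis using True by (simp add: F_def tendsto_ennrealI)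
    qed (simp add: F_def)
  qed
  finally show ?thesis .
qed

section \<open>Even reflection in a half-space\<close>

text \<open>A Vitali family of disjoint balls fills \<open>U\<close> up to a null set, and the
  preimage of a ball under the involution is a ball of the same radius. Only volumes of balls are
  compared.\<close>

lemma emeasure_vimage_isometric_involution:
  fixes \<sigma> :: "'a::euclidean_space \<Rightarrow> 'a"
  assumes iso: "\<And>x y. dist (\<sigma> x) (\<sigma> y) = dist x y" and inv: "\<And>x. \<sigma> (\<sigma> x) = x" and U: "open U"
  shows "emeasure lborel U \<le> emeasure lborel (\<sigma> -` U)"
proof -
  have cont: "continuous_on UNIV \<sigma>"
    unfolding continuous_on_iff using iso by metis
  then have [measurable]: "open (\<sigma> -` U)" using U open_vimage by blast
  define K where "K = {i::'a \<times> real. 0 < snd i \<and> ball (fst i) (snd i) \<subseteq> U}"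
  have vit: "\<exists>i. i \<in> K \<and> x \<in> ball (fst i) (snd i) \<and> snd i < d" if "x \<in> U" "0 < d" for x d
  proof -
    obtain e where e: "0 < e" "ball x e \<subseteq> U" using U \<open>x \<in> U\<close> openE by blast
    define r where "r = min e (d / 2)"
    have r: "0 < r" "r < d" "r \<le> e" using e(1) \<open>0 < d\<close> by (auto simp: r_def)
    have "ball x r \<subseteq> U" by (rule subset_trans[OF subset_ball[OF r(3)] e(2)])
    then show ?thesis using r by (intro exI[of _ "(x, r)"]) (simp add: K_def)
  qed
  have "\<exists>C. countable C \<and> C \<subseteq> K \<and>
     pairwise (\<lambda>i j. disjnt (ball (fst i) (snd i)) (ball (fst j) (snd j))) C \<and>
     negligible (U - (\<Union>i \<in> C. ball (fst i) (snd i)))"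
    by (rule Vitali_covering_theorem_balls[of U K fst snd])
      ((rule vit; assumption), (intro exI conjI; assumption))
  then obtain C where C: "countable C" "C \<subseteq> K"
     "pairwise (\<lambda>i j. disjnt (ball (fst i) (snd i)) (ball (fst j) (snd j))) C"
     "negligible (U - (\<Union>i \<in> C. ball (fst i) (snd i)))"
    by auto
  define V where "V = (\<Union>i \<in> C. ball (fst i) (snd i))"
  have oV: "open V" unfolding V_def by auto
  have dis: "disjoint_family_on (\<lambda>i. ball (fst i) (snd i)) C"
    using C(3) by (auto simp: disjoint_family_on_def pairwise_def disjnt_def)
  have dis': "disjoint_family_on (\<lambda>i. ball (\<sigma> (fst i)) (snd i)) C"
  proof -
    have "ball (\<sigma> (fst i)) (snd i) = \<sigma> -` ball (fst i) (snd i)" for i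
    proof -
      have "dist (\<sigma> (fst i)) x = dist (fst i) (\<sigma> x)" for x using iso[of "\<sigma> (fst i)" x] by (simp add: inv)
      then show ?thesis by auto
    qed
    then show ?thesis using dis by (simp add: disjoint_family_on_def vimage_Int[symmetric])
  qed
  have "emeasure lborel U \<le> emeasure lborel (V \<union> (U - V))"
    using U oV by (intro emeasure_mono) auto
  also have "\<dots> \<le> emeasure lborel V + emeasure lborel (U - V)"
    using U oV by (intro emeasure_subadditive) auto
  also have "emeasure lborel (U - V) = 0"
  proof -
    have "U - V \<in> sets borel" using U oV by auto
    moreover have "emeasure lebesgue (U - V) = 0"
      using C(4) by (simp add: negligible_iff_null_sets V_def null_sets_def)
    ultimately show ?thesis by simp
  qed
  also have "emeasure lborel V = (\<integral>\<^sup>+i. emeasure lborel (ball (fst i) (snd i)) \<partial>count_space C)"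
    unfolding V_def by (rule emeasure_UN_countable[OF _ C(1) dis]) auto
  also have "\<dots> = (\<integral>\<^sup>+i. emeasure lborel (ball (\<sigma> (fst i)) (snd i)) \<partial>count_space C)"
    using C(2) by (intro nn_integral_cong) (auto simp: K_def emeasure_ball)
  also have "\<dots> = emeasure lborel (\<Union>i \<in> C. ball (\<sigma> (fst i)) (snd i))"
    by (rule emeasure_UN_countable[OF _ C(1) dis', symmetric]) auto
  also have "\<dots> \<le> emeasure lborel (\<sigma> -` U)"
  proof (rule emeasure_mono)
    show "(\<Union>i \<in> C. ball (\<sigma> (fst i)) (snd i)) \<subseteq> \<sigma> -` U"
    proof
      fix x assume "x \<in> (\<Union>i \<in> C. ball (\<sigma> (fst i)) (snd i))"
      then obtain i where i: "i \<in> C" "dist (\<sigma> (fst i)) x < snd i" by auto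
      then have "i \<in> K" using C(2) by blast
      moreover have "dist (fst i) (\<sigma> x) < snd i"
        using i iso[of "\<sigma> (fst i)" x] by (simp add: inv)
      ultimately show "x \<in> \<sigma> -` U" by (auto simp: K_def subset_iff)
    qed
  qed simp
  finally show ?thesis by simp
qed

text \<open>Being its own inverse, the map also yields the reverse inequality, by applying the
  previous one to the preimage of a box.\<close>

lemma distr_isometric_involution:
  fixes \<sigma> :: "'a::euclidean_space \<Rightarrow> 'a"
  assumes iso: "\<And>x y. dist (\<sigma> x) (\<sigma> y) = dist x y" and inv: "\<And>x. \<sigma> (\<sigma> x) = x"
  shows "distr lborel borel \<sigma> = lborel"
proof (rule lborel_eqI[symmetric])
  have cont: "continuous_on UNIV \<sigma>"
    unfolding continuous_on_iff using iso by metis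
  then have [measurable]: "\<sigma> \<in> borel_measurable borel" by (rule borel_measurable_continuous_onI)
  fix l u :: 'a assume lu: "\<And>b. b \<in> Basis \<Longrightarrow> l \<bullet> b \<le> u \<bullet> b"
  have o: "open (\<sigma> -` box l u)" using cont open_box open_vimage by blast
  have "emeasure lborel (\<sigma> -` box l u) = emeasure lborel (box l u)"
  proof (rule antisym)
    have "\<sigma> -` (\<sigma> -` box l u) = box l u" using inv by auto
    then show "emeasure lborel (\<sigma> -` box l u) \<le> emeasure lborel (box l u)"
      using emeasure_vimage_isometric_involution[of \<sigma>, OF iso inv o] by simp
  qed (rule emeasure_vimage_isometric_involution[of \<sigma>, OF iso inv open_box])
  moreover have "emeasure (distr lborel borel \<sigma>) (box l u) = emeasure lborel (\<sigma> -` box l u)"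
    by (subst emeasure_distr) auto
  ultimately show "emeasure (distr lborel borel \<sigma>) (box l u) = ennreal (\<Prod>b\<in>Basis. (u - l) \<bullet> b)"
    using emeasure_lborel_box[of l u, OF lu] by simp
qed simp

definition kernel_tail :: "real \<Rightarrow> real \<Rightarrow> 'a::euclidean_space \<Rightarrow> real" where
  "kernel_tail s r z = rker s z * indicator {z. r \<le> norm z} z"

lemma measurable_kernel_tail [measurable]: "kernel_tail s r \<in> borel_measurable borel"
  unfolding kernel_tail_def by measurable

lemma kernel_tail_nonneg [simp]: "0 \<le> kernel_tail s r z"
  by (simp add: kernel_tail_def)

lemma nn_integral_translate_even:
  fixes g :: "'a::euclidean_space \<Rightarrow> ennreal"
  assumes [measurable]: "g \<in> borel_measurable borel" and even: "\<And>z. g (- z) = g z"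
  shows "(\<integral>\<^sup>+y. g (x - y) \<partial>lborel) = (\<integral>\<^sup>+z. g z \<partial>lborel)" "(\<integral>\<^sup>+y. g (y - x) \<partial>lborel) = (\<integral>\<^sup>+z. g z \<partial>lborel)"
proof -
  show *: "(\<integral>\<^sup>+y. g (y - x) \<partial>lborel) = (\<integral>\<^sup>+z. g z \<partial>lborel)"
  proof -
    have "(\<integral>\<^sup>+z. g z \<partial>lborel) = (\<integral>\<^sup>+z. g z \<partial>distr lborel borel ((+) (- x)))"
      by (simp only: lborel_distr_plus)
    also have "\<dots> = (\<integral>\<^sup>+y. g (- x + y) \<partial>lborel)"
      by (rule nn_integral_distr) measurable
    finally show ?thesis by simp
  qed
  have "g (x - y) = g (y - x)" for y using even[of "y - x"] by simp
  then show "(\<integral>\<^sup>+y. g (x - y) \<partial>lborel) = (\<integral>\<^sup>+z. g z \<partial>lborel)" using * by simp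
qed

section \<open>Reflection in an affine hyperplane\<close>

locale hyperplane_reflection =
  fixes a :: "'a::euclidean_space" and b :: real
  assumes norm_a: "norm a = 1"
begin

definition height :: "'a \<Rightarrow> real" where "height x = a \<bullet> x - b"

definition reflect :: "'a \<Rightarrow> 'a" where "reflect x = x - (2 * height x) *\<^sub>R a"

definition upper :: "'a set" where "upper = {x. 0 < height x}"

lemma aa: "a \<bullet> a = 1"
  using norm_a by (simp add: dot_square_norm)

lemma height_reflect [simp]: "height (reflect x) = - height x"
  by (simp add: height_def reflect_def inner_diff_right aa algebra_simps)

lemma reflect_reflect [simp]: "reflect (reflect x) = x"
  by (simp add: reflect_def[of "reflect x"]) (simp add: reflect_def)

text \<open>The difference of \<open>x\<close> and the mirror image of \<open>y\<close> is the sum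
  of the heights times the normal plus a tangential vector; Pythagoras then exhibits the form
  required by \<open>shifted_kernel\<close>.\<close>

lemma norm_diff_reflect_sq:
  "(norm (x - reflect y))\<^sup>2 = (height x + height y)\<^sup>2 + (norm ((x - (a \<bullet> x) *\<^sub>R a) - (y - (a \<bullet> y) *\<^sub>R a)))\<^sup>2"
proof -
  define u where "u = (x - (a \<bullet> x) *\<^sub>R a) - (y - (a \<bullet> y) *\<^sub>R a)"
  have eq: "x - reflect y = (height x + height y) *\<^sub>R a + u"
    by (simp add: reflect_def height_def u_def algebra_simps) (simp flip: scaleR_left_distrib)
  have "a \<bullet> u = 0" by (simp add: u_def inner_diff_right aa)
  then have "orthogonal ((height x + height y) *\<^sub>R a) u" by (simp add: orthogonal_def)
  from norm_add_Pythagorean[OF this] show ?thesis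
    unfolding eq u_def[symmetric] by (simp add: norm_a)
qed

lemma dist_reflect: "dist (reflect x) (reflect y) = dist x y"
proof -
  define d where "d = x - y"
  have eq: "reflect x - reflect y = d - (2 * (a \<bullet> d)) *\<^sub>R a"
    by (simp add: reflect_def height_def d_def inner_diff_right algebra_simps)
  have "(norm (reflect x - reflect y))\<^sup>2 = (norm (x - y))\<^sup>2"
    unfolding eq d_def[symmetric] power2_norm_eq_inner
    by (simp add: inner_diff_left inner_diff_right aa inner_commute[of d a])
  then show ?thesis by (simp add: dist_norm)
qed

lemma measurable_height [measurable]: "height \<in> borel_measurable borel"
  unfolding height_def by measurable

lemma measurable_reflect [measurable]: "reflect \<in> borel_measurable borel"
  unfolding reflect_def by measurable

lemma upper_sets [measurable]: "upper \<in> sets borel"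
  unfolding upper_def by measurable

lemma nn_integral_reflect:
  assumes [measurable]: "f \<in> borel_measurable borel"
  shows "(\<integral>\<^sup>+x. f (reflect x) \<partial>lborel) = (\<integral>\<^sup>+x. f x \<partial>lborel)"
proof -
  have "(\<integral>\<^sup>+x. f x \<partial>lborel) = (\<integral>\<^sup>+x. f x \<partial>distr lborel borel reflect)"
    by (simp only: distr_isometric_involution[of reflect, OF dist_reflect reflect_reflect])
  also have "\<dots> = (\<integral>\<^sup>+x. f (reflect x) \<partial>lborel)"
    by (rule nn_integral_distr) measurable
  finally show ?thesis by simp
qed

text \<open>The hyperplane is a null set, and the reflection carries the lower half-space to the
  upper one without changing the measure.\<close>

lemma nn_integral_split_upper:
  assumes [measurable]: "f \<in> borel_measurable borel"
  shows "(\<integral>\<^sup>+x. f x \<partial>lborel) = (\<integral>\<^sup>+x. (f x + f (reflect x)) * indicator upper x \<partial>lborel)"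
proof -
  have "negligible {x. a \<bullet> x = b}" using norm_a by (intro negligible_hyperplane) auto
  then have "{x. a \<bullet> x = b} \<in> null_sets lborel"
    by (subst null_sets_completion_iff[symmetric]) (simp_all add: negligible_iff_null_sets)
  then have "AE x in lborel. x \<notin> {x. a \<bullet> x = b}" by (rule AE_not_in)
  then have "AE x in lborel. height x \<noteq> 0" by (simp add: height_def)
  then have "(\<integral>\<^sup>+x. f x \<partial>lborel) = (\<integral>\<^sup>+x. f x * indicator upper x + f x * indicator {x. height x < 0} x \<partial>lborel)"
    by (intro nn_integral_cong_AE) (auto simp: upper_def indicator_def)
  also have "\<dots> = (\<integral>\<^sup>+x. f x * indicator upper x \<partial>lborel) + (\<integral>\<^sup>+x. f x * indicator {x. height x < 0} x \<partial>lborel)"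
    by (rule nn_integral_add) measurable
  also have "(\<integral>\<^sup>+x. f x * indicator {x. height x < 0} x \<partial>lborel) = (\<integral>\<^sup>+x. f (reflect x) * indicator {x. height x < 0} (reflect x) \<partial>lborel)"
    by (rule nn_integral_reflect[of "\<lambda>x. f x * indicator {x. height x < 0} x", symmetric]) measurable
  also have "\<dots> = (\<integral>\<^sup>+x. f (reflect x) * indicator upper x \<partial>lborel)"
    by (intro nn_integral_cong) (auto simp: upper_def indicator_def)
  also have "(\<integral>\<^sup>+x. f x * indicator upper x \<partial>lborel) + (\<integral>\<^sup>+x. f (reflect x) * indicator upper x \<partial>lborel)
      = (\<integral>\<^sup>+x. f x * indicator upper x + f (reflect x) * indicator upper x \<partial>lborel)"
    by (rule nn_integral_add[symmetric]) measurable
  finally show ?thesis by (simp only: distrib_right)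
qed

lemma reflected_kernel_eq:
  "rker s (x - reflect y) = shifted_kernel s height (\<lambda>x. x - (a \<bullet> x) *\<^sub>R a) 0 x y"
proof -
  have "norm (x - reflect y) powr - (real DIM('a) + 2 * s) = ((norm (x - reflect y))\<^sup>2) powr - (real DIM('a) / 2 + s)"
  proof (cases "x = reflect y")
    case False
    then have "((norm (x - reflect y))\<^sup>2) = norm (x - reflect y) powr 2" by simp
    moreover have "2 * - (real DIM('a) / 2 + s) = - (real DIM('a) + 2 * s)" by simp
    ultimately show ?thesis by (simp only: powr_powr)
  qed simp
  then show ?thesis unfolding rker_def shifted_kernel_def norm_diff_reflect_sq by simp
qed

lemma reflected_form_inequality:
  fixes f v :: "'a \<Rightarrow> real"
  assumes s: "0 < s" and D [measurable]: "D \<in> sets borel" "bounded D" "D \<subseteq> upper"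
    and [measurable]: "f \<in> borel_measurable borel" "v \<in> borel_measurable borel"
  shows "gform (\<lambda>x y. rker s (x - reflect y)) D f D f \<le> 2 * gform (\<lambda>x y. rker s (x - reflect y)) D f D v"
proof -
  \<comment> \<open>Positive definiteness asks for heights that are nonnegative everywhere; on
    \<open>D\<close> the positive part changes nothing.\<close>
  define h where "h x = max 0 (height x)" for x
  have [measurable]: "h \<in> borel_measurable borel" unfolding h_def by measurable
  let ?P = "\<lambda>x. x - (a \<bullet> x) *\<^sub>R a"
  have eq: "rker s (x - reflect y) = shifted_kernel s h ?P 0 x y" if "x \<in> D" "y \<in> D" for x y
    using that D(3) by (auto simp: reflected_kernel_eq shifted_kernel_def h_def upper_def max_def)
  have form: "gform (\<lambda>x y. rker s (x - reflect y)) D f D g = gform (shifted_kernel s h ?P 0) D f D g" for g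
    unfolding gform_def
  proof (intro nn_integral_cong)
    fix x
    have "(\<integral>\<^sup>+y. ennreal ((f x - g y)\<^sup>2 * rker s (x - reflect y)) * indicator D y \<partial>lborel)
        = (\<integral>\<^sup>+y. ennreal ((f x - g y)\<^sup>2 * shifted_kernel s h ?P 0 x y) * indicator D y \<partial>lborel)" if "x \<in> D"
      using eq[OF that] by (intro nn_integral_cong) (auto simp: indicator_def)
    then show "(\<integral>\<^sup>+y. ennreal ((f x - g y)\<^sup>2 * rker s (x - reflect y)) * indicator D y \<partial>lborel) * indicator D x
        = (\<integral>\<^sup>+y. ennreal ((f x - g y)\<^sup>2 * shifted_kernel s h ?P 0 x y) * indicator D y \<partial>lborel) * indicator D x"
      by (auto simp: indicator_def)
  qed
  show ?thesis
    unfolding form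
  proof (rule reflection_inequality[OF s])
    show "emeasure lborel D < \<infinity>" using D(2) by (rule emeasure_bounded_finite)
    show "0 < h x" if "x \<in> D" for x using that D(3) by (auto simp: h_def upper_def)
  qed (auto simp: h_def)
qed

section \<open>Energy of the even extension\<close>

definition lower :: "'a set" where "lower = {x. height x < 0}"

definition even_ext :: "('a \<Rightarrow> real) \<Rightarrow> 'a \<Rightarrow> real" where
  "even_ext W x = (if 0 < height x then W x else W (reflect x))"

lemma even_ext_upper: "x \<in> upper \<Longrightarrow> even_ext W x = W x" "x \<in> upper \<Longrightarrow> even_ext W (reflect x) = W x"
  by (auto simp: even_ext_def upper_def)

lemma measurable_even_ext [measurable]:
  assumes [measurable]: "W \<in> borel_measurable borel"
  shows "even_ext W \<in> borel_measurable borel"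
  unfolding even_ext_def by measurable

lemma nn_integral_even_ext:
  assumes [measurable]: "W \<in> borel_measurable borel" "h \<in> borel_measurable borel"
  shows "(\<integral>\<^sup>+x. h (even_ext W x) \<partial>lborel) = 2 * (\<integral>\<^sup>+x. h (W x) * indicator upper x \<partial>lborel)" (is "?L = _ * ?R")
proof -
  have "?L = (\<integral>\<^sup>+x. (h (even_ext W x) + h (even_ext W (reflect x))) * indicator upper x \<partial>lborel)"
    by (rule nn_integral_split_upper) measurable
  also have "\<dots> = (\<integral>\<^sup>+x. 2 * (h (W x) * indicator upper x) \<partial>lborel)"
    by (intro nn_integral_cong) (auto simp: indicator_def even_ext_upper mult_2)
  also have "\<dots> = 2 * ?R" by (rule nn_integral_cmult) measurable
  finally show ?thesis .
qed

text \<open>Splitting both variables into halves gives four terms with the same difference of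
  values. Two have points on the same side and carry the kernel itself, two have points on opposite
  sides and carry the reflected kernel.\<close>

lemma seminorm_even_ext:
  assumes [measurable]: "W \<in> borel_measurable borel"
  shows "seminorm_sq s (even_ext W) =
    (\<integral>\<^sup>+x. (\<integral>\<^sup>+y. ennreal (2 * (W x - W y)\<^sup>2 * (rker s (x - y) + rker s (x - reflect y))) * indicator upper y \<partial>lborel) * indicator upper x \<partial>lborel)"
proof -
  define F where "F x y = ennreal ((even_ext W x - even_ext W y)\<^sup>2 * rker s (x - y))" for x y
  have Fm [measurable]: "(\<lambda>p. F (fst p) (snd p)) \<in> borel_measurable (borel \<Otimes>\<^sub>M borel)"
    unfolding F_def by measurable
  have Fm': "F x \<in> borel_measurable borel" for x unfolding F_def by measurable
  define G where "G x = (\<integral>\<^sup>+y. (F x y + F x (reflect y)) * indicator upper y \<partial>lborel)" for x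
  have Gm [measurable]: "G \<in> borel_measurable borel"
  proof -
    have "(\<lambda>(x, y). (F x y + F x (reflect y)) * indicator upper y) \<in> borel_measurable (borel \<Otimes>\<^sub>M lborel)"
      unfolding F_def case_prod_beta' by measurable
    then show ?thesis unfolding G_def by (rule lborel.borel_measurable_nn_integral)
  qed
  have "seminorm_sq s (even_ext W) = (\<integral>\<^sup>+x. G x \<partial>lborel)"
    unfolding gform_def G_def F_def[symmetric]
    by (simp add: nn_integral_split_upper[OF Fm'])
  also have "\<dots> = (\<integral>\<^sup>+x. (G x + G (reflect x)) * indicator upper x \<partial>lborel)"
    by (rule nn_integral_split_upper[OF Gm])
  also have "\<dots> = (\<integral>\<^sup>+x. (\<integral>\<^sup>+y. ennreal (2 * (W x - W y)\<^sup>2 * (rker s (x - y) + rker s (x - reflect y))) * indicator upper y \<partial>lborel) * indicator upper x \<partial>lborel)"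
  proof (intro nn_integral_cong)
    fix x
    have "G x + G (reflect x) = (\<integral>\<^sup>+y. ennreal (2 * (W x - W y)\<^sup>2 * (rker s (x - y) + rker s (x - reflect y))) * indicator upper y \<partial>lborel)"
      if "x \<in> upper"
    proof -
      have "G x + G (reflect x) = (\<integral>\<^sup>+y. (F x y + F x (reflect y)) * indicator upper y + (F (reflect x) y + F (reflect x) (reflect y)) * indicator upper y \<partial>lborel)"
        unfolding G_def using Fm' by (intro nn_integral_add[symmetric]) (auto intro!: measurable_compose[OF measurable_reflect])
      also have "\<dots> = (\<integral>\<^sup>+y. ennreal (2 * (W x - W y)\<^sup>2 * (rker s (x - y) + rker s (x - reflect y))) * indicator upper y \<partial>lborel)"
      proof (intro nn_integral_cong)
        fix y
        have r1: "rker s (reflect x - reflect y) = rker s (x - y)"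
          using dist_reflect[of x y] by (simp add: rker_def dist_norm)
        have r2: "rker s (reflect x - y) = rker s (x - reflect y)"
          using dist_reflect[of x "reflect y"] by (simp add: rker_def dist_norm)
        show "(F x y + F x (reflect y)) * indicator upper y + (F (reflect x) y + F (reflect x) (reflect y)) * indicator upper y
          = ennreal (2 * (W x - W y)\<^sup>2 * (rker s (x - y) + rker s (x - reflect y))) * indicator upper y"
          using that
          by (cases "y \<in> upper")
            (simp_all add: F_def even_ext_upper r1 r2 ennreal_plus[symmetric] algebra_simps del: ennreal_plus)
      qed
      finally show ?thesis .
    qed
    then show "(G x + G (reflect x)) * indicator upper x
      = (\<integral>\<^sup>+y. ennreal (2 * (W x - W y)\<^sup>2 * (rker s (x - y) + rker s (x - reflect y))) * indicator upper y \<partial>lborel) * indicator upper x"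
      by (auto simp: indicator_def)
  qed
  finally show ?thesis .
qed

text \<open>For a fixed point the direct and the reflected tail integrate to twice
  \<open>\<Theta>\<close>. By symmetry of the tail the two squares contribute equally, and the 8 is
  2 (coefficient) times 2 (tails) times 2 (squares).\<close>

lemma tail_double_integral:
  fixes s r :: real
  assumes W [measurable]: "W \<in> borel_measurable borel"
  defines "\<Theta> \<equiv> (\<integral>\<^sup>+z. ennreal (kernel_tail s r (z::'a)) \<partial>lborel)"
  shows "(\<integral>\<^sup>+x. (\<integral>\<^sup>+y. ennreal (2 * ((W x)\<^sup>2 + (W y)\<^sup>2) * (kernel_tail s r (x - y) + kernel_tail s r (x - reflect y))) * indicator upper y \<partial>lborel) * indicator upper x \<partial>lborel)
    \<le> 8 * \<Theta> * (\<integral>\<^sup>+x. ennreal ((W x)\<^sup>2) * indicator upper x \<partial>lborel)"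
proof -
  define T where "T x y = ennreal (kernel_tail s r (x - y) + kernel_tail s r (x - reflect y))" for x y :: 'a
  define V where "V x = ennreal (2 * (W x)\<^sup>2) * indicator upper x" for x
  have [measurable]: "V \<in> borel_measurable borel" unfolding V_def by measurable
  have Tm [measurable]: "(\<lambda>p. T (fst p) (snd p)) \<in> borel_measurable (borel \<Otimes>\<^sub>M borel)"
    unfolding T_def by measurable
  have Tm' [measurable]: "T x \<in> borel_measurable borel" for x unfolding T_def by measurable
  have even: "ennreal (kernel_tail s r (- z)) = ennreal (kernel_tail s r z)" for z :: 'a
    by (simp add: kernel_tail_def indicator_def)
  have Tint: "(\<integral>\<^sup>+y. T x y \<partial>lborel) = 2 * \<Theta>" for x
  proof -
    have "(\<integral>\<^sup>+y. T x y \<partial>lborel) = (\<integral>\<^sup>+y. ennreal (kernel_tail s r (x - y)) \<partial>lborel) + (\<integral>\<^sup>+y. ennreal (kernel_tail s r (x - reflect y)) \<partial>lborel)"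
      unfolding T_def by (subst nn_integral_add[symmetric]) auto
    also have "(\<integral>\<^sup>+y. ennreal (kernel_tail s r (x - reflect y)) \<partial>lborel) = (\<integral>\<^sup>+y. ennreal (kernel_tail s r (x - y)) \<partial>lborel)"
      by (rule nn_integral_reflect[of "\<lambda>y. ennreal (kernel_tail s r (x - y))"]) measurable
    also have "(\<integral>\<^sup>+y. ennreal (kernel_tail s r (x - y)) \<partial>lborel) = \<Theta>"
      unfolding \<Theta>_def by (rule nn_integral_translate_even(1)[of "\<lambda>z. ennreal (kernel_tail s r z)", OF _ even]) measurable
    finally show ?thesis by (simp add: mult_2)
  qed
  have Tsym: "T x y = T y x" for x y
  proof -
    have "norm (x - reflect y) = norm (y - reflect x)"
      using dist_reflect[of x "reflect y"] by (simp add: dist_norm norm_minus_commute)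
    then have "kernel_tail s r (x - reflect y) = kernel_tail s r (y - reflect x)"
      by (simp add: kernel_tail_def rker_def indicator_def)
    moreover have "kernel_tail s r (x - y) = kernel_tail s r (y - x)"
      by (simp add: kernel_tail_def rker_def indicator_def norm_minus_commute)
    ultimately show ?thesis by (simp add: T_def)
  qed
  have Vint: "(\<integral>\<^sup>+x. V x \<partial>lborel) = 2 * (\<integral>\<^sup>+x. ennreal ((W x)\<^sup>2) * indicator upper x \<partial>lborel)"
  proof -
    have "V x = 2 * (ennreal ((W x)\<^sup>2) * indicator upper x)" for x
      unfolding V_def by (subst ennreal_mult) (simp_all add: mult.assoc)
    then have "(\<integral>\<^sup>+x. V x \<partial>lborel) = (\<integral>\<^sup>+x. 2 * (ennreal ((W x)\<^sup>2) * indicator upper x) \<partial>lborel)"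
      by (simp only:)
    also have "\<dots> = 2 * (\<integral>\<^sup>+x. ennreal ((W x)\<^sup>2) * indicator upper x \<partial>lborel)"
      by (rule nn_integral_cmult) measurable
    finally show ?thesis .
  qed
  have "(\<integral>\<^sup>+x. (\<integral>\<^sup>+y. ennreal (2 * ((W x)\<^sup>2 + (W y)\<^sup>2) * (kernel_tail s r (x - y) + kernel_tail s r (x - reflect y))) * indicator upper y \<partial>lborel) * indicator upper x \<partial>lborel)
    \<le> (\<integral>\<^sup>+x. (\<integral>\<^sup>+y. V x * T x y + V y * T x y \<partial>lborel) \<partial>lborel)"
  proof (rule nn_integral_mono)
    fix x
    show "(\<integral>\<^sup>+y. ennreal (2 * ((W x)\<^sup>2 + (W y)\<^sup>2) * (kernel_tail s r (x - y) + kernel_tail s r (x - reflect y))) * indicator upper y \<partial>lborel) * indicator upper x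
      \<le> (\<integral>\<^sup>+y. V x * T x y + V y * T x y \<partial>lborel)"
    proof (cases "x \<in> upper")
      case True
      have "(\<integral>\<^sup>+y. ennreal (2 * ((W x)\<^sup>2 + (W y)\<^sup>2) * (kernel_tail s r (x - y) + kernel_tail s r (x - reflect y))) * indicator upper y \<partial>lborel)
        \<le> (\<integral>\<^sup>+y. V x * T x y + V y * T x y \<partial>lborel)"
      proof (rule nn_integral_mono)
        fix y
        show "ennreal (2 * ((W x)\<^sup>2 + (W y)\<^sup>2) * (kernel_tail s r (x - y) + kernel_tail s r (x - reflect y))) * indicator upper y
          \<le> V x * T x y + V y * T x y"
          using True by (cases "y \<in> upper") (simp_all add: V_def T_def ennreal_mult[symmetric] ennreal_plus[symmetric] distrib_left distrib_right del: ennreal_plus)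
      qed
      then show ?thesis using True by simp
    qed simp
  qed
  also have "\<dots> = (\<integral>\<^sup>+x. (\<integral>\<^sup>+y. V x * T x y \<partial>lborel) + (\<integral>\<^sup>+y. V y * T x y \<partial>lborel) \<partial>lborel)"
    by (intro nn_integral_cong nn_integral_add) measurable
  also have "\<dots> = (\<integral>\<^sup>+x. (\<integral>\<^sup>+y. V x * T x y \<partial>lborel) \<partial>lborel) + (\<integral>\<^sup>+x. (\<integral>\<^sup>+y. V y * T x y \<partial>lborel) \<partial>lborel)"
  proof (rule nn_integral_add)
    have "(\<lambda>(x, y). V x * T x y) \<in> borel_measurable (lborel \<Otimes>\<^sub>M lborel)" "(\<lambda>(x, y). V y * T x y) \<in> borel_measurable (lborel \<Otimes>\<^sub>M lborel)"
      unfolding T_def case_prod_beta' by measurable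
    then show "(\<lambda>x. \<integral>\<^sup>+y. V x * T x y \<partial>lborel) \<in> borel_measurable lborel" "(\<lambda>x. \<integral>\<^sup>+y. V y * T x y \<partial>lborel) \<in> borel_measurable lborel"
      by (auto intro: lborel.borel_measurable_nn_integral)
  qed
  also have "(\<integral>\<^sup>+x. (\<integral>\<^sup>+y. V y * T x y \<partial>lborel) \<partial>lborel) = (\<integral>\<^sup>+y. (\<integral>\<^sup>+x. V y * T x y \<partial>lborel) \<partial>lborel)"
  proof -
    have "(\<lambda>(x, y). V y * T x y) \<in> borel_measurable (lborel \<Otimes>\<^sub>M lborel)"
      unfolding T_def case_prod_beta' by measurable
    from lborel_pair.Fubini'[OF this] show ?thesis by simp
  qed
  also have "(\<integral>\<^sup>+y. (\<integral>\<^sup>+x. V y * T x y \<partial>lborel) \<partial>lborel) = (\<integral>\<^sup>+x. (\<integral>\<^sup>+y. V x * T x y \<partial>lborel) \<partial>lborel)"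
    by (subst Tsym) rule
  also have "(\<integral>\<^sup>+x. (\<integral>\<^sup>+y. V x * T x y \<partial>lborel) \<partial>lborel) = (\<integral>\<^sup>+x. V x * (2 * \<Theta>) \<partial>lborel)"
    by (intro nn_integral_cong) (simp add: nn_integral_cmult Tint)
  also have "\<dots> = (\<integral>\<^sup>+x. V x \<partial>lborel) * (2 * \<Theta>)"
    by (rule nn_integral_multc) measurable
  also have "(\<integral>\<^sup>+x. V x \<partial>lborel) * (2 * \<Theta>) + (\<integral>\<^sup>+x. V x \<partial>lborel) * (2 * \<Theta>)
      = 8 * \<Theta> * (\<integral>\<^sup>+x. ennreal ((W x)\<^sup>2) * indicator upper x \<partial>lborel)"
  proof -
    have "2 * I * (2 * T) + 2 * I * (2 * T) = 8 * T * I" for I T :: ennreal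
    proof -
      have "2 * I * (2 * T) + 2 * I * (2 * T) = (2 * 2 * 2) * (T * I)"
        by (simp only: mult_2[symmetric]) (simp only: mult_ac)
      then show ?thesis by (simp add: mult.assoc)
    qed
    then show ?thesis by (simp only: Vint)
  qed
  finally show ?thesis .
qed

lemma reflect_eq_self: "height x = 0 \<Longrightarrow> reflect x = x"
  by (simp add: reflect_def)

text \<open>A ball centred on the hyperplane is invariant under the reflection, so substituting the
  mirror image of \<open>y\<close> turns the form with reflected kernel and reflected values into
  the mixed part of the original energy.\<close>

lemma form_lower_eq:
  assumes [measurable]: "W \<in> borel_measurable borel" and x0: "height x0 = 0"
  shows "gform (\<lambda>x y. rker s (x - reflect y)) D W (upper \<inter> ball x0 R) (\<lambda>y. W (reflect y))
    = gform (\<lambda>x y. rker s (x - y)) D W (lower \<inter> ball x0 R) W"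
proof -
  have [measurable]: "lower \<in> sets borel" unfolding lower_def by measurable
  have [measurable]: "ball x0 R \<in> sets borel" by simp
  have ball: "reflect y \<in> ball x0 R \<longleftrightarrow> y \<in> ball x0 R" for y
  proof -
    have "dist x0 (reflect y) = dist x0 y" using dist_reflect[of x0 y] by (simp only: reflect_eq_self[OF x0])
    then show ?thesis by (simp only: mem_ball)
  qed
  have ind: "indicator (upper \<inter> ball x0 R) y = (indicator (lower \<inter> ball x0 R) (reflect y) :: ennreal)" for y
  proof -
    have "reflect y \<in> lower \<longleftrightarrow> y \<in> upper" by (simp add: upper_def lower_def)
    then show ?thesis by (simp only: indicator_def Int_iff ball)
  qed
  have "(\<integral>\<^sup>+y. ennreal ((W x - W (reflect y))\<^sup>2 * rker s (x - reflect y)) * indicator (upper \<inter> ball x0 R) y \<partial>lborel)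
      = (\<integral>\<^sup>+y. ennreal ((W x - W y)\<^sup>2 * rker s (x - y)) * indicator (lower \<inter> ball x0 R) y \<partial>lborel)" for x
  proof -
    have "(\<integral>\<^sup>+y. ennreal ((W x - W (reflect y))\<^sup>2 * rker s (x - reflect y)) * indicator (upper \<inter> ball x0 R) y \<partial>lborel)
      = (\<integral>\<^sup>+y. ennreal ((W x - W (reflect y))\<^sup>2 * rker s (x - reflect y)) * indicator (lower \<inter> ball x0 R) (reflect y) \<partial>lborel)"
      by (simp only: ind)
    also have "\<dots> = (\<integral>\<^sup>+y. ennreal ((W x - W y)\<^sup>2 * rker s (x - y)) * indicator (lower \<inter> ball x0 R) y \<partial>lborel)"
      by (rule nn_integral_reflect[of "\<lambda>y. ennreal ((W x - W y)\<^sup>2 * rker s (x - y)) * indicator (lower \<inter> ball x0 R) y"]) measurable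
    finally show ?thesis .
  qed
  then show ?thesis unfolding gform_def by (simp only:)
qed

text \<open>Pairs inside \<open>D\<close> are left to the reflection inequality. Any other pair has
  a point outside the ball of radius \<open>R\<close>, where \<open>W\<close> vanishes; then either
  \<open>W\<close> vanishes at both points, or they are at least R/2 apart and the kernel is its
  tail. Since both points lie in the upper half-space, the error contains no outside value of
  \<open>W\<close>.\<close>

lemma seminorm_even_ext_le:
  fixes s R :: real
  assumes s: "0 < s" and W [measurable]: "W \<in> borel_measurable borel"
    and supp: "\<And>x. x \<notin> ball x0 (R / 2) \<Longrightarrow> W x = 0" and x0: "height x0 = 0"
  defines "D \<equiv> upper \<inter> ball x0 R"
  shows "seminorm_sq s (even_ext W) \<le>
     2 * (gform (\<lambda>x y. rker s (x - y)) D W D W + 2 * gform (\<lambda>x y. rker s (x - y)) D W (lower \<inter> ball x0 R) W)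
     + 8 * (\<integral>\<^sup>+z. ennreal (kernel_tail s (R / 2) (z::'a)) \<partial>lborel) * (\<integral>\<^sup>+x. ennreal ((W x)\<^sup>2) * indicator upper x \<partial>lborel)"
proof -
  let ?K = "\<lambda>x y. rker s (x - y)" and ?K' = "\<lambda>x y. rker s (x - reflect y)"
  let ?T = "\<lambda>x y. kernel_tail s (R / 2) (x - y)" and ?T' = "\<lambda>x y. kernel_tail s (R / 2) (x - reflect y)"
  have D [measurable]: "D \<in> sets borel" unfolding D_def by measurable
  have far: "?K x y = ?T x y" "?K y x = ?T y x" if "x \<in> ball x0 (R / 2)" "y \<notin> ball x0 R" for x y
  proof -
    have "R / 2 \<le> norm (x - y)"
      using that norm_triangle_ineq[of "x0 - x" "x - y"] by (simp add: dist_norm)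
    then show "?K x y = ?T x y" "?K y x = ?T y x"
      by (simp_all add: kernel_tail_def norm_minus_commute)
  qed
  have nball: "reflect y \<notin> ball x0 r \<longleftrightarrow> y \<notin> ball x0 r" for y r
  proof -
    have "dist x0 (reflect y) = dist x0 y" using dist_reflect[of x0 y] by (simp only: reflect_eq_self[OF x0])
    then show ?thesis by (simp only: mem_ball)
  qed
  \<comment> \<open>Outside D x D at least one of the two values is zero, so the squared difference
    is at most the sum of squares, and the kernel may be replaced by its tail wherever the other
    value survives.\<close>
  have pt: "2 * (W x - W y)\<^sup>2 * (?K x y + ?K' x y) \<le>
      (2 * (W x - W y)\<^sup>2 * (?K x y + ?K' x y)) * (indicator D x * indicator D y)
      + 2 * ((W x)\<^sup>2 + (W y)\<^sup>2) * (?T x y + ?T' x y)"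
    if xy: "x \<in> upper" "y \<in> upper" for x y
  proof -
    consider "x \<in> D" "y \<in> D" | "y \<notin> ball x0 R" | "x \<notin> ball x0 R" using xy unfolding D_def by blast
    then show ?thesis
    proof cases
      case 2
      then have "y \<notin> ball x0 (R / 2)" using zero_le_dist[of x0 y] unfolding mem_ball by linarith
      then have "W y = 0" by (rule supp)
      show ?thesis
      proof (cases "x \<in> ball x0 (R / 2)")
        case True
        then have "?K x y = ?T x y" "?K' x y = ?T' x y"
          using far(1)[OF True 2] far(1)[OF True, of "reflect y"] 2 nball[of y R] by auto
        then show ?thesis using \<open>W y = 0\<close> by simp
      next
        case False
        then show ?thesis using \<open>W y = 0\<close> supp by simp
      qed
    next
      case 3
      then have "x \<notin> ball x0 (R / 2)" using zero_le_dist[of x0 x] unfolding mem_ball by linarith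
      then have "W x = 0" by (rule supp)
      show ?thesis
      proof (cases "y \<in> ball x0 (R / 2)")
        case True
        then have "?K x y = ?T x y" "?K' x y = ?T' x y"
          using far(2)[OF True 3] far(2)[of "reflect y" x] 3 nball[of y "R / 2"] by auto
        then show ?thesis using \<open>W x = 0\<close> by simp
      next
        case False
        then show ?thesis using \<open>W x = 0\<close> supp by simp
      qed
    qed (auto intro!: mult_nonneg_nonneg add_nonneg_nonneg)
  qed
  define F where "F x y = ennreal (2 * (W x - W y)\<^sup>2 * (?K x y + ?K' x y))" for x y
  define G where "G x y = ennreal (2 * ((W x)\<^sup>2 + (W y)\<^sup>2) * (?T x y + ?T' x y)) * indicator upper y" for x y
  have Fm: "(\<lambda>(x, y). F x y * indicator D y) \<in> borel_measurable (borel \<Otimes>\<^sub>M lborel)"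
    unfolding F_def case_prod_beta' by measurable
  have Gm: "(\<lambda>(x, y). G x y) \<in> borel_measurable (borel \<Otimes>\<^sub>M lborel)"
    unfolding G_def case_prod_beta' by measurable
  have [measurable]: "(\<lambda>x. \<integral>\<^sup>+y. F x y * indicator D y \<partial>lborel) \<in> borel_measurable borel"
    "(\<lambda>x. \<integral>\<^sup>+y. G x y \<partial>lborel) \<in> borel_measurable borel"
    using lborel.borel_measurable_nn_integral[OF Fm] lborel.borel_measurable_nn_integral[OF Gm] by simp_all
  have [measurable]: "F x \<in> borel_measurable borel" "G x \<in> borel_measurable borel" for x
    unfolding F_def G_def by measurable
  have "seminorm_sq s (even_ext W) = (\<integral>\<^sup>+x. (\<integral>\<^sup>+y. F x y * indicator upper y \<partial>lborel) * indicator upper x \<partial>lborel)"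
    unfolding F_def by (rule seminorm_even_ext[OF W])
  also have "\<dots> \<le> (\<integral>\<^sup>+x. (\<integral>\<^sup>+y. F x y * indicator D y \<partial>lborel) * indicator D x + (\<integral>\<^sup>+y. G x y \<partial>lborel) * indicator upper x \<partial>lborel)"
  proof (rule nn_integral_mono)
    fix x
    show "(\<integral>\<^sup>+y. F x y * indicator upper y \<partial>lborel) * indicator upper x
      \<le> (\<integral>\<^sup>+y. F x y * indicator D y \<partial>lborel) * indicator D x + (\<integral>\<^sup>+y. G x y \<partial>lborel) * indicator upper x"
    proof (cases "x \<in> upper")
      case True
      have "(\<integral>\<^sup>+y. F x y * indicator upper y \<partial>lborel) \<le> (\<integral>\<^sup>+y. F x y * indicator D y * indicator D x + G x y \<partial>lborel)"
      proof (rule nn_integral_mono)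
        fix y
        show "F x y * indicator upper y \<le> F x y * indicator D y * indicator D x + G x y"
        proof (cases "y \<in> upper")
          case y: True
          have "F x y \<le> ennreal ((2 * (W x - W y)\<^sup>2 * (?K x y + ?K' x y)) * (indicator D x * indicator D y)
            + 2 * ((W x)\<^sup>2 + (W y)\<^sup>2) * (?T x y + ?T' x y))"
            unfolding F_def by (intro ennreal_leI pt True y)
          also have "\<dots> = F x y * indicator D y * indicator D x + G x y"
            using y by (subst ennreal_plus) (auto simp: F_def G_def indicator_def)
          finally show ?thesis using y by simp
        qed simp
      qed
      also have "\<dots> = (\<integral>\<^sup>+y. F x y * indicator D y \<partial>lborel) * indicator D x + (\<integral>\<^sup>+y. G x y \<partial>lborel)"
        by (subst nn_integral_add) (auto simp: nn_integral_multc)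
      finally show ?thesis using True by simp
    qed simp
  qed
  also have "\<dots> = (\<integral>\<^sup>+x. (\<integral>\<^sup>+y. F x y * indicator D y \<partial>lborel) * indicator D x \<partial>lborel) + (\<integral>\<^sup>+x. (\<integral>\<^sup>+y. G x y \<partial>lborel) * indicator upper x \<partial>lborel)"
    by (rule nn_integral_add) measurable
  finally have le: "seminorm_sq s (even_ext W) \<le> (\<integral>\<^sup>+x. (\<integral>\<^sup>+y. F x y * indicator D y \<partial>lborel) * indicator D x \<partial>lborel)
      + (\<integral>\<^sup>+x. (\<integral>\<^sup>+y. G x y \<partial>lborel) * indicator upper x \<partial>lborel)" .
  have near: "(\<integral>\<^sup>+x. (\<integral>\<^sup>+y. F x y * indicator D y \<partial>lborel) * indicator D x \<partial>lborel) = 2 * (gform ?K D W D W + gform ?K' D W D W)"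
  proof -
    have km: "(\<lambda>x. \<integral>\<^sup>+y. ennreal ((W x - W y)\<^sup>2 * k x y) * indicator D y \<partial>lborel) \<in> borel_measurable borel"
      if "(\<lambda>p. k (fst p) (snd p)) \<in> borel_measurable (borel \<Otimes>\<^sub>M lborel)" for k
    proof -
      have "(\<lambda>(x, y). ennreal ((W x - W y)\<^sup>2 * k x y) * indicator D y) \<in> borel_measurable (borel \<Otimes>\<^sub>M lborel)"
        using that unfolding case_prod_beta' by measurable
      then show ?thesis by (rule lborel.borel_measurable_nn_integral)
    qed
    have [measurable]: "(\<lambda>x. \<integral>\<^sup>+y. ennreal ((W x - W y)\<^sup>2 * ?K x y) * indicator D y \<partial>lborel) \<in> borel_measurable borel"
      "(\<lambda>x. \<integral>\<^sup>+y. ennreal ((W x - W y)\<^sup>2 * ?K' x y) * indicator D y \<partial>lborel) \<in> borel_measurable borel"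
      by (rule km, measurable)+
    have split: "(\<integral>\<^sup>+y. F x y * indicator D y \<partial>lborel) = 2 * ((\<integral>\<^sup>+y. ennreal ((W x - W y)\<^sup>2 * ?K x y) * indicator D y \<partial>lborel)
        + (\<integral>\<^sup>+y. ennreal ((W x - W y)\<^sup>2 * ?K' x y) * indicator D y \<partial>lborel))" for x
    proof -
      have "F x y * indicator D y = 2 * (ennreal ((W x - W y)\<^sup>2 * ?K x y) * indicator D y + ennreal ((W x - W y)\<^sup>2 * ?K' x y) * indicator D y)" for y
      proof (cases "y \<in> D")
        case True
        have "F x y = ennreal (2 * ((W x - W y)\<^sup>2 * ?K x y + (W x - W y)\<^sup>2 * ?K' x y))"
          by (simp add: F_def distrib_left mult.assoc)
        also have "\<dots> = ennreal 2 * (ennreal ((W x - W y)\<^sup>2 * ?K x y) + ennreal ((W x - W y)\<^sup>2 * ?K' x y))"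
          by (subst ennreal_mult, simp, simp, subst ennreal_plus) simp_all
        finally show ?thesis using True by simp
      qed simp
      then have "(\<integral>\<^sup>+y. F x y * indicator D y \<partial>lborel) = (\<integral>\<^sup>+y. 2 * (ennreal ((W x - W y)\<^sup>2 * ?K x y) * indicator D y + ennreal ((W x - W y)\<^sup>2 * ?K' x y) * indicator D y) \<partial>lborel)"
        by simp
      also have "\<dots> = 2 * (\<integral>\<^sup>+y. ennreal ((W x - W y)\<^sup>2 * ?K x y) * indicator D y + ennreal ((W x - W y)\<^sup>2 * ?K' x y) * indicator D y \<partial>lborel)"
        by (rule nn_integral_cmult) measurable
      also have "(\<integral>\<^sup>+y. ennreal ((W x - W y)\<^sup>2 * ?K x y) * indicator D y + ennreal ((W x - W y)\<^sup>2 * ?K' x y) * indicator D y \<partial>lborel)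
          = (\<integral>\<^sup>+y. ennreal ((W x - W y)\<^sup>2 * ?K x y) * indicator D y \<partial>lborel) + (\<integral>\<^sup>+y. ennreal ((W x - W y)\<^sup>2 * ?K' x y) * indicator D y \<partial>lborel)"
        by (rule nn_integral_add) measurable
      finally show ?thesis .
    qed
    have "(\<integral>\<^sup>+x. (\<integral>\<^sup>+y. F x y * indicator D y \<partial>lborel) * indicator D x \<partial>lborel)
      = (\<integral>\<^sup>+x. 2 * ((\<integral>\<^sup>+y. ennreal ((W x - W y)\<^sup>2 * ?K x y) * indicator D y \<partial>lborel) * indicator D x
        + (\<integral>\<^sup>+y. ennreal ((W x - W y)\<^sup>2 * ?K' x y) * indicator D y \<partial>lborel) * indicator D x) \<partial>lborel)"
      unfolding split by (simp only: mult.assoc distrib_right)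
    also have "\<dots> = 2 * (\<integral>\<^sup>+x. (\<integral>\<^sup>+y. ennreal ((W x - W y)\<^sup>2 * ?K x y) * indicator D y \<partial>lborel) * indicator D x
        + (\<integral>\<^sup>+y. ennreal ((W x - W y)\<^sup>2 * ?K' x y) * indicator D y \<partial>lborel) * indicator D x \<partial>lborel)"
      by (rule nn_integral_cmult) measurable
    also have "(\<integral>\<^sup>+x. (\<integral>\<^sup>+y. ennreal ((W x - W y)\<^sup>2 * ?K x y) * indicator D y \<partial>lborel) * indicator D x
        + (\<integral>\<^sup>+y. ennreal ((W x - W y)\<^sup>2 * ?K' x y) * indicator D y \<partial>lborel) * indicator D x \<partial>lborel)
      = gform ?K D W D W + gform ?K' D W D W"
      unfolding gform_def by (rule nn_integral_add) measurable
    finally show ?thesis .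
  qed
  \<comment> \<open>The function \<open>v\<close> of the reflection inequality is \<open>W\<close>
    composed with the reflection, that is, the outside values seen from inside.\<close>
  have "gform ?K' D W D W \<le> 2 * gform ?K' D W D (\<lambda>y. W (reflect y))"
    by (rule reflected_form_inequality[OF s D]) (simp_all add: D_def bounded_Int)
  also have "gform ?K' D W D (\<lambda>y. W (reflect y)) = gform ?K D W (lower \<inter> ball x0 R) W"
    unfolding D_def by (rule form_lower_eq[OF W x0])
  finally have refl: "gform ?K' D W D W \<le> 2 * gform ?K D W (lower \<inter> ball x0 R) W" .
  have far_part: "(\<integral>\<^sup>+x. (\<integral>\<^sup>+y. G x y \<partial>lborel) * indicator upper x \<partial>lborel)
      \<le> 8 * (\<integral>\<^sup>+z. ennreal (kernel_tail s (R / 2) (z::'a)) \<partial>lborel) * (\<integral>\<^sup>+x. ennreal ((W x)\<^sup>2) * indicator upper x \<partial>lborel)"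
    unfolding G_def by (rule tail_double_integral[OF W])
  show ?thesis
    by (rule order_trans[OF le[unfolded near] add_mono[OF mult_left_mono[OF add_left_mono[OF refl]] far_part]]) simp
qed

text \<open>The whole-space inequality applied to the even extension, with the doubled integral on
  the left halved at the end. The radius R/2 of the support leaves room for the tail
  estimate.\<close>

lemma half_space_sobolev:
  fixes s R C0 :: real
  defines "n \<equiv> real DIM('a)"
  defines "q \<equiv> 2 * n / (n - 2 * s)"
  assumes s: "0 < s" "s < 1" "2 * s < n" and sob: "sobolev_bound TYPE('a) s C0" and C0: "0 \<le> C0"
    and R: "0 < R" and x0: "height x0 = 0"
  shows "\<exists>A\<ge>0. \<forall>W\<in>borel_measurable borel. \<forall>e\<ge>0. \<forall>m\<ge>0. (\<forall>x. x \<notin> ball x0 (R / 2) \<longrightarrow> W x = 0) \<longrightarrow>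
     gform (\<lambda>x y. rker s (x - y)) (upper \<inter> ball x0 R) W (upper \<inter> ball x0 R) W
       + 2 * gform (\<lambda>x y. rker s (x - y)) (upper \<inter> ball x0 R) W (lower \<inter> ball x0 R) W \<le> ennreal e \<longrightarrow>
     (\<integral>\<^sup>+x. ennreal ((W x)\<^sup>2) * indicator upper x \<partial>lborel) \<le> ennreal m \<longrightarrow>
     (\<integral>\<^sup>+x. ennreal (\<bar>W x\<bar> powr q) * indicator upper x \<partial>lborel)
       \<le> ennreal ((2 powr (2 * s / n) * C0 * e + A * m) powr (n / (n - 2 * s)))"
proof -
  have "(\<integral>\<^sup>+z. ennreal (kernel_tail s (R / 2) (z::'a)) \<partial>lborel) < \<infinity>"
    using kernel_tail_finite[OF s(1,2), of "R / 2", where 'a='a] R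
    by (simp add: kernel_tail_def ennreal_mult' ennreal_indicator)
  then obtain \<theta> where \<theta>: "(\<integral>\<^sup>+z. ennreal (kernel_tail s (R / 2) (z::'a)) \<partial>lborel) = ennreal \<theta>" "0 \<le> \<theta>"
    by (cases "\<integral>\<^sup>+z. ennreal (kernel_tail s (R / 2) (z::'a)) \<partial>lborel") auto
  have n: "0 < n" by (simp add: n_def)
  \<comment> \<open>The extension has energy at most 2e + 8 theta m; multiplying by C0 2^(2s/n - 1)
    gives the coefficient 2^(2s/n) C0 for e and 4 theta times that for m.\<close>
  define A where "A = 2 powr (2 * s / n) * C0 * 4 * \<theta>"
  have A: "0 \<le> A" using C0 \<theta> by (simp add: A_def)
  have "(\<integral>\<^sup>+x. ennreal (\<bar>W x\<bar> powr q) * indicator upper x \<partial>lborel)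
       \<le> ennreal ((2 powr (2 * s / n) * C0 * e + A * m) powr (n / (n - 2 * s)))"
    if W [measurable]: "W \<in> borel_measurable borel" and e: "0 \<le> e" and m: "0 \<le> m"
      and supp: "\<And>x. x \<notin> ball x0 (R / 2) \<Longrightarrow> W x = 0"
      and E: "gform (\<lambda>x y. rker s (x - y)) (upper \<inter> ball x0 R) W (upper \<inter> ball x0 R) W
       + 2 * gform (\<lambda>x y. rker s (x - y)) (upper \<inter> ball x0 R) W (lower \<inter> ball x0 R) W \<le> ennreal e"
      and M: "(\<integral>\<^sup>+x. ennreal ((W x)\<^sup>2) * indicator upper x \<partial>lborel) \<le> ennreal m" for W e m
  proof -
    define e' where "e' = 2 * e + 8 * \<theta> * m"
    have e': "0 \<le> e'" using e m \<theta> by (simp add: e'_def)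
    have "seminorm_sq s (even_ext W) \<le> 2 * ennreal e + 8 * ennreal \<theta> * ennreal m"
      by (rule order_trans[OF seminorm_even_ext_le[OF s(1) W supp x0] add_mono[OF mult_left_mono[OF E] mult_mono[OF _ M]]])
        (simp_all add: \<theta>)
    also have "\<dots> = ennreal e'"
      using e m \<theta>(2) by (simp add: e'_def ennreal_mult)
    finally have 1: "seminorm_sq s (even_ext W) \<le> ennreal e'" .
    have "(\<integral>\<^sup>+x. ennreal ((even_ext W x)\<^sup>2) \<partial>lborel) = 2 * (\<integral>\<^sup>+x. ennreal ((W x)\<^sup>2) * indicator upper x \<partial>lborel)"
      by (rule nn_integral_even_ext[OF W, of "\<lambda>t. ennreal (t\<^sup>2)"]) measurable
    also have "\<dots> < \<infinity>"
      using le_less_trans[OF M ennreal_less_top] by (simp add: ennreal_mult_less_top)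
    finally have 2: "(\<integral>\<^sup>+x. ennreal ((even_ext W x)\<^sup>2) \<partial>lborel) < \<infinity>" .
    have "2 * (\<integral>\<^sup>+x. ennreal (\<bar>W x\<bar> powr q) * indicator upper x \<partial>lborel) = (\<integral>\<^sup>+x. ennreal (\<bar>even_ext W x\<bar> powr q) \<partial>lborel)"
      by (rule nn_integral_even_ext[OF W, of "\<lambda>t. ennreal (\<bar>t\<bar> powr q)", symmetric]) measurable
    also have "\<dots> \<le> ennreal ((C0 * e') powr (n / (n - 2 * s)))"
      using sob[unfolded sobolev_bound_def, rule_format, of "even_ext W" e'] 1 2 e'
      unfolding q_def n_def by simp
    finally have "ennreal (1 / 2) * (2 * (\<integral>\<^sup>+x. ennreal (\<bar>W x\<bar> powr q) * indicator upper x \<partial>lborel))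
        \<le> ennreal (1 / 2) * ennreal ((C0 * e') powr (n / (n - 2 * s)))"
      by (rule mult_left_mono) simp
    moreover have "ennreal (1 / 2) * (2 * X) = X" for X
    proof -
      have "ennreal (1 / 2) * ennreal 2 = 1" by (subst ennreal_mult[symmetric]) auto
      then show ?thesis by (simp only: mult.assoc[symmetric] ennreal_numeral mult_1_left)
    qed
    moreover have "ennreal (1 / 2) * ennreal ((C0 * e') powr (n / (n - 2 * s))) = ennreal ((C0 * e') powr (n / (n - 2 * s)) / 2)"
      by (subst ennreal_mult[symmetric]) auto
    ultimately have "(\<integral>\<^sup>+x. ennreal (\<bar>W x\<bar> powr q) * indicator upper x \<partial>lborel) \<le> ennreal ((C0 * e') powr (n / (n - 2 * s)) / 2)"
      by (simp only:)
    also have "(C0 * e') powr (n / (n - 2 * s)) / 2 = (2 powr (2 * s / n) * C0 * e + A * m) powr (n / (n - 2 * s))"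
    proof -
      have "2 powr (2 * s / n) * C0 * e + A * m = 2 powr (2 * s / n - 1) * (C0 * e')"
        by (simp add: A_def e'_def powr_diff algebra_simps)
      \<comment> \<open>This is how the halving of the integral enters the base: (2s/n - 1) n/(n -
        2s) = -1.\<close>
      moreover have "(2 powr (2 * s / n - 1)) powr (n / (n - 2 * s)) = 1 / (2::real)"
      proof -
        have "(2 * s / n - 1) * (n / (n - 2 * s)) = -1" using n s by (simp add: field_simps)
        then show ?thesis by (simp add: powr_powr powr_minus)
      qed
      ultimately show ?thesis using C0 e' by (simp add: powr_mult)
    qed
    finally show ?thesis .
  qed
  note * = this
  show ?thesis by (intro exI[of _ A] conjI ballI allI impI A *) blast+
qed

end

section \<open>Flattening a \<open>C\<^sup>1\<close> boundary by a shear\<close>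

text \<open>On each level set of the rounded \<open>\<phi>\<close> the map is a translation along
  \<open>e\<close>, and \<open>\<phi>\<close> is constant along \<open>e\<close>, so the pieces are
  translated within their own level sets and stay disjoint.\<close>

lemma emeasure_vimage_step_shear:
  fixes e :: "'a::euclidean_space" and \<phi> :: "'a \<Rightarrow> real" and h :: real
  assumes [measurable]: "\<phi> \<in> borel_measurable borel" and inv: "\<And>x t. \<phi> (x + t *\<^sub>R e) = \<phi> x"
    and A [measurable]: "A \<in> sets borel"
  shows "emeasure lborel ((\<lambda>x. x + (h * of_int \<lfloor>\<phi> x / h\<rfloor>) *\<^sub>R e) -` A) = emeasure lborel A"
proof -
  define P where "P k = {x. \<lfloor>\<phi> x / h\<rfloor> = k}" for k :: int
  have [measurable]: "P k \<in> sets borel" for k unfolding P_def by measurable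
  define T where "T k = (\<lambda>x. (h * of_int k) *\<^sub>R e + x)" for k :: int
  have T: "emeasure lborel (T k -` B) = emeasure lborel B" if [measurable]: "B \<in> sets borel" for B k
  proof -
    have "emeasure lborel B = emeasure (distr lborel borel ((+) ((h * of_int k) *\<^sub>R e))) B"
      by (simp only: lborel_distr_plus)
    also have "\<dots> = emeasure lborel (T k -` B)"
      by (subst emeasure_distr) (simp_all add: T_def)
    finally show ?thesis by simp
  qed
  have "(\<lambda>x. x + (h * of_int \<lfloor>\<phi> x / h\<rfloor>) *\<^sub>R e) -` A = (\<Union>k. T k -` (A \<inter> P k))"
    using inv by (auto simp: T_def P_def add.commute)
  also have "emeasure lborel \<dots> = (\<integral>\<^sup>+k. emeasure lborel (T k -` (A \<inter> P k)) \<partial>count_space UNIV)"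
  proof (rule emeasure_UN_countable)
    have "T k \<in> borel_measurable borel" for k unfolding T_def by measurable
    from measurable_sets[OF this, of "A \<inter> P k" for k]
    show "T k -` (A \<inter> P k) \<in> sets lborel" for k by simp
    show "disjoint_family_on (\<lambda>k. T k -` (A \<inter> P k)) UNIV"
      using inv by (auto simp: disjoint_family_on_def T_def P_def add.commute)
  qed simp
  also have "\<dots> = (\<integral>\<^sup>+k. emeasure lborel (A \<inter> P k) \<partial>count_space UNIV)"
    by (intro nn_integral_cong T) simp
  also have "\<dots> = emeasure lborel (\<Union>k. A \<inter> P k)"
    by (rule emeasure_UN_countable[symmetric]) (auto simp: disjoint_family_on_def P_def)
  also have "(\<Union>k. A \<inter> P k) = A" by (auto simp: P_def)
  finally show ?thesis .
qed

text \<open>A shear is a pointwise limit of piecewise translations, and Fatou's lemma gives one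
  inequality for open sets; the inverse shear gives the other.\<close>

lemma emeasure_vimage_shear_le:
  fixes e :: "'a::euclidean_space" and \<phi> :: "'a \<Rightarrow> real"
  assumes cont: "continuous_on UNIV \<phi>" and inv: "\<And>x t. \<phi> (x + t *\<^sub>R e) = \<phi> x" and U: "open U"
  shows "emeasure lborel ((\<lambda>x. x + \<phi> x *\<^sub>R e) -` U) \<le> emeasure lborel U"
proof -
  have \<phi>m [measurable]: "\<phi> \<in> borel_measurable borel" using cont by (rule borel_measurable_continuous_onI)
  have Um [measurable]: "U \<in> sets borel" using U by simp
  define h where "h i = inverse (real (Suc i))" for i
  define \<phi>' where "\<phi>' i x = h i * of_int \<lfloor>\<phi> x / h i\<rfloor>" for i x
  have [measurable]: "\<phi>' i \<in> borel_measurable borel" for i unfolding \<phi>'_def by measurable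
  have hpos: "0 < h i" for i by (simp add: h_def)
  have close: "\<bar>\<phi>' i x - \<phi> x\<bar> \<le> h i" for i x
  proof -
    have "h i * of_int \<lfloor>\<phi> x / h i\<rfloor> \<le> h i * (\<phi> x / h i)"
      using hpos[of i] by (intro mult_left_mono of_int_floor_le) simp
    then have "\<phi>' i x \<le> \<phi> x" using hpos[of i] by (simp add: \<phi>'_def)
    moreover have "\<phi> x / h i \<le> of_int \<lfloor>\<phi> x / h i\<rfloor> + 1" by linarith
    then have "\<phi> x \<le> \<phi>' i x + h i" using hpos[of i] by (simp add: \<phi>'_def field_simps)
    ultimately show ?thesis by linarith
  qed
  have lim: "(\<lambda>i. x + \<phi>' i x *\<^sub>R e) \<longlonglongrightarrow> x + \<phi> x *\<^sub>R e" for x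
  proof -
    have "(\<lambda>i. \<phi>' i x) \<longlonglongrightarrow> \<phi> x"
    proof (rule LIM_zero_cancel, rule Lim_null_comparison)
      show "\<forall>\<^sub>F i in sequentially. norm (\<phi>' i x - \<phi> x) \<le> h i" using close by simp
      show "h \<longlonglongrightarrow> 0" unfolding h_def by (rule LIMSEQ_inverse_real_of_nat)
    qed
    then show ?thesis by (intro tendsto_intros)
  qed
  define V where "V = (\<lambda>x. x + \<phi> x *\<^sub>R e) -` U"
  define V' where "V' i = (\<lambda>x. x + \<phi>' i x *\<^sub>R e) -` U" for i
  have [measurable]: "V \<in> sets borel" "V' i \<in> sets borel" for i
  proof -
    have "(\<lambda>x. x + \<phi> x *\<^sub>R e) \<in> borel_measurable borel" "(\<lambda>x. x + \<phi>' i x *\<^sub>R e) \<in> borel_measurable borel"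
      by measurable
    from measurable_sets[OF this(1) Um] measurable_sets[OF this(2) Um]
    show "V \<in> sets borel" "V' i \<in> sets borel" by (simp_all add: V_def V'_def)
  qed
  have "emeasure lborel V = (\<integral>\<^sup>+x. indicator V x \<partial>lborel)" by simp
  also have "\<dots> \<le> emeasure lborel U"
  \<comment> \<open>Intersecting with \<open>V\<close> makes the indicators converge everywhere:
    inside \<open>V\<close> openness of \<open>U\<close> puts the step maps into \<open>U\<close>
    eventually, outside \<open>V\<close> the indicators are 0.\<close>
  proof (rule nn_integral_le_of_tendsto[where f="\<lambda>i. indicator (V \<inter> V' i)"])
    fix i
    have "(\<integral>\<^sup>+x. indicator (V \<inter> V' i) x \<partial>lborel) = emeasure lborel (V \<inter> V' i)" by simp
    also have "\<dots> \<le> emeasure lborel (V' i)" by (intro emeasure_mono) auto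
    also have "\<dots> = emeasure lborel U"
      unfolding V'_def \<phi>'_def by (rule emeasure_vimage_step_shear[OF \<phi>m inv Um])
    finally show "(\<integral>\<^sup>+x. indicator (V \<inter> V' i) x \<partial>lborel) \<le> emeasure lborel U" .
  next
    fix x
    show "(\<lambda>i. indicator (V \<inter> V' i) x) \<longlonglongrightarrow> (indicator V x :: ennreal)"
    proof (cases "x \<in> V")
      case True
      then have "\<forall>\<^sub>F i in sequentially. x + \<phi>' i x *\<^sub>R e \<in> U"
        using topological_tendstoD[OF lim U] by (simp add: V_def)
      then have "\<forall>\<^sub>F i in sequentially. indicator (V \<inter> V' i) x = (indicator V x :: ennreal)"
        by (rule eventually_mono) (use True in \<open>simp add: V'_def\<close>)
      then show ?thesis by (rule tendsto_eventually)
    qed simp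
  qed simp
  finally show ?thesis by (simp add: V_def)
qed

lemma distr_shear:
  fixes e :: "'a::euclidean_space" and \<phi> :: "'a \<Rightarrow> real"
  assumes cont: "continuous_on UNIV \<phi>" and inv: "\<And>x t. \<phi> (x + t *\<^sub>R e) = \<phi> x"
  shows "distr lborel borel (\<lambda>x. x + \<phi> x *\<^sub>R e) = lborel"
proof (rule lborel_eqI[symmetric])
  let ?\<Psi> = "\<lambda>x. x + \<phi> x *\<^sub>R e" and ?\<Phi> = "\<lambda>x. x + (- \<phi> x) *\<^sub>R e"
  have cont\<Psi>: "continuous_on UNIV ?\<Psi>" using cont by (intro continuous_intros)
  then have m [measurable]: "?\<Psi> \<in> borel_measurable borel" by (rule borel_measurable_continuous_onI)
  fix l u :: 'a assume lu: "\<And>b. b \<in> Basis \<Longrightarrow> l \<bullet> b \<le> u \<bullet> b"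
  have "emeasure lborel (?\<Psi> -` box l u) = emeasure lborel (box l u)"
  proof (rule antisym)
    have "open (?\<Psi> -` box l u)" using cont\<Psi> open_box open_vimage by blast
    moreover have "continuous_on UNIV (\<lambda>x. - \<phi> x)" using cont by (rule continuous_on_minus)
    ultimately have "emeasure lborel (?\<Phi> -` (?\<Psi> -` box l u)) \<le> emeasure lborel (?\<Psi> -` box l u)"
      by (intro emeasure_vimage_shear_le[of "\<lambda>x. - \<phi> x" e]) (simp_all only: inv)
    moreover have "?\<Psi> (?\<Phi> x) = x" for x by (simp only: inv) simp
    then have "?\<Phi> -` (?\<Psi> -` box l u) = box l u" by (simp only: vimage_def mem_Collect_eq) simp
    ultimately show "emeasure lborel (box l u) \<le> emeasure lborel (?\<Psi> -` box l u)" by (simp only:)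
  qed (rule emeasure_vimage_shear_le[OF cont inv open_box])
  moreover have "emeasure (distr lborel borel ?\<Psi>) (box l u) = emeasure lborel (?\<Psi> -` box l u)"
    by (subst emeasure_distr[OF _]) simp_all
  ultimately show "emeasure (distr lborel borel ?\<Psi>) (box l u) = ennreal (\<Prod>b\<in>Basis. (u - l) \<bullet> b)"
    using emeasure_lborel_box[of l u, OF lu] by simp
qed simp

section \<open>Straightening the boundary near a point\<close>

text \<open>The mean value inequality for \<open>\<gamma>\<close> minus its linear part at
  \<open>y0\<close>: by continuity of the gradient the remaining derivative is small near
  \<open>y0\<close>.\<close>

lemma C1_remainder_lipschitz:
  fixes \<gamma> :: "'a::euclidean_space \<Rightarrow> real"
  assumes C1: "C1_function \<gamma>" and d: "0 < \<delta>"
  obtains g r where "0 < r"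
    "\<And>x y. x \<in> cball y0 r \<Longrightarrow> y \<in> cball y0 r \<Longrightarrow>
      \<bar>(\<gamma> x - g \<bullet> x) - (\<gamma> y - g \<bullet> y)\<bar> \<le> \<delta> * norm (x - y)"
proof -
  obtain G where G: "\<And>x. GDERIV \<gamma> x :> G x" "continuous_on UNIV G"
    using C1 unfolding C1_function_def by blast
  have "continuous (at y0) G" using G(2) by (simp add: continuous_on_eq_continuous_at)
  then obtain r where r': "0 < r" "\<forall>y. dist y y0 < r \<longrightarrow> dist (G y) (G y0) < \<delta>"
    using d unfolding continuous_at_eps_delta by auto
  then have r: "0 < r" "norm (y - y0) < r \<Longrightarrow> norm (G y - G y0) < \<delta>" for y
    by (auto simp: dist_norm)
  have *: "\<bar>(\<gamma> x - G y0 \<bullet> x) - (\<gamma> y - G y0 \<bullet> y)\<bar> \<le> \<delta> * norm (x - y)"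
    if xy: "x \<in> cball y0 (r / 2)" "y \<in> cball y0 (r / 2)" for x y
  proof -
    have "norm ((\<gamma> x - G y0 \<bullet> x) - (\<gamma> y - G y0 \<bullet> y)) \<le> \<delta> * norm (x - y)"
    proof (rule differentiable_bound[of "cball y0 (r / 2)" "\<lambda>x. \<gamma> x - G y0 \<bullet> x" "\<lambda>x h. h \<bullet> G x - G y0 \<bullet> h"])
      fix z assume z: "z \<in> cball y0 (r / 2)"
      have "(\<gamma> has_derivative (\<lambda>h. h \<bullet> G z)) (at z)" using G(1)[of z] by (simp add: gderiv_def)
      then show "((\<lambda>x. \<gamma> x - G y0 \<bullet> x) has_derivative (\<lambda>h. h \<bullet> G z - G y0 \<bullet> h)) (at z within cball y0 (r / 2))"
        by (rule has_derivative_at_withinI[OF has_derivative_diff[OF _ has_derivative_inner_right[OF has_derivative_ident]]])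
      have "norm (z - y0) < r" using z r(1) by (simp add: dist_norm norm_minus_commute)
      then have "norm (G z - G y0) \<le> \<delta>" by (rule less_imp_le[OF r(2)])
      show "onorm (\<lambda>h. h \<bullet> G z - G y0 \<bullet> h) \<le> \<delta>"
      proof (rule onorm_le)
        fix h
        have "h \<bullet> G z - G y0 \<bullet> h = h \<bullet> (G z - G y0)" by (simp add: inner_diff_right inner_commute)
        then have "norm (h \<bullet> G z - G y0 \<bullet> h) \<le> norm h * norm (G z - G y0)"
          using Cauchy_Schwarz_ineq2[of h "G z - G y0"] by simp
        also have "\<dots> \<le> norm h * \<delta>" using \<open>norm (G z - G y0) \<le> \<delta>\<close> by (intro mult_left_mono) auto
        finally show "norm (h \<bullet> G z - G y0 \<bullet> h) \<le> \<delta> * norm h" by (simp add: mult.commute)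
      qed
    qed (rule convex_cball, rule xy, rule xy)
    then show ?thesis by simp
  qed
  show ?thesis by (rule that[of "r / 2" "G y0"]) (simp add: r(1), rule *)
qed

text \<open>The shear subtracts from the graph its deviation from the tangent plane at \<open>x0\<close>; it is
  close to the identity although \<open>e\<close> need not be normal to the boundary.\<close>

lemma C1_boundary_flatten:
  fixes \<Omega> :: "'a::euclidean_space set"
  assumes "open \<Omega>" and C1: "C1_boundary \<Omega>" and x0: "x0 \<in> frontier \<Omega>" and d: "0 < \<delta>" "\<delta> \<le> 1"
  obtains R \<phi> e a b where "0 < R" "norm e = 1" "norm a = 1"
    "\<And>x t. \<phi> (x + t *\<^sub>R e) = \<phi> x" "\<And>x y. \<bar>\<phi> x - \<phi> y\<bar> \<le> \<delta> * norm (x - y)"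
    "\<phi> x0 = 0" "a \<bullet> x0 = b"
    "\<And>x. x - \<phi> x *\<^sub>R e \<in> ball x0 R \<Longrightarrow> x \<in> \<Omega> \<longleftrightarrow> b < a \<bullet> (x - \<phi> x *\<^sub>R e)"
proof -
  obtain r e \<gamma> where r: "0 < r" and e: "norm e = 1" and g: "C1_function \<gamma>"
    and \<Omega>: "\<Omega> \<inter> ball x0 r = {x \<in> ball x0 r. x \<bullet> e > \<gamma> (x - (x \<bullet> e) *\<^sub>R e)}"
    using C1 x0 unfolding C1_boundary_def by blast
  define P where "P x = x - (x \<bullet> e) *\<^sub>R e" for x
  have ee: "e \<bullet> e = 1" using e by (simp add: dot_square_norm)
  have P_shift: "P (x + t *\<^sub>R e) = P x" for x t
    by (simp add: P_def inner_add_left ee algebra_simps)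
  have P_diff: "P x - P y = P (x - y)" for x y
    by (simp add: P_def inner_diff_left algebra_simps)
  have P_norm: "norm (P x) \<le> norm x" for x
  proof -
    have "orthogonal ((x \<bullet> e) *\<^sub>R e) (P x)"
      by (simp add: orthogonal_def P_def inner_diff_right ee inner_commute)
    from norm_add_Pythagorean[OF this] have "(norm x)\<^sup>2 = (norm ((x \<bullet> e) *\<^sub>R e))\<^sup>2 + (norm (P x))\<^sup>2"
      by (simp add: P_def)
    then have "(norm (P x))\<^sup>2 \<le> (norm x)\<^sup>2" by simp
    then show ?thesis by (rule power2_le_imp_le) simp
  qed
  have mem: "x \<in> \<Omega> \<longleftrightarrow> x \<bullet> e > \<gamma> (P x)" if "x \<in> ball x0 r" for x
  proof -
    have "x \<in> \<Omega> \<inter> ball x0 r \<longleftrightarrow> x \<in> {x \<in> ball x0 r. x \<bullet> e > \<gamma> (x - (x \<bullet> e) *\<^sub>R e)}"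
      by (simp only: \<Omega>)
    then show ?thesis using that by (simp only: Int_iff mem_Collect_eq P_def) simp
  qed
  have \<gamma>cont: "continuous_on UNIV \<gamma>"
    using g unfolding C1_function_def gderiv_def
    by (meson continuous_at_imp_continuous_on has_derivative_continuous)
  have Pcont: "continuous_on UNIV P" unfolding P_def by (intro continuous_intros)
  have \<gamma>Pcont: "continuous_on UNIV (\<lambda>x. \<gamma> (P x))" by (rule continuous_on_compose2[OF \<gamma>cont Pcont]) simp
  \<comment> \<open>A frontier point of an open set is not in the set, hence not above the graph.
    Were it below, the open region below the graph near it would meet the domain.\<close>
  have onP: "x0 \<bullet> e = \<gamma> (P x0)"
  proof (rule antisym)
    have "x0 \<notin> \<Omega>" using x0 \<open>open \<Omega>\<close> by (simp add: frontier_def interior_open)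
    then have "\<not> x0 \<bullet> e > \<gamma> (P x0)" using mem[of x0] r by simp
    then show "x0 \<bullet> e \<le> \<gamma> (P x0)" by simp
    show "\<gamma> (P x0) \<le> x0 \<bullet> e"
    proof (rule ccontr)
      assume neg: "\<not> \<gamma> (P x0) \<le> x0 \<bullet> e"
      define N where "N = {x. x \<bullet> e < \<gamma> (P x)} \<inter> ball x0 r"
      have "open {x. x \<bullet> e < \<gamma> (P x)}"
        by (intro open_Collect_less \<gamma>Pcont) (intro continuous_intros)
      then have "open N" unfolding N_def by auto
      moreover have "x0 \<in> N" using neg r by (simp add: N_def)
      moreover have "x0 \<in> closure \<Omega>" using x0 by (simp add: frontier_def)
      ultimately have "N \<inter> closure \<Omega> \<noteq> {}" by blast
      then have "N \<inter> \<Omega> \<noteq> {}" by (simp only: open_Int_closure_eq_empty[OF \<open>open N\<close>] not_False_eq_True)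
      then obtain z where z: "z \<in> \<Omega>" "z \<in> N" by blast
      then have "z \<bullet> e > \<gamma> (P z)" using mem[of z] by (simp add: N_def)
      then show False using z(2) by (simp add: N_def)
    qed
  qed
  obtain g0 \<rho> where \<rho>: "0 < \<rho>" and lip: "\<And>x y. x \<in> cball (P x0) \<rho> \<Longrightarrow> y \<in> cball (P x0) \<rho> \<Longrightarrow>
      \<bar>(\<gamma> x - g0 \<bullet> x) - (\<gamma> y - g0 \<bullet> y)\<bar> \<le> \<delta> * norm (x - y)"
    by (rule C1_remainder_lipschitz[OF g d(1), of "P x0"]) blast
  \<comment> \<open>The remainder has a small Lipschitz constant only near \<open>P x0\<close>.
    Composing with the nearest-point projection onto that ball, which is 1-Lipschitz, extends it
    globally with the same constant.\<close>
  define c where "c x = closest_point (cball (P x0) \<rho>) (P x)" for x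
  have cin: "c x \<in> cball (P x0) \<rho>" for x
    unfolding c_def using \<rho> by (intro closest_point_in_set) auto
  have clip: "norm (c x - c y) \<le> norm (x - y)" for x y
  proof -
    have "dist (c x) (c y) \<le> dist (P x) (P y)"
      unfolding c_def using \<rho> by (intro closest_point_lipschitz) auto
    also have "\<dots> \<le> norm (x - y)" using P_norm[of "x - y"] by (simp add: dist_norm P_diff)
    finally show ?thesis by (simp add: dist_norm)
  qed
  have ceq: "c x = P x" if "dist x0 x \<le> \<rho>" for x
  proof -
    have "P x \<in> cball (P x0) \<rho>" using that P_norm[of "x0 - x"] by (simp add: dist_norm P_diff)
    then show ?thesis by (simp add: c_def closest_point_self)
  qed
  define k where "k = \<gamma> (P x0) - g0 \<bullet> P x0"
  define \<phi> where "\<phi> x = \<gamma> (c x) - g0 \<bullet> c x - k" for x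
  have \<phi>_shift: "\<phi> (x + t *\<^sub>R e) = \<phi> x" for x t by (simp add: \<phi>_def c_def P_shift)
  have \<phi>_lip: "\<bar>\<phi> x - \<phi> y\<bar> \<le> \<delta> * norm (x - y)" for x y
  proof -
    have "\<bar>\<phi> x - \<phi> y\<bar> \<le> \<delta> * norm (c x - c y)" using lip[OF cin cin, of x y] by (simp add: \<phi>_def)
    also have "\<dots> \<le> \<delta> * norm (x - y)" using clip d by (intro mult_left_mono) auto
    finally show ?thesis .
  qed
  have \<phi>0: "\<phi> x0 = 0" using ceq[of x0] \<rho> by (simp add: \<phi>_def k_def)
  \<comment> \<open>The gradient of x . e minus the linear part of the graph function: its level
    hyperplane through \<open>x0\<close> is the tangent plane. The pairing with \<open>e\<close> is
    1, so it is nonzero and can be normalised.\<close>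
  define a0 where "a0 = e - P g0"
  have Pg: "P g0 \<bullet> e = 0" by (simp add: P_def inner_diff_left ee)
  have Pg2: "P g0 \<bullet> x = g0 \<bullet> P x" for x
    by (simp add: P_def inner_diff_left inner_diff_right inner_commute)
  have "a0 \<bullet> e = 1" by (simp add: a0_def inner_diff_left ee Pg)
  then have a0: "a0 \<noteq> 0" by auto
  define a where "a = (1 / norm a0) *\<^sub>R a0"
  have key: "a0 \<bullet> x = x \<bullet> e - g0 \<bullet> P x" for x
    by (simp only: a0_def inner_diff_left Pg2 inner_commute[of e x])
  \<comment> \<open>Since \<open>\<delta> \<le> 1\<close>, undoing the shear at most doubles the
    distance to \<open>x0\<close>; half of the smaller radius therefore keeps \<open>x\<close> where
    both the graph description and the remainder bound hold.\<close>
  define R where "R = min r \<rho> / 2"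
  have R: "0 < R" using r \<rho> by (simp add: R_def)
  have iff: "x \<in> \<Omega> \<longleftrightarrow> k / norm a0 < a \<bullet> (x - \<phi> x *\<^sub>R e)" if "x - \<phi> x *\<^sub>R e \<in> ball x0 R" for x
  proof -
    have "norm (x - x0) \<le> norm (x - \<phi> x *\<^sub>R e - x0) + norm (\<phi> x *\<^sub>R e)"
      using norm_triangle_ineq[of "x - \<phi> x *\<^sub>R e - x0" "\<phi> x *\<^sub>R e"] by (simp add: algebra_simps)
    define y where "y = x - \<phi> x *\<^sub>R e"
    have xy: "x = y + \<phi> y *\<^sub>R e" using \<phi>_shift[of x "- \<phi> x"] by (simp add: y_def)
    have "norm (x - x0) \<le> norm (y - x0) + \<bar>\<phi> y - \<phi> x0\<bar>"
      using norm_triangle_ineq[of "y - x0" "\<phi> y *\<^sub>R e"] xy e \<phi>0 by (simp add: algebra_simps)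
    also have "\<dots> \<le> norm (y - x0) + 1 * norm (y - x0)"
      using \<phi>_lip[of y x0] d mult_right_mono[of \<delta> 1 "norm (y - x0)"] by simp
    also have "\<dots> < 2 * R" using that by (simp add: y_def dist_norm norm_minus_commute)
    finally have "norm (x - x0) < min r \<rho>" by (simp add: R_def)
    then have xr: "x \<in> ball x0 r" and x\<rho>: "dist x0 x \<le> \<rho>" by (auto simp: dist_norm norm_minus_commute)
    have "x \<in> \<Omega> \<longleftrightarrow> x \<bullet> e > \<gamma> (P x)" by (rule mem[OF xr])
    also have "\<dots> \<longleftrightarrow> k < a0 \<bullet> y"
    proof -
      have "P y = P x" unfolding y_def using P_shift[of x "- \<phi> x"] by simp
      moreover have "y \<bullet> e = x \<bullet> e - \<phi> x" by (simp add: y_def inner_diff_left ee)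
      ultimately show ?thesis by (simp add: key \<phi>_def ceq[OF x\<rho>])
    qed
    also have "\<dots> \<longleftrightarrow> k / norm a0 < a \<bullet> y" using a0 by (simp add: a_def divide_less_cancel)
    finally show ?thesis by (simp add: y_def)
  qed
  show ?thesis
  proof (rule that[OF R e _ \<phi>_shift \<phi>_lip \<phi>0 _ iff])
    show "norm a = 1" using a0 by (simp add: a_def)
    have "a0 \<bullet> x0 = k" by (simp add: key k_def onP)
    then show "a \<bullet> x0 = k / norm a0" by (simp add: a_def)
  qed
qed

section \<open>The energy over T as a sum of forms\<close>

lemma measurable_gform_inner:
  assumes [measurable]: "f \<in> borel_measurable borel" "g \<in> borel_measurable borel" "B \<in> sets borel"
    and k: "(\<lambda>p. k (fst p) (snd p)) \<in> borel_measurable (borel \<Otimes>\<^sub>M borel)"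
  shows "(\<lambda>x. \<integral>\<^sup>+y. ennreal ((f x - g y)\<^sup>2 * k x y) * indicator B y \<partial>lborel) \<in> borel_measurable borel"
    and "(\<lambda>y. k x y) \<in> borel_measurable borel"
proof -
  have [measurable]: "(\<lambda>p. k (fst p) (snd p)) \<in> borel_measurable (borel \<Otimes>\<^sub>M lborel)"
    using k by (simp add: measurable_def space_pair_measure sets_pair_measure)
  have "(\<lambda>(x, y). ennreal ((f x - g y)\<^sup>2 * k x y) * indicator B y) \<in> borel_measurable (borel \<Otimes>\<^sub>M lborel)"
    unfolding case_prod_beta' by measurable
  then show "(\<lambda>x. \<integral>\<^sup>+y. ennreal ((f x - g y)\<^sup>2 * k x y) * indicator B y \<partial>lborel) \<in> borel_measurable borel"
    by (rule lborel.borel_measurable_nn_integral)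
  show "(\<lambda>y. k x y) \<in> borel_measurable borel"
    using measurable_compose[OF measurable_Pair1', of x borel, OF _ k] by simp
qed

lemma gform_split_right:
  assumes [measurable]: "f \<in> borel_measurable borel" "g \<in> borel_measurable borel" "A \<in> sets borel" "B \<in> sets borel"
    and k: "(\<lambda>p. k (fst p) (snd p)) \<in> borel_measurable (borel \<Otimes>\<^sub>M borel)"
  shows "gform k A f UNIV g = gform k A f B g + gform k A f (- B) g"
proof -
  note [measurable] = measurable_gform_inner[OF _ _ _ k]
  have "(\<integral>\<^sup>+y. ennreal ((f x - g y)\<^sup>2 * k x y) * indicator UNIV y \<partial>lborel)
     = (\<integral>\<^sup>+y. ennreal ((f x - g y)\<^sup>2 * k x y) * indicator B y \<partial>lborel) + (\<integral>\<^sup>+y. ennreal ((f x - g y)\<^sup>2 * k x y) * indicator (- B) y \<partial>lborel)" for x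
  proof -
    have "(\<integral>\<^sup>+y. ennreal ((f x - g y)\<^sup>2 * k x y) * indicator UNIV y \<partial>lborel)
      = (\<integral>\<^sup>+y. ennreal ((f x - g y)\<^sup>2 * k x y) * indicator B y + ennreal ((f x - g y)\<^sup>2 * k x y) * indicator (- B) y \<partial>lborel)"
      by (intro nn_integral_cong) (simp add: indicator_def)
    also have "\<dots> = (\<integral>\<^sup>+y. ennreal ((f x - g y)\<^sup>2 * k x y) * indicator B y \<partial>lborel) + (\<integral>\<^sup>+y. ennreal ((f x - g y)\<^sup>2 * k x y) * indicator (- B) y \<partial>lborel)"
      by (rule nn_integral_add) measurable
    finally show ?thesis .
  qed
  then have "gform k A f UNIV g = (\<integral>\<^sup>+x. (\<integral>\<^sup>+y. ennreal ((f x - g y)\<^sup>2 * k x y) * indicator B y \<partial>lborel) * indicator A x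
      + (\<integral>\<^sup>+y. ennreal ((f x - g y)\<^sup>2 * k x y) * indicator (- B) y \<partial>lborel) * indicator A x \<partial>lborel)"
    unfolding gform_def by (simp only: distrib_right)
  also have "\<dots> = gform k A f B g + gform k A f (- B) g"
    unfolding gform_def by (rule nn_integral_add) measurable
  finally show ?thesis .
qed

lemma measurable_rker_diff: "(\<lambda>p. rker s (fst p - snd p)) \<in> borel_measurable (borel \<Otimes>\<^sub>M borel)"
  by measurable

text \<open>The energy over T for Borel functions: T consists of the pairs inside the domain and two
  mixed regions, equal by symmetry, whence the 2.\<close>

definition neumann_form :: "real \<Rightarrow> 'a::euclidean_space set \<Rightarrow> ('a \<Rightarrow> real) \<Rightarrow> ennreal" where
  "neumann_form s \<Omega> u = gform (\<lambda>x y. rker s (x - y)) \<Omega> u \<Omega> u + 2 * gform (\<lambda>x y. rker s (x - y)) \<Omega> u (- \<Omega>) u"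

lemma gform_rker_swap:
  assumes "u \<in> borel_measurable borel" "A \<in> sets borel" "B \<in> sets borel"
  shows "gform (\<lambda>x y. rker s (x - y)) A u B u = gform (\<lambda>x y. rker s (x - y)) B u A u"
  by (rule gform_swap[OF assms(1) assms(1) assms(2,3) measurable_rker_diff]) (rule rker_commute)

text \<open>For a function vanishing outside the set, pairs of two outside points contribute
  nothing.\<close>

lemma seminorm_eq_neumann_form:
  assumes u: "u \<in> borel_measurable borel" and \<Omega>: "\<Omega> \<in> sets borel" and zero: "\<And>x. x \<notin> \<Omega> \<Longrightarrow> u x = 0"
  shows "seminorm_sq s u = neumann_form s \<Omega> u"
proof -
  let ?K = "\<lambda>x y. rker s (x - y)"
  have \<Omega>': "- \<Omega> \<in> sets borel" using \<Omega> by auto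
  have "gform ?K (- \<Omega>) u (- \<Omega>) u = (\<integral>\<^sup>+x. 0 \<partial>(lborel::'a measure))"
    unfolding gform_def
  proof (intro nn_integral_cong)
    fix x
    have "(\<integral>\<^sup>+y. ennreal ((u x - u y)\<^sup>2 * ?K x y) * indicator (- \<Omega>) y \<partial>lborel) = (\<integral>\<^sup>+y. 0 \<partial>(lborel::'a measure))" if "x \<notin> \<Omega>"
      using zero that by (intro nn_integral_cong) (auto simp: indicator_def)
    then show "(\<integral>\<^sup>+y. ennreal ((u x - u y)\<^sup>2 * ?K x y) * indicator (- \<Omega>) y \<partial>lborel) * indicator (- \<Omega>) x = 0"
      by (cases "x \<in> \<Omega>") simp_all
  qed
  then have z: "gform ?K (- \<Omega>) u (- \<Omega>) u = 0" by simp
  have "seminorm_sq s u = gform ?K UNIV u \<Omega> u + gform ?K UNIV u (- \<Omega>) u"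
    by (rule gform_split_right[OF u u _ \<Omega> measurable_rker_diff]) simp
  also have "gform ?K UNIV u \<Omega> u = gform ?K \<Omega> u UNIV u"
    by (rule gform_rker_swap[OF u _ \<Omega>]) simp
  also have "gform ?K \<Omega> u UNIV u = gform ?K \<Omega> u \<Omega> u + gform ?K \<Omega> u (- \<Omega>) u"
    by (rule gform_split_right[OF u u \<Omega> \<Omega> measurable_rker_diff])
  also have "gform ?K UNIV u (- \<Omega>) u = gform ?K (- \<Omega>) u UNIV u"
    by (rule gform_rker_swap[OF u _ \<Omega>']) simp
  also have "gform ?K (- \<Omega>) u UNIV u = gform ?K (- \<Omega>) u \<Omega> u + gform ?K (- \<Omega>) u (- \<Omega>) u"
    by (rule gform_split_right[OF u u \<Omega>' \<Omega> measurable_rker_diff])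
  also have "gform ?K (- \<Omega>) u \<Omega> u = gform ?K \<Omega> u (- \<Omega>) u"
    by (rule gform_rker_swap[OF u \<Omega>' \<Omega>])
  finally show ?thesis unfolding neumann_form_def z by (simp add: mult_2 add.assoc)
qed

section \<open>Local inequalities\<close>

text \<open>\<open>c\<close> is the coefficient of the energy and \<open>A\<close> that of the mass,
  for functions supported in \<open>V\<close>. Real bounds \<open>e\<close> and \<open>m\<close>
  stand for the possibly infinite integrals so that the power on the right is taken of a real
  number.\<close>

definition local_bound :: "real \<Rightarrow> 'a::euclidean_space set \<Rightarrow> 'a set \<Rightarrow> real \<Rightarrow> real \<Rightarrow> bool" where
  "local_bound s \<Omega> V c A \<longleftrightarrow> (\<forall>w\<in>borel_measurable borel. \<forall>e\<ge>0. \<forall>m\<ge>0. (\<forall>x. x \<notin> V \<longrightarrow> w x = 0) \<longrightarrow>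
     neumann_form s \<Omega> w \<le> ennreal e \<longrightarrow> (\<integral>\<^sup>+x. ennreal ((w x)\<^sup>2) * indicator \<Omega> x \<partial>lborel) \<le> ennreal m \<longrightarrow>
     (\<integral>\<^sup>+x. ennreal (\<bar>w x\<bar> powr (2 * real DIM('a) / (real DIM('a) - 2 * s))) * indicator \<Omega> x \<partial>lborel)
       \<le> ennreal ((c * e + A * m) powr (real DIM('a) / (real DIM('a) - 2 * s))))"

text \<open>A function supported inside the domain has its whole energy over T, so the whole-space
  inequality applies without reflection and without a mass term.\<close>

lemma local_bound_interior:
  fixes \<Omega> :: "'a::euclidean_space set"
  assumes s: "2 * s < real DIM('a)" and \<Omega> [measurable]: "\<Omega> \<in> sets borel" and V: "V \<subseteq> \<Omega>"
    and sob: "sobolev_bound TYPE('a) s C0" and C0: "0 \<le> C0" "C0 \<le> c"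
  shows "local_bound s \<Omega> V c 0"
  unfolding local_bound_def
proof (intro ballI allI impI)
  fix w :: "'a \<Rightarrow> real" and e m :: real
  assume w [measurable]: "w \<in> borel_measurable borel" and e: "0 \<le> e" and m: "0 \<le> m"
    and supp: "\<forall>x. x \<notin> V \<longrightarrow> w x = 0" and E: "neumann_form s \<Omega> w \<le> ennreal e"
    and M: "(\<integral>\<^sup>+x. ennreal ((w x)\<^sup>2) * indicator \<Omega> x \<partial>lborel) \<le> ennreal m"
  let ?q = "2 * real DIM('a) / (real DIM('a) - 2 * s)" and ?p = "real DIM('a) / (real DIM('a) - 2 * s)"
  have zero: "w x = 0" if "x \<notin> \<Omega>" for x using supp V that by blast
  have 1: "seminorm_sq s w \<le> ennreal e" using E seminorm_eq_neumann_form[OF w \<Omega> zero] by simp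
  have "(\<integral>\<^sup>+x. ennreal ((w x)\<^sup>2) \<partial>lborel) = (\<integral>\<^sup>+x. ennreal ((w x)\<^sup>2) * indicator \<Omega> x \<partial>lborel)"
    using zero by (intro nn_integral_cong) (auto simp: indicator_def)
  also have "\<dots> < \<infinity>" using le_less_trans[OF M ennreal_less_top] by simp
  finally have 2: "(\<integral>\<^sup>+x. ennreal ((w x)\<^sup>2) \<partial>lborel) < \<infinity>" .
  have "(\<integral>\<^sup>+x. ennreal (\<bar>w x\<bar> powr ?q) * indicator \<Omega> x \<partial>lborel) \<le> (\<integral>\<^sup>+x. ennreal (\<bar>w x\<bar> powr ?q) \<partial>lborel)"
    by (intro nn_integral_mono) (auto simp: indicator_def)
  also have "\<dots> \<le> ennreal ((C0 * e) powr ?p)"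
    using sob[unfolded sobolev_bound_def, rule_format, of w e] w 1 2 e by simp
  also have "\<dots> \<le> ennreal ((c * e + 0 * m) powr ?p)"
    using s C0 e by (intro ennreal_leI powr_mono2) (auto intro: mult_right_mono)
  finally show "(\<integral>\<^sup>+x. ennreal (\<bar>w x\<bar> powr ?q) * indicator \<Omega> x \<partial>lborel) \<le> ennreal ((c * e + 0 * m) powr ?p)" .
qed

text \<open>The kernel is homogeneous of degree -(n + 2s) and decreasing in the norm away from 0.
  The last hypothesis excludes z = 0 with nonzero z', where the value \<open>rker s 0 = 0\<close>
  would falsify the bound.\<close>

lemma rker_bilipschitz:
  fixes z z' :: "'a::euclidean_space"
  assumes s: "0 < s" and k: "0 < k" and le: "norm z \<le> k * norm z'" and "z = 0 \<Longrightarrow> z' = 0"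
  shows "rker s z' \<le> k powr (real DIM('a) + 2 * s) * rker s z"
proof (cases "z = 0")
  case False
  let ?L = "real DIM('a) + 2 * s"
  have pos: "0 < norm z / k" using False k by simp
  have "norm z / k \<le> norm z'" using le k by (simp add: field_simps)
  then have "rker s z' \<le> (norm z / k) powr - ?L"
    unfolding rker_def using pos s by (intro powr_mono2') auto
  also have "\<dots> = k powr ?L * rker s z"
  proof -
    have "(norm z / k) powr - ?L = norm z powr - ?L / k powr - ?L" using k by (simp only: powr_divide)
    also have "\<dots> = k powr ?L * norm z powr - ?L" by (simp only: powr_minus_divide[of k]) simp
    finally show ?thesis by (simp only: rker_def)
  qed
  finally show ?thesis .
qed (use assms in simp)

text \<open>Both variables are changed by the measure-preserving map, so no Jacobian appears and the
  whole loss is the distortion of the kernel.\<close>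

lemma gform_transport_le:
  fixes \<Psi> :: "'a::euclidean_space \<Rightarrow> 'a"
  assumes s: "0 < s" and k: "0 < k" and \<Psi> [measurable]: "\<Psi> \<in> borel_measurable borel"
    and pres: "distr lborel borel \<Psi> = lborel"
    and lip: "\<And>x y. norm (x - y) \<le> k * norm (\<Psi> x - \<Psi> y)"
    and W [measurable]: "W \<in> borel_measurable borel" and w [measurable]: "w \<in> borel_measurable borel"
    and Ww: "\<And>x. W (\<Psi> x) = w x"
    and [measurable]: "A \<in> sets borel" "B \<in> sets borel" "A' \<in> sets borel" "B' \<in> sets borel"
    and AA: "\<And>x. \<Psi> x \<in> A \<Longrightarrow> x \<in> A'" and BB: "\<And>x. \<Psi> x \<in> B \<Longrightarrow> x \<in> B'"
  shows "gform (\<lambda>x y. rker s (x - y)) A W B W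
    \<le> ennreal (k powr (real DIM('a) + 2 * s)) * gform (\<lambda>x y. rker s (x - y)) A' w B' w"
proof -
  let ?L = "k powr (real DIM('a) + 2 * s)"
  note [measurable] = measurable_gform_inner(1)[OF _ _ _ measurable_rker_diff]
  have tr: "(\<integral>\<^sup>+x. f x \<partial>lborel) = (\<integral>\<^sup>+x. f (\<Psi> x) \<partial>lborel)" if [measurable]: "f \<in> borel_measurable borel" for f
  proof -
    have "(\<integral>\<^sup>+x. f x \<partial>lborel) = (\<integral>\<^sup>+x. f x \<partial>distr lborel borel \<Psi>)" by (simp only: pres)
    also have "\<dots> = (\<integral>\<^sup>+x. f (\<Psi> x) \<partial>lborel)" by (rule nn_integral_distr) measurable
    finally show ?thesis .
  qed
  have "gform (\<lambda>x y. rker s (x - y)) A W B W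
     = (\<integral>\<^sup>+x. (\<integral>\<^sup>+y. ennreal ((W (\<Psi> x) - W y)\<^sup>2 * rker s (\<Psi> x - y)) * indicator B y \<partial>lborel) * indicator A (\<Psi> x) \<partial>lborel)"
    unfolding gform_def by (rule tr) measurable
  also have "\<dots> = (\<integral>\<^sup>+x. (\<integral>\<^sup>+y. ennreal ((W (\<Psi> x) - W (\<Psi> y))\<^sup>2 * rker s (\<Psi> x - \<Psi> y)) * indicator B (\<Psi> y) \<partial>lborel) * indicator A (\<Psi> x) \<partial>lborel)"
  proof -
    have "(\<integral>\<^sup>+y. ennreal ((W (\<Psi> x) - W y)\<^sup>2 * rker s (\<Psi> x - y)) * indicator B y \<partial>lborel)
      = (\<integral>\<^sup>+y. ennreal ((W (\<Psi> x) - W (\<Psi> y))\<^sup>2 * rker s (\<Psi> x - \<Psi> y)) * indicator B (\<Psi> y) \<partial>lborel)" for x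
      by (rule tr) measurable
    then show ?thesis by (simp only:)
  qed
  also have "\<dots> \<le> (\<integral>\<^sup>+x. ennreal ?L * ((\<integral>\<^sup>+y. ennreal ((w x - w y)\<^sup>2 * rker s (x - y)) * indicator B' y \<partial>lborel) * indicator A' x) \<partial>lborel)"
  proof (rule nn_integral_mono)
    fix x
    have "(\<integral>\<^sup>+y. ennreal ((W (\<Psi> x) - W (\<Psi> y))\<^sup>2 * rker s (\<Psi> x - \<Psi> y)) * indicator B (\<Psi> y) \<partial>lborel)
      \<le> (\<integral>\<^sup>+y. ennreal ?L * (ennreal ((w x - w y)\<^sup>2 * rker s (x - y)) * indicator B' y) \<partial>lborel)"
    proof (rule nn_integral_mono)
      fix y
      have "rker s (\<Psi> x - \<Psi> y) \<le> ?L * rker s (x - y)"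
        by (rule rker_bilipschitz[OF s k lip]) simp
      then have "(w x - w y)\<^sup>2 * rker s (\<Psi> x - \<Psi> y) \<le> (w x - w y)\<^sup>2 * (?L * rker s (x - y))"
        by (rule mult_left_mono) simp
      then have "ennreal ((w x - w y)\<^sup>2 * rker s (\<Psi> x - \<Psi> y)) \<le> ennreal ?L * ennreal ((w x - w y)\<^sup>2 * rker s (x - y))"
        by (subst ennreal_mult[symmetric]) (auto intro!: ennreal_leI simp: mult_ac)
      moreover have "indicator B (\<Psi> y) \<le> (indicator B' y :: ennreal)" using BB by (auto simp: indicator_def)
      ultimately show "ennreal ((W (\<Psi> x) - W (\<Psi> y))\<^sup>2 * rker s (\<Psi> x - \<Psi> y)) * indicator B (\<Psi> y)
         \<le> ennreal ?L * (ennreal ((w x - w y)\<^sup>2 * rker s (x - y)) * indicator B' y)"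
        unfolding Ww mult.assoc[symmetric] by (intro mult_mono) auto
    qed
    also have "\<dots> = ennreal ?L * (\<integral>\<^sup>+y. ennreal ((w x - w y)\<^sup>2 * rker s (x - y)) * indicator B' y \<partial>lborel)"
      by (rule nn_integral_cmult) measurable
    finally show "(\<integral>\<^sup>+y. ennreal ((W (\<Psi> x) - W (\<Psi> y))\<^sup>2 * rker s (\<Psi> x - \<Psi> y)) * indicator B (\<Psi> y) \<partial>lborel) * indicator A (\<Psi> x)
      \<le> ennreal ?L * ((\<integral>\<^sup>+y. ennreal ((w x - w y)\<^sup>2 * rker s (x - y)) * indicator B' y \<partial>lborel) * indicator A' x)"
      unfolding mult.assoc[symmetric] using AA[of x] by (intro mult_mono) (auto simp: indicator_def)
  qed
  also have "\<dots> = ennreal ?L * gform (\<lambda>x y. rker s (x - y)) A' w B' w"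
    unfolding gform_def by (rule nn_integral_cmult) measurable
  finally show ?thesis .
qed

text \<open>Straighten, apply the half-space inequality, and transport back. The shear distorts
  distances by a factor at most 1 + delta, and \<open>\<epsilon>\<close> pays for that
  distortion.\<close>

lemma local_bound_boundary:
  fixes \<Omega> :: "'a::euclidean_space set" and s C0 :: real
  defines "n \<equiv> real DIM('a)"
  assumes \<Omega>: "open \<Omega>" "C1_boundary \<Omega>" and x0: "x0 \<in> frontier \<Omega>"
    and s: "0 < s" "s < 1" "2 * s < n" and sob: "sobolev_bound TYPE('a) s C0" and C0: "0 \<le> C0" and eps: "0 < \<epsilon>"
  shows "\<exists>\<rho>>0. \<exists>A\<ge>0. local_bound s \<Omega> (ball x0 \<rho>) (2 powr (2 * s / n) * C0 + \<epsilon>) A"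
proof -
  define B where "B = 2 powr (2 * s / n) * C0"
  have B: "0 \<le> B" using C0 by (simp add: B_def)
  have n: "0 < n" by (simp add: n_def)
  \<comment> \<open>Continuity of (1 + d)^(n + 2s) at d = 0: the distorted constant still fits below
    B + epsilon.\<close>
  obtain \<delta> where \<delta>: "0 < \<delta>" "\<delta> \<le> 1" "(1 + \<delta>) powr (n + 2 * s) * B \<le> B + \<epsilon>"
  proof -
    have "((\<lambda>d. (1 + d) powr (n + 2 * s) * B) \<longlongrightarrow> (1 + 0) powr (n + 2 * s) * B) (at_right 0)"
      by (intro tendsto_intros) auto
    then have "\<forall>\<^sub>F d in at_right 0. (1 + d) powr (n + 2 * s) * B < B + \<epsilon>"
      using eps by (intro order_tendstoD) auto
    moreover have "\<forall>\<^sub>F d in at_right 0. d \<in> {0<..<1::real}" by (rule eventually_at_right_real) simp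
    ultimately have "\<forall>\<^sub>F d in at_right 0. 0 < d \<and> d \<le> 1 \<and> (1 + d) powr (n + 2 * s) * B \<le> B + \<epsilon>"
      by eventually_elim auto
    then obtain d where "0 < d \<and> d \<le> 1 \<and> (1 + d) powr (n + 2 * s) * B \<le> B + \<epsilon>"
      using eventually_happens'[of "at_right (0::real)"] by (auto simp: trivial_limit_at_right_real)
    then show ?thesis using that by blast
  qed
  obtain R \<phi> e a b where R: "0 < R" and e: "norm e = 1" and a: "norm a = 1"
    and shift: "\<And>x t. \<phi> (x + t *\<^sub>R e) = \<phi> x" and lip: "\<And>x y. \<bar>\<phi> x - \<phi> y\<bar> \<le> \<delta> * norm (x - y)"
    and \<phi>0: "\<phi> x0 = 0" and ax0: "a \<bullet> x0 = b"
    and iff: "\<And>x. x - \<phi> x *\<^sub>R e \<in> ball x0 R \<Longrightarrow> x \<in> \<Omega> \<longleftrightarrow> b < a \<bullet> (x - \<phi> x *\<^sub>R e)"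
    by (rule C1_boundary_flatten[OF \<Omega> x0 \<delta>(1,2)]) (rule that; assumption)
  interpret hyperplane_reflection a b by unfold_locales (rule a)
  define \<Psi> where "\<Psi> x = x + (- \<phi> x) *\<^sub>R e" for x
  define \<Phi> where "\<Phi> x = x + \<phi> x *\<^sub>R e" for x
  have contphi: "continuous_on UNIV \<phi>"
  proof (rule continuous_onI)
    fix x :: 'a and r :: real assume "0 < r"
    moreover have "\<delta> * norm (y - x) \<le> norm (y - x)" for y :: 'a
      using \<delta> mult_right_mono[of \<delta> 1 "norm (y - x)"] by simp
    moreover have "dist (\<phi> y) (\<phi> x) \<le> \<delta> * norm (y - x)" for y
      using lip[of y x] by (simp add: dist_norm)
    ultimately have "\<forall>y\<in>UNIV. dist y x < r \<longrightarrow> dist (\<phi> y) (\<phi> x) \<le> r"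
      by (metis dist_norm order_trans less_imp_le)
    with \<open>0 < r\<close> show "\<exists>d>0. \<forall>y\<in>UNIV. dist y x < d \<longrightarrow> dist (\<phi> y) (\<phi> x) \<le> r" by blast
  qed
  have [measurable]: "\<phi> \<in> borel_measurable borel" using contphi by (rule borel_measurable_continuous_onI)
  have \<Psi>m [measurable]: "\<Psi> \<in> borel_measurable borel" unfolding \<Psi>_def by measurable
  have \<Phi>m [measurable]: "\<Phi> \<in> borel_measurable borel" unfolding \<Phi>_def by measurable
  have pres: "distr lborel borel \<Psi> = lborel"
    unfolding \<Psi>_def using contphi by (intro distr_shear continuous_on_minus) (simp_all only: shift)
  have \<Phi>\<Psi>: "\<Phi> (\<Psi> x) = x" for x unfolding \<Phi>_def \<Psi>_def by (simp only: shift) simp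
  have \<Psi>\<Phi>: "\<Psi> (\<Phi> x) = x" for x unfolding \<Phi>_def \<Psi>_def by (simp only: shift) simp
  have lip\<Psi>: "norm (x - y) \<le> (1 + \<delta>) * norm (\<Psi> x - \<Psi> y)" for x y
  proof -
    have "\<phi> x = \<phi> (\<Psi> x)" "\<phi> y = \<phi> (\<Psi> y)" unfolding \<Psi>_def by (simp_all only: shift)
    then have "\<bar>\<phi> x - \<phi> y\<bar> \<le> \<delta> * norm (\<Psi> x - \<Psi> y)" using lip[of "\<Psi> x" "\<Psi> y"] by simp
    moreover have "x - y = (\<Psi> x - \<Psi> y) + (\<phi> x - \<phi> y) *\<^sub>R e" by (simp add: \<Psi>_def algebra_simps)
    then have "norm (x - y) \<le> norm (\<Psi> x - \<Psi> y) + \<bar>\<phi> x - \<phi> y\<bar>"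
      using norm_triangle_ineq[of "\<Psi> x - \<Psi> y" "(\<phi> x - \<phi> y) *\<^sub>R e"] e by simp
    ultimately show ?thesis by (simp add: algebra_simps)
  qed
  have lip2: "norm (\<Psi> x - x0) \<le> 2 * norm (x - x0)" for x
  proof -
    have "\<bar>\<phi> x\<bar> \<le> \<delta> * norm (x - x0)" using lip[of x x0] \<phi>0 by simp
    also have "\<dots> \<le> norm (x - x0)" using \<delta> mult_right_mono[of \<delta> 1 "norm (x - x0)"] by simp
    finally have "\<bar>\<phi> x\<bar> \<le> norm (x - x0)" .
    moreover have eq: "\<Psi> x - x0 = (x - x0) + (- \<phi> x) *\<^sub>R e" by (simp add: \<Psi>_def)
    have "norm (\<Psi> x - x0) \<le> norm (x - x0) + \<bar>\<phi> x\<bar>"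
      unfolding eq using norm_triangle_ineq[of "x - x0" "(- \<phi> x) *\<^sub>R e"] e by simp
    ultimately show ?thesis by simp
  qed
  have hx0: "height x0 = 0" by (simp add: height_def ax0)
  have iffH: "x \<in> \<Omega> \<longleftrightarrow> 0 < height (\<Psi> x)" if "\<Psi> x \<in> ball x0 R" for x
    using iff[of x] that by (simp add: \<Psi>_def height_def)
  have \<Omega>m [measurable]: "\<Omega> \<in> sets borel" using \<Omega>(1) by simp
  have [measurable]: "lower \<in> sets borel" unfolding lower_def by measurable
  obtain A where A: "0 \<le> A"
    and hs: "\<And>W e m. W \<in> borel_measurable borel \<Longrightarrow> 0 \<le> e \<Longrightarrow> 0 \<le> m \<Longrightarrow> (\<And>x. x \<notin> ball x0 (R / 2) \<Longrightarrow> W x = 0) \<Longrightarrow>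
     gform (\<lambda>x y. rker s (x - y)) (upper \<inter> ball x0 R) W (upper \<inter> ball x0 R) W
       + 2 * gform (\<lambda>x y. rker s (x - y)) (upper \<inter> ball x0 R) W (lower \<inter> ball x0 R) W \<le> ennreal e \<Longrightarrow>
     (\<integral>\<^sup>+x. ennreal ((W x)\<^sup>2) * indicator upper x \<partial>lborel) \<le> ennreal m \<Longrightarrow>
     (\<integral>\<^sup>+x. ennreal (\<bar>W x\<bar> powr (2 * n / (n - 2 * s))) * indicator upper x \<partial>lborel)
       \<le> ennreal ((B * e + A * m) powr (n / (n - 2 * s)))"
    using half_space_sobolev[OF s[unfolded n_def] sob C0 R hx0] unfolding n_def[symmetric] B_def[symmetric] by auto
  define k where "k = (1 + \<delta>) powr (n + 2 * s)"
  have k0: "0 \<le> k" by (simp add: k_def)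
  \<comment> \<open>The radius is R/4 because the shear at most doubles the distance to
    \<open>x0\<close>: the transported function is then supported in the ball of radius R/2 that the
    half-space inequality requires.\<close>
  have "local_bound s \<Omega> (ball x0 (R / 4)) (B + \<epsilon>) A"
    unfolding local_bound_def n_def[symmetric]
  proof (intro ballI allI impI)
    fix w :: "'a \<Rightarrow> real" and E m :: real
    assume w [measurable]: "w \<in> borel_measurable borel" and E: "0 \<le> E" and m: "0 \<le> m"
      and supp: "\<forall>x. x \<notin> ball x0 (R / 4) \<longrightarrow> w x = 0" and EE: "neumann_form s \<Omega> w \<le> ennreal E"
      and M: "(\<integral>\<^sup>+x. ennreal ((w x)\<^sup>2) * indicator \<Omega> x \<partial>lborel) \<le> ennreal m"
    define W where "W x = w (\<Phi> x)" for x
    have Wm [measurable]: "W \<in> borel_measurable borel" unfolding W_def by measurable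
    have Ww: "W (\<Psi> x) = w x" for x by (simp add: W_def \<Phi>\<Psi>)
    have near: "\<Psi> x \<in> ball x0 (R / 2)" if "w x \<noteq> 0" for x
    proof -
      have "norm (x - x0) < R / 4" using supp that by (auto simp: dist_norm norm_minus_commute)
      then show ?thesis using lip2[of x] by (simp add: dist_norm norm_minus_commute)
    qed
    have Wsupp: "W x = 0" if "x \<notin> ball x0 (R / 2)" for x
      using near[of "\<Phi> x"] that by (auto simp: W_def \<Psi>\<Phi>)
    have trW: "(\<integral>\<^sup>+x. h (W x) * indicator upper x \<partial>lborel) = (\<integral>\<^sup>+x. h (w x) * indicator \<Omega> x \<partial>lborel)"
      if [measurable]: "h \<in> borel_measurable borel" and h0: "h 0 = 0" for h :: "real \<Rightarrow> ennreal"
    proof -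
      have "(\<integral>\<^sup>+x. h (W x) * indicator upper x \<partial>lborel) = (\<integral>\<^sup>+x. h (W x) * indicator upper x \<partial>distr lborel borel \<Psi>)"
        by (simp only: pres)
      also have "\<dots> = (\<integral>\<^sup>+x. h (W (\<Psi> x)) * indicator upper (\<Psi> x) \<partial>lborel)"
        by (rule nn_integral_distr) measurable
      also have "\<dots> = (\<integral>\<^sup>+x. h (w x) * indicator \<Omega> x \<partial>lborel)"
      proof (rule nn_integral_cong)
        fix x
        show "h (W (\<Psi> x)) * indicator upper (\<Psi> x) = h (w x) * indicator \<Omega> x"
        proof (cases "w x = 0")
          case False
          have "\<Psi> x \<in> ball x0 R" using near[OF False] R by auto
          then show ?thesis using iffH[of x] by (simp add: Ww upper_def indicator_def)
        qed (simp add: Ww h0)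
      qed
      finally show ?thesis .
    qed
    have inU: "x \<in> \<Omega>" if "\<Psi> x \<in> upper \<inter> ball x0 R" for x
      using that iffH[of x] by (simp add: upper_def)
    have inL: "x \<in> - \<Omega>" if "\<Psi> x \<in> lower \<inter> ball x0 R" for x
      using that iffH[of x] by (simp add: lower_def)
    have d1: "0 < 1 + \<delta>" using \<delta> by simp
    have f1: "gform (\<lambda>x y. rker s (x - y)) (upper \<inter> ball x0 R) W (upper \<inter> ball x0 R) W \<le> ennreal k * gform (\<lambda>x y. rker s (x - y)) \<Omega> w \<Omega> w"
      unfolding k_def n_def
      by (rule gform_transport_le[OF s(1) d1 \<Psi>m pres lip\<Psi> Wm w Ww _ _ \<Omega>m \<Omega>m inU inU]) auto
    have f2: "gform (\<lambda>x y. rker s (x - y)) (upper \<inter> ball x0 R) W (lower \<inter> ball x0 R) W \<le> ennreal k * gform (\<lambda>x y. rker s (x - y)) \<Omega> w (- \<Omega>) w"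
      unfolding k_def n_def
      by (rule gform_transport_le[OF s(1) d1 \<Psi>m pres lip\<Psi> Wm w Ww _ _ \<Omega>m _ inU inL]) auto
    have "gform (\<lambda>x y. rker s (x - y)) (upper \<inter> ball x0 R) W (upper \<inter> ball x0 R) W
       + 2 * gform (\<lambda>x y. rker s (x - y)) (upper \<inter> ball x0 R) W (lower \<inter> ball x0 R) W
      \<le> ennreal k * gform (\<lambda>x y. rker s (x - y)) \<Omega> w \<Omega> w + 2 * (ennreal k * gform (\<lambda>x y. rker s (x - y)) \<Omega> w (- \<Omega>) w)"
      by (intro add_mono mult_left_mono f1 f2) simp
    also have "\<dots> = ennreal k * neumann_form s \<Omega> w"
      by (simp add: neumann_form_def distrib_left mult.left_commute)
    also have "\<dots> \<le> ennreal k * ennreal E" by (intro mult_left_mono EE) simp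
    also have "\<dots> = ennreal (k * E)" using k0 E by (simp add: ennreal_mult)
    finally have F: "gform (\<lambda>x y. rker s (x - y)) (upper \<inter> ball x0 R) W (upper \<inter> ball x0 R) W
       + 2 * gform (\<lambda>x y. rker s (x - y)) (upper \<inter> ball x0 R) W (lower \<inter> ball x0 R) W \<le> ennreal (k * E)" .
    have M': "(\<integral>\<^sup>+x. ennreal ((W x)\<^sup>2) * indicator upper x \<partial>lborel) \<le> ennreal m"
      using M trW[of "\<lambda>t. ennreal (t\<^sup>2)"] by simp
    have "(\<integral>\<^sup>+x. ennreal (\<bar>w x\<bar> powr (2 * n / (n - 2 * s))) * indicator \<Omega> x \<partial>lborel)
       = (\<integral>\<^sup>+x. ennreal (\<bar>W x\<bar> powr (2 * n / (n - 2 * s))) * indicator upper x \<partial>lborel)"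
      by (rule trW[of "\<lambda>t. ennreal (\<bar>t\<bar> powr (2 * n / (n - 2 * s)))", symmetric]) simp_all
    also have "\<dots> \<le> ennreal ((B * (k * E) + A * m) powr (n / (n - 2 * s)))"
      by (rule hs[OF Wm _ m Wsupp F M']) (use k0 E in simp_all)
    also have "\<dots> \<le> ennreal (((B + \<epsilon>) * E + A * m) powr (n / (n - 2 * s)))"
    proof (intro ennreal_leI powr_mono2 add_right_mono)
      show "B * (k * E) \<le> (B + \<epsilon>) * E"
        using mult_right_mono[OF \<delta>(3) E] by (simp add: k_def mult_ac)
    qed (use s n B k0 E A m in auto)
    finally show "(\<integral>\<^sup>+x. ennreal (\<bar>w x\<bar> powr (2 * n / (n - 2 * s))) * indicator \<Omega> x \<partial>lborel)
      \<le> ennreal (((B + \<epsilon>) * E + A * m) powr (n / (n - 2 * s)))" .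
  qed
  then show ?thesis using R A unfolding B_def by (intro exI[of _ "R / 4"] conjI exI[of _ A]) auto
qed

section \<open>Localization\<close>

text \<open>For positive arguments this is convexity of the power; at the endpoint 0 it reduces to
  c^p <= c for 0 < c < 1.\<close>

lemma convex_on_powr_nonneg:
  assumes "1 \<le> p"
  shows "convex_on {0..} (\<lambda>x::real. x powr p)"
proof (rule convex_onI)
  fix t x y :: real
  assume t: "0 < t" "t < 1" and xy: "x \<in> {0..}" "y \<in> {0..}"
  have pw: "(c * z) powr p \<le> c * z powr p" if "0 < c" "c < 1" "0 \<le> z" for c z :: real
  proof -
    have "c powr p \<le> c powr 1" using that assms by (intro powr_mono') auto
    then show ?thesis using that by (simp add: powr_mult mult_right_mono)
  qed
  show "((1 - t) *\<^sub>R x + t *\<^sub>R y) powr p \<le> (1 - t) * x powr p + t * y powr p"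
  proof (cases "x = 0 \<or> y = 0")
    case True
    then show ?thesis using pw[of t y] pw[of "1 - t" x] t xy by auto
  next
    case False
    then show ?thesis
      using convex_onD[OF powr_convex[OF assms], of t x y] t xy by auto
  qed
qed (rule convex_real_interval)

text \<open>Minkowski's inequality without roots: \<open>N i\<close> bounds the \<open>L\<^sup>p\<close> norm of \<open>f i\<close>.\<close>

lemma nn_integral_powr_sum_le_pos:
  fixes f :: "'i \<Rightarrow> 'b \<Rightarrow> real" and N :: "'i \<Rightarrow> real"
  assumes I: "finite I" "I \<noteq> {}" and p: "1 \<le> p"
    and [measurable]: "\<And>i. i \<in> I \<Longrightarrow> f i \<in> borel_measurable M" and f0: "\<And>i x. i \<in> I \<Longrightarrow> 0 \<le> f i x"
    and N: "\<And>i. i \<in> I \<Longrightarrow> 0 < N i"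
    and le: "\<And>i. i \<in> I \<Longrightarrow> (\<integral>\<^sup>+x. ennreal (f i x powr p) \<partial>M) \<le> ennreal (N i powr p)"
  shows "(\<integral>\<^sup>+x. ennreal ((\<Sum>i\<in>I. f i x) powr p) \<partial>M) \<le> ennreal ((\<Sum>i\<in>I. N i) powr p)"
proof -
  define S where "S = (\<Sum>i\<in>I. N i)"
  have S: "0 < S" unfolding S_def using I N by (rule sum_pos)
  \<comment> \<open>Jensen's inequality with weights proportional to the norms: each f_i / N_i has
    L^p norm at most 1, and the sum of the f_i divided by \<open>S\<close> is their convex
    combination.\<close>
  define a where "a i = N i / S" for i
  have a0: "0 < a i" if "i \<in> I" for i using N[OF that] S by (simp add: a_def)
  have a1: "(\<Sum>i\<in>I. a i) = 1" using S by (simp add: a_def sum_divide_distrib[symmetric] S_def)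
  have jensen: "(\<Sum>i\<in>I. f i x) powr p \<le> (\<Sum>i\<in>I. (S powr p * a i / N i powr p) * f i x powr p)" for x
  proof -
    have "(\<Sum>i\<in>I. a i *\<^sub>R (f i x / N i)) powr p \<le> (\<Sum>i\<in>I. a i * (f i x / N i) powr p)"
      using convex_on_sum[OF I convex_on_powr_nonneg[OF p], of a "\<lambda>i. f i x / N i"] a0 a1 f0 N
      by (force simp: less_imp_le)
    moreover have "(\<Sum>i\<in>I. a i *\<^sub>R (f i x / N i)) = (\<Sum>i\<in>I. f i x) / S"
      unfolding sum_divide_distrib by (intro sum.cong refl) (use N in \<open>force simp: a_def\<close>)
    ultimately have "((\<Sum>i\<in>I. f i x) / S) powr p \<le> (\<Sum>i\<in>I. a i * (f i x / N i) powr p)" by simp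
    then have "S powr p * ((\<Sum>i\<in>I. f i x) / S) powr p \<le> S powr p * (\<Sum>i\<in>I. a i * (f i x / N i) powr p)"
      by (rule mult_left_mono) simp
    moreover have "S powr p * ((\<Sum>i\<in>I. f i x) / S) powr p = (\<Sum>i\<in>I. f i x) powr p"
      using S f0 by (simp add: powr_divide sum_nonneg)
    moreover have "S powr p * (\<Sum>i\<in>I. a i * (f i x / N i) powr p) = (\<Sum>i\<in>I. (S powr p * a i / N i powr p) * f i x powr p)"
      unfolding sum_distrib_left
      by (intro sum.cong refl) (use N f0 in \<open>simp add: powr_divide less_imp_le\<close>)
    ultimately show ?thesis by simp
  qed
  have c0: "0 \<le> S powr p * a i / N i powr p" if "i \<in> I" for i using a0[OF that] by (simp add: less_imp_le)
  have "(\<integral>\<^sup>+x. ennreal ((\<Sum>i\<in>I. f i x) powr p) \<partial>M)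
      \<le> (\<integral>\<^sup>+x. (\<Sum>i\<in>I. ennreal (S powr p * a i / N i powr p) * ennreal (f i x powr p)) \<partial>M)"
  proof (rule nn_integral_mono)
    fix x
    have "ennreal ((\<Sum>i\<in>I. f i x) powr p) \<le> ennreal (\<Sum>i\<in>I. (S powr p * a i / N i powr p) * f i x powr p)"
      by (rule ennreal_leI[OF jensen])
    also have "\<dots> = (\<Sum>i\<in>I. ennreal (S powr p * a i / N i powr p) * ennreal (f i x powr p))"
    proof (subst sum_ennreal[symmetric])
      show "0 \<le> (S powr p * a i / N i powr p) * f i x powr p" if "i \<in> I" for i
        using c0[OF that] by (rule mult_nonneg_nonneg) simp
      show "(\<Sum>i\<in>I. ennreal ((S powr p * a i / N i powr p) * f i x powr p)) = (\<Sum>i\<in>I. ennreal (S powr p * a i / N i powr p) * ennreal (f i x powr p))"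
        by (intro sum.cong refl ennreal_mult c0 powr_ge_zero)
    qed
    finally show "ennreal ((\<Sum>i\<in>I. f i x) powr p) \<le> (\<Sum>i\<in>I. ennreal (S powr p * a i / N i powr p) * ennreal (f i x powr p))" .
  qed
  also have "\<dots> = (\<Sum>i\<in>I. ennreal (S powr p * a i / N i powr p) * (\<integral>\<^sup>+x. ennreal (f i x powr p) \<partial>M))"
    by (subst nn_integral_sum) (auto intro!: sum.cong nn_integral_cmult)
  also have "\<dots> \<le> (\<Sum>i\<in>I. ennreal (S powr p * a i / N i powr p) * ennreal (N i powr p))"
    by (intro sum_mono mult_left_mono le) auto
  also have "\<dots> = (\<Sum>i\<in>I. ennreal (S powr p * a i))"
  proof (intro sum.cong refl)
    fix i assume i: "i \<in> I"
    show "ennreal (S powr p * a i / N i powr p) * ennreal (N i powr p) = ennreal (S powr p * a i)"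
      using c0[OF i] N[OF i] by (subst ennreal_mult[symmetric]) auto
  qed
  also have "\<dots> = ennreal (S powr p * (\<Sum>i\<in>I. a i))"
    using a0 by (subst sum_ennreal) (auto simp: sum_distrib_left less_imp_le)
  finally show ?thesis by (simp add: a1 S_def)
qed

lemma nn_integral_powr_sum_le:
  fixes f :: "'i \<Rightarrow> 'b \<Rightarrow> real" and N :: "'i \<Rightarrow> real"
  assumes I: "finite I" and p: "1 \<le> p"
    and m: "\<And>i. i \<in> I \<Longrightarrow> f i \<in> borel_measurable M" and f0: "\<And>i x. i \<in> I \<Longrightarrow> 0 \<le> f i x"
    and N: "\<And>i. i \<in> I \<Longrightarrow> 0 \<le> N i"
    and le: "\<And>i. i \<in> I \<Longrightarrow> (\<integral>\<^sup>+x. ennreal (f i x powr p) \<partial>M) \<le> ennreal (N i powr p)"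
  shows "(\<integral>\<^sup>+x. ennreal ((\<Sum>i\<in>I. f i x) powr p) \<partial>M) \<le> ennreal ((\<Sum>i\<in>I. N i) powr p)"
proof (cases "I = {}")
  case False
  define h where "h k = inverse (real (Suc k))" for k
  have h: "0 < h k" for k by (simp add: h_def)
  have "(\<integral>\<^sup>+x. ennreal ((\<Sum>i\<in>I. f i x) powr p) \<partial>M) \<le> ennreal ((\<Sum>i\<in>I. N i + h k) powr p)" for k
  proof (rule nn_integral_powr_sum_le_pos[OF I False p m f0])
    fix i assume i: "i \<in> I"
    show "0 < N i + h k" using N[OF i] h[of k] by simp
    show "(\<integral>\<^sup>+x. ennreal (f i x powr p) \<partial>M) \<le> ennreal ((N i + h k) powr p)"
      using N[OF i] h[of k] p by (intro order_trans[OF le[OF i]] ennreal_leI powr_mono2) auto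
  qed
  moreover have "(\<lambda>k. ennreal ((\<Sum>i\<in>I. N i + h k) powr p)) \<longlonglongrightarrow> ennreal ((\<Sum>i\<in>I. N i + 0) powr p)"
    unfolding h_def using p N
    by (intro tendsto_intros tendsto_powr2 LIMSEQ_inverse_real_of_nat tendsto_ennrealI)
      (auto intro!: always_eventually sum_nonneg add_nonneg_nonneg)
  ultimately have "(\<integral>\<^sup>+x. ennreal ((\<Sum>i\<in>I. f i x) powr p) \<partial>M) \<le> ennreal ((\<Sum>i\<in>I. N i + 0) powr p)"
    by (intro LIMSEQ_le_const) blast+
  then show ?thesis by simp
qed simp

section \<open>A Lipschitz partition with squares summing to one\<close>

text \<open>Cone functions over a finite cover, divided by the root of their sum of squares. The
  cover uses half radii, so that at each point of \<open>K\<close> some cone has height at least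
  1/2.\<close>

lemma lipschitz_partition:
  fixes K :: "'a::euclidean_space set" and \<rho> :: "'a \<Rightarrow> real"
  assumes K: "compact K" and \<rho>: "\<And>x. x \<in> K \<Longrightarrow> 0 < \<rho> x"
  obtains I L \<eta> where "finite I" "I \<subseteq> K" "0 \<le> L"
    "\<And>i x. i \<in> I \<Longrightarrow> 0 \<le> \<eta> i x" "\<And>i x. i \<in> I \<Longrightarrow> \<eta> i x \<le> (1::real)"
    "\<And>i x. i \<in> I \<Longrightarrow> x \<notin> ball i (\<rho> i) \<Longrightarrow> \<eta> i x = 0"
    "\<And>i x y. i \<in> I \<Longrightarrow> \<bar>\<eta> i x - \<eta> i y\<bar> \<le> L * norm (x - y)"
    "\<And>x. (\<Sum>i\<in>I. (\<eta> i x)\<^sup>2) \<le> 1" "\<And>x. x \<in> K \<Longrightarrow> (\<Sum>i\<in>I. (\<eta> i x)\<^sup>2) = 1"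
proof -
  have cov: "K \<subseteq> (\<Union>x\<in>K. ball x (\<rho> x / 2))" using \<rho> by force
  obtain I where I: "I \<subseteq> K" "finite I" "K \<subseteq> (\<Union>x\<in>I. ball x (\<rho> x / 2))"
    by (rule compactE_image[OF K _ cov]) (rule open_ball, rule that)
  have \<rho>I: "0 < \<rho> i" if "i \<in> I" for i using \<rho> I that by auto
  define g where "g i x = max 0 (1 - dist x i / \<rho> i)" for i x
  have g0: "0 \<le> g i x" for i x by (simp add: g_def)
  have g1: "g i x \<le> 1" if "i \<in> I" for i x using \<rho>I[OF that] by (simp add: g_def)
  have glip: "\<bar>g i x - g i y\<bar> \<le> 1 / \<rho> i * norm (x - y)" if "i \<in> I" for i x y
  proof -
    have "\<bar>g i x - g i y\<bar> \<le> \<bar>dist x i / \<rho> i - dist y i / \<rho> i\<bar>"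
      by (auto simp: g_def max_def)
    also have "\<dots> = \<bar>dist x i - dist y i\<bar> / \<rho> i"
      using \<rho>I[OF that] by (simp add: diff_divide_distrib[symmetric] abs_divide)
    also have "\<bar>dist x i - dist y i\<bar> \<le> norm (x - y)"
      using dist_triangle[of x i y] dist_triangle[of y i x] by (simp add: dist_norm norm_minus_commute abs_le_iff)
    finally show ?thesis using \<rho>I[OF that] by (simp add: divide_right_mono)
  qed
  define M where "M = (\<Sum>i\<in>I. 1 / \<rho> i)"
  have M0: "0 \<le> M" unfolding M_def using \<rho>I by (intro sum_nonneg) (simp add: less_imp_le)
  have Mi: "1 / \<rho> i \<le> M" if "i \<in> I" for i
    unfolding M_def using that \<rho>I I(2) by (intro member_le_sum) (auto simp: less_imp_le)
  define G where "G x = (\<Sum>i\<in>I. (g i x)\<^sup>2)" for x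
  \<comment> \<open>On \<open>K\<close> the sum of squares is at least 1/4, so the maximum is
    inactive and the normalisation exact. Elsewhere the floor 1/4 keeps the quotient Lipschitz, and
    the squares sum to at most 1.\<close>
  define D where "D x = sqrt (max (1 / 4) (G x))" for x
  have G0: "0 \<le> G x" for x by (simp add: G_def sum_nonneg)
  have Dge: "1 / 2 \<le> D x" for x
  proof -
    have "sqrt (1 / 4) \<le> D x" unfolding D_def by (intro real_sqrt_le_mono) simp
    then show ?thesis by (simp add: real_sqrt_divide)
  qed
  have D2: "(D x)\<^sup>2 = max (1 / 4) (G x)" for x unfolding D_def by (intro real_sqrt_pow2) simp
  have Glip: "\<bar>G x - G y\<bar> \<le> 2 * M * norm (x - y)" for x y
  proof -
    have "\<bar>(g i x)\<^sup>2 - (g i y)\<^sup>2\<bar> \<le> 2 * (1 / \<rho> i * norm (x - y))" if i: "i \<in> I" for i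
    proof -
      have "\<bar>(g i x)\<^sup>2 - (g i y)\<^sup>2\<bar> = \<bar>g i x + g i y\<bar> * \<bar>g i x - g i y\<bar>"
        by (simp add: abs_mult[symmetric] power2_eq_square algebra_simps)
      also have "\<dots> \<le> 2 * (1 / \<rho> i * norm (x - y))"
        using g0[of i x] g0[of i y] g1[OF i, of x] g1[OF i, of y] glip[OF i, of x y] by (intro mult_mono) auto
      finally show ?thesis .
    qed
    then have "(\<Sum>i\<in>I. \<bar>(g i x)\<^sup>2 - (g i y)\<^sup>2\<bar>) \<le> (\<Sum>i\<in>I. 2 * (1 / \<rho> i * norm (x - y)))"
      by (intro sum_mono)
    also have "\<dots> = 2 * M * norm (x - y)" by (simp add: M_def sum_distrib_left sum_distrib_right)
    finally show ?thesis
      unfolding G_def sum_subtractf[symmetric] using sum_abs[of "\<lambda>i. (g i x)\<^sup>2 - (g i y)\<^sup>2" I] by linarith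
  qed
  have Dlip: "\<bar>D x - D y\<bar> \<le> 2 * M * norm (x - y)" for x y
  proof -
    have "\<bar>D x - D y\<bar> \<le> \<bar>D x - D y\<bar> * (D x + D y)"
      using Dge[of x] Dge[of y] mult_left_mono[of 1 "D x + D y" "\<bar>D x - D y\<bar>"] by simp
    also have "\<dots> = \<bar>(D x)\<^sup>2 - (D y)\<^sup>2\<bar>"
    proof -
      have eq: "(D x)\<^sup>2 - (D y)\<^sup>2 = (D x - D y) * (D x + D y)" by (simp add: power2_eq_square algebra_simps)
      have "0 \<le> D x + D y" using Dge[of x] Dge[of y] by linarith
      then show ?thesis unfolding eq abs_mult by simp
    qed
    also have "\<dots> \<le> \<bar>G x - G y\<bar>" unfolding D2 by (auto simp: max_def)
    also note Glip
    finally show ?thesis .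
  qed
  define \<eta> where "\<eta> i x = g i x / D x" for i x
  have sumeta: "(\<Sum>i\<in>I. (\<eta> i x)\<^sup>2) = G x / max (1 / 4) (G x)" for x
    by (simp add: \<eta>_def power_divide D2 G_def sum_divide_distrib)
  have sum1: "(\<Sum>i\<in>I. (\<eta> i x)\<^sup>2) \<le> 1" for x
    unfolding sumeta using G0[of x] by (simp add: divide_le_eq)
  have eta0: "0 \<le> \<eta> i x" for i x using g0[of i x] Dge[of x] by (simp add: \<eta>_def)
  have eta1: "\<eta> i x \<le> 1" if "i \<in> I" for i x
  proof -
    have "(\<eta> i x)\<^sup>2 \<le> (\<Sum>i\<in>I. (\<eta> i x)\<^sup>2)" using that I(2) by (intro member_le_sum) auto
    then have "(\<eta> i x)\<^sup>2 \<le> 1\<^sup>2" using sum1[of x] by simp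
    then show ?thesis by (rule power2_le_imp_le) simp
  qed
  \<comment> \<open>With the denominators at least 1/2, the numerator contributes 2 M and the
    denominator 4 times its Lipschitz constant 2 M, in total 10 M.\<close>
  have etalip: "\<bar>\<eta> i x - \<eta> i y\<bar> \<le> 10 * M * norm (x - y)" if i: "i \<in> I" for i x y
  proof -
    have Dpos: "0 < D x" "0 < D y" using Dge[of x] Dge[of y] by linarith+
    have "\<eta> i x - \<eta> i y = (g i x - g i y) / D x + g i y * ((D y - D x) / (D x * D y))"
      using Dpos by (simp add: \<eta>_def field_simps)
    then have "\<bar>\<eta> i x - \<eta> i y\<bar> \<le> \<bar>(g i x - g i y) / D x\<bar> + \<bar>g i y * ((D y - D x) / (D x * D y))\<bar>"
      by (simp only: abs_triangle_ineq)
    moreover have "\<bar>(g i x - g i y) / D x\<bar> \<le> 2 * \<bar>g i x - g i y\<bar>"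
    proof -
      have "\<bar>g i x - g i y\<bar> * 1 \<le> \<bar>g i x - g i y\<bar> * (2 * D x)" using Dge[of x] by (intro mult_left_mono) auto
      then show ?thesis using Dpos by (simp add: abs_divide divide_le_eq mult_ac)
    qed
    moreover have "\<bar>g i y * ((D y - D x) / (D x * D y))\<bar> \<le> 4 * \<bar>D x - D y\<bar>"
    proof -
      have "1 / 2 * (1 / 2) \<le> D x * D y" using Dge[of x] Dge[of y] by (intro mult_mono) auto
      then have "\<bar>D x - D y\<bar> * 1 \<le> \<bar>D x - D y\<bar> * (4 * (D x * D y))" by (intro mult_left_mono) auto
      then have "\<bar>(D y - D x) / (D x * D y)\<bar> \<le> 4 * \<bar>D x - D y\<bar>"
        using Dpos by (simp add: abs_divide abs_mult divide_le_eq mult_ac abs_minus_commute)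
      moreover have "\<bar>g i y\<bar> \<le> 1" using g0[of i y] g1[OF i, of y] by simp
      ultimately have "\<bar>g i y\<bar> * \<bar>(D y - D x) / (D x * D y)\<bar> \<le> 1 * (4 * \<bar>D x - D y\<bar>)"
        by (intro mult_mono) auto
      then show ?thesis by (simp only: abs_mult mult_1_left)
    qed
    moreover have "2 * \<bar>g i x - g i y\<bar> + 4 * \<bar>D x - D y\<bar> \<le> 2 * (M * norm (x - y)) + 4 * (2 * M * norm (x - y))"
    proof -
      have "\<bar>g i x - g i y\<bar> \<le> M * norm (x - y)"
        using glip[OF i, of x y] mult_right_mono[OF Mi[OF i], of "norm (x - y)"] by simp
      then show ?thesis using Dlip[of x y] by (intro add_mono mult_left_mono) simp_all
    qed
    ultimately have "\<bar>\<eta> i x - \<eta> i y\<bar> \<le> 2 * (M * norm (x - y)) + 4 * (2 * M * norm (x - y))"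
      by (rule order_trans[OF _ order_trans[OF add_mono]])
    then show ?thesis by simp
  qed
  have sumK: "(\<Sum>i\<in>I. (\<eta> i x)\<^sup>2) = 1" if x: "x \<in> K" for x
  proof -
    obtain i where i: "i \<in> I" "dist i x < \<rho> i / 2" using I(3) x by auto
    then have "dist x i / \<rho> i < 1 / 2" using \<rho>I[OF i(1)] by (simp add: divide_less_eq dist_commute)
    then have "1 / 2 \<le> g i x" unfolding g_def by (intro max.coboundedI2) linarith
    then have "(1 / 2)\<^sup>2 \<le> (g i x)\<^sup>2" by (intro power_mono) auto
    also have "\<dots> \<le> G x" unfolding G_def using i I(2) by (intro member_le_sum) auto
    finally show ?thesis unfolding sumeta by (simp add: power2_eq_square)
  qed
  show ?thesis
  proof (rule that[of I "10 * M" \<eta>])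
    show "\<eta> i x = 0" if "i \<in> I" "x \<notin> ball i (\<rho> i)" for i x
      using that \<rho>I[of i] by (simp add: \<eta>_def g_def dist_commute)
  qed (use I M0 eta0 eta1 etalip sum1 sumK in auto)
qed

section \<open>Localization of the energy\<close>

text \<open>Write the difference as u (a - b) + b (u - v) and use Young's inequality. The asymmetric
  splitting is deliberate: the cutoff difference multiplies only \<open>u\<close>, the value at the
  point kept inside the domain, while \<open>v\<close> occurs only inside u - v.\<close>

lemma square_product_diff_le:
  fixes \<delta> :: real
  assumes "0 < \<delta>"
  shows "(a * u - b * v)\<^sup>2 \<le> (1 + \<delta>) * (b\<^sup>2 * (u - v)\<^sup>2) + (1 + 1 / \<delta>) * (u\<^sup>2 * (a - b)\<^sup>2)"
proof -
  define p where "p = u * (a - b)"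
  define q where "q = b * (u - v)"
  have eq: "a * u - b * v = p + q" by (simp add: p_def q_def algebra_simps)
  have sq: "u\<^sup>2 * (a - b)\<^sup>2 = p\<^sup>2" "b\<^sup>2 * (u - v)\<^sup>2 = q\<^sup>2" by (simp_all add: p_def q_def power_mult_distrib)
  have "0 \<le> (p / sqrt \<delta> - sqrt \<delta> * q)\<^sup>2" by simp
  then have "2 * (p * q) \<le> p\<^sup>2 / \<delta> + \<delta> * q\<^sup>2"
    using assms by (simp add: power2_diff power_divide power_mult_distrib)
  then show ?thesis unfolding eq sq by (simp add: power2_sum algebra_simps)
qed

text \<open>The main term carries the squared cutoffs at \<open>y\<close>, which may lie outside the
  domain; hence their sum must be at most 1 everywhere. Cutoff differences are at most 1 and at most
  L |x - y|, so the error integrates over \<open>y\<close> to a finite kernel moment times the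
  square of \<open>u x\<close>.\<close>

lemma localization_form:
  fixes \<Omega> :: "'a::euclidean_space set" and \<eta> :: "'i \<Rightarrow> 'a \<Rightarrow> real"
  assumes [measurable]: "\<Omega> \<in> sets borel" "B \<in> sets borel" and u [measurable]: "u \<in> borel_measurable borel"
    and I: "finite I" and \<eta>m [measurable]: "\<And>i. i \<in> I \<Longrightarrow> \<eta> i \<in> borel_measurable borel"
    and \<eta>01: "\<And>i x. i \<in> I \<Longrightarrow> 0 \<le> \<eta> i x" "\<And>i x. i \<in> I \<Longrightarrow> \<eta> i x \<le> 1"
    and lip: "\<And>i x y. i \<in> I \<Longrightarrow> \<bar>\<eta> i x - \<eta> i y\<bar> \<le> L * norm (x - y)"
    and sum1: "\<And>x. (\<Sum>i\<in>I. (\<eta> i x)\<^sup>2) \<le> 1" and \<delta>: "0 < \<delta>"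
  shows "(\<Sum>i\<in>I. gform (\<lambda>x y. rker s (x - y)) \<Omega> (\<lambda>x. \<eta> i x * u x) B (\<lambda>x. \<eta> i x * u x))
    \<le> ennreal (1 + \<delta>) * gform (\<lambda>x y. rker s (x - y)) \<Omega> u B u
      + ennreal ((1 + 1 / \<delta>) * (real (card I) * max 1 (L\<^sup>2))) * (\<integral>\<^sup>+z. ennreal (min 1 ((norm z)\<^sup>2) * rker s (z::'a)) \<partial>lborel)
        * (\<integral>\<^sup>+x. ennreal ((u x)\<^sup>2) * indicator \<Omega> x \<partial>lborel)"
proof -
  let ?K = "\<lambda>x y. rker s (x - y)"
  define T where "T z = ennreal (min 1 ((norm z)\<^sup>2) * rker s (z::'a))" for z
  have Tm [measurable]: "T \<in> borel_measurable borel" unfolding T_def by measurable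
  define Z where "Z = (\<integral>\<^sup>+z. T z \<partial>lborel)"
  have Teven: "T (- z) = T z" for z by (simp add: T_def)
  define C where "C = (1 + 1 / \<delta>) * (real (card I) * max 1 (L\<^sup>2))"
  have C: "0 \<le> C" using \<delta> by (simp add: C_def)
  note [measurable] = measurable_gform_inner(1)[OF _ _ _ measurable_rker_diff]
  have eta2: "(\<eta> i x - \<eta> i y)\<^sup>2 \<le> max 1 (L\<^sup>2) * min 1 ((norm (x - y))\<^sup>2)" if i: "i \<in> I" for i x y
  proof (cases "1 \<le> (norm (x - y))\<^sup>2")
    case True
    have "\<bar>\<eta> i x - \<eta> i y\<bar> \<le> 1" using \<eta>01[OF i, of x] \<eta>01[OF i, of y] by (simp add: abs_le_iff)
    then have "\<bar>\<eta> i x - \<eta> i y\<bar>\<^sup>2 \<le> 1\<^sup>2" by (intro power_mono) auto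
    then show ?thesis using True by simp
  next
    case False
    have "\<bar>\<eta> i x - \<eta> i y\<bar>\<^sup>2 \<le> (L * norm (x - y))\<^sup>2" using lip[OF i] by (intro power_mono) auto
    also have "\<dots> = L\<^sup>2 * (norm (x - y))\<^sup>2" by (simp add: power_mult_distrib)
    also have "\<dots> \<le> max 1 (L\<^sup>2) * (norm (x - y))\<^sup>2" by (intro mult_right_mono) auto
    finally show ?thesis using False by (simp add: min_def)
  qed
  have pt: "(\<Sum>i\<in>I. (\<eta> i x * u x - \<eta> i y * u y)\<^sup>2 * ?K x y)
      \<le> (1 + \<delta>) * ((u x - u y)\<^sup>2 * ?K x y) + C * (u x)\<^sup>2 * (min 1 ((norm (x - y))\<^sup>2) * ?K x y)" for x y
  proof -
    have "(\<Sum>i\<in>I. (\<eta> i x * u x - \<eta> i y * u y)\<^sup>2)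
        \<le> (\<Sum>i\<in>I. (1 + \<delta>) * (u x - u y)\<^sup>2 * (\<eta> i y)\<^sup>2 + (1 + 1 / \<delta>) * (u x)\<^sup>2 * (max 1 (L\<^sup>2) * min 1 ((norm (x - y))\<^sup>2)))"
    proof (rule sum_mono)
      fix i assume i: "i \<in> I"
      have "(1 + 1 / \<delta>) * (u x)\<^sup>2 * (\<eta> i x - \<eta> i y)\<^sup>2 \<le> (1 + 1 / \<delta>) * (u x)\<^sup>2 * (max 1 (L\<^sup>2) * min 1 ((norm (x - y))\<^sup>2))"
        using \<delta> by (intro mult_left_mono eta2[OF i]) auto
      then show "(\<eta> i x * u x - \<eta> i y * u y)\<^sup>2 \<le> (1 + \<delta>) * (u x - u y)\<^sup>2 * (\<eta> i y)\<^sup>2 + (1 + 1 / \<delta>) * (u x)\<^sup>2 * (max 1 (L\<^sup>2) * min 1 ((norm (x - y))\<^sup>2))"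
        using square_product_diff_le[OF \<delta>, of "\<eta> i x" "u x" "\<eta> i y" "u y"] by (simp add: mult_ac)
    qed
    also have "\<dots> = (1 + \<delta>) * (u x - u y)\<^sup>2 * (\<Sum>i\<in>I. (\<eta> i y)\<^sup>2) + C * (u x)\<^sup>2 * min 1 ((norm (x - y))\<^sup>2)"
      by (simp add: sum.distrib sum_distrib_left C_def mult_ac)
    also have "\<dots> \<le> (1 + \<delta>) * (u x - u y)\<^sup>2 * 1 + C * (u x)\<^sup>2 * min 1 ((norm (x - y))\<^sup>2)"
      using \<delta> by (intro add_right_mono mult_left_mono sum1) auto
    finally have "(\<Sum>i\<in>I. (\<eta> i x * u x - \<eta> i y * u y)\<^sup>2) * ?K x y
        \<le> ((1 + \<delta>) * (u x - u y)\<^sup>2 * 1 + C * (u x)\<^sup>2 * min 1 ((norm (x - y))\<^sup>2)) * ?K x y"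
      by (rule mult_right_mono) simp
    then show ?thesis by (simp add: sum_distrib_right distrib_right mult.assoc)
  qed
  have inner: "(\<Sum>i\<in>I. \<integral>\<^sup>+y. ennreal ((\<eta> i x * u x - \<eta> i y * u y)\<^sup>2 * ?K x y) * indicator B y \<partial>lborel)
      \<le> ennreal (1 + \<delta>) * (\<integral>\<^sup>+y. ennreal ((u x - u y)\<^sup>2 * ?K x y) * indicator B y \<partial>lborel) + ennreal C * Z * ennreal ((u x)\<^sup>2)" for x
  proof -
    have "(\<Sum>i\<in>I. \<integral>\<^sup>+y. ennreal ((\<eta> i x * u x - \<eta> i y * u y)\<^sup>2 * ?K x y) * indicator B y \<partial>lborel)
       = (\<integral>\<^sup>+y. (\<Sum>i\<in>I. ennreal ((\<eta> i x * u x - \<eta> i y * u y)\<^sup>2 * ?K x y) * indicator B y) \<partial>lborel)"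
      by (rule nn_integral_sum[symmetric]) measurable
    also have "\<dots> \<le> (\<integral>\<^sup>+y. ennreal (1 + \<delta>) * (ennreal ((u x - u y)\<^sup>2 * ?K x y) * indicator B y) + ennreal (C * (u x)\<^sup>2) * T (x - y) \<partial>lborel)"
    proof (rule nn_integral_mono)
      fix y
      show "(\<Sum>i\<in>I. ennreal ((\<eta> i x * u x - \<eta> i y * u y)\<^sup>2 * ?K x y) * indicator B y)
        \<le> ennreal (1 + \<delta>) * (ennreal ((u x - u y)\<^sup>2 * ?K x y) * indicator B y) + ennreal (C * (u x)\<^sup>2) * T (x - y)"
      proof (cases "y \<in> B")
        case True
        have "(\<Sum>i\<in>I. ennreal ((\<eta> i x * u x - \<eta> i y * u y)\<^sup>2 * ?K x y)) = ennreal (\<Sum>i\<in>I. (\<eta> i x * u x - \<eta> i y * u y)\<^sup>2 * ?K x y)"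
          by (rule sum_ennreal) simp
        also have "\<dots> \<le> ennreal ((1 + \<delta>) * ((u x - u y)\<^sup>2 * ?K x y) + C * (u x)\<^sup>2 * (min 1 ((norm (x - y))\<^sup>2) * ?K x y))"
          by (rule ennreal_leI[OF pt])
        also have "\<dots> = ennreal ((1 + \<delta>) * ((u x - u y)\<^sup>2 * ?K x y)) + ennreal (C * (u x)\<^sup>2 * (min 1 ((norm (x - y))\<^sup>2) * ?K x y))"
          using \<delta> C by (intro ennreal_plus mult_nonneg_nonneg) auto
        also have "ennreal ((1 + \<delta>) * ((u x - u y)\<^sup>2 * ?K x y)) = ennreal (1 + \<delta>) * ennreal ((u x - u y)\<^sup>2 * ?K x y)"
          using \<delta> by (intro ennreal_mult) auto
        also have "ennreal (C * (u x)\<^sup>2 * (min 1 ((norm (x - y))\<^sup>2) * ?K x y)) = ennreal (C * (u x)\<^sup>2) * T (x - y)"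
          unfolding T_def using C by (intro ennreal_mult mult_nonneg_nonneg) auto
        finally show ?thesis using True by simp
      qed simp
    qed
    also have "\<dots> = ennreal (1 + \<delta>) * (\<integral>\<^sup>+y. ennreal ((u x - u y)\<^sup>2 * ?K x y) * indicator B y \<partial>lborel) + ennreal (C * (u x)\<^sup>2) * (\<integral>\<^sup>+y. T (x - y) \<partial>lborel)"
      by (subst nn_integral_add) (auto simp: nn_integral_cmult)
    also have "(\<integral>\<^sup>+y. T (x - y) \<partial>lborel) = Z"
      unfolding Z_def by (rule nn_integral_translate_even(1)[OF Tm Teven])
    also have "ennreal (C * (u x)\<^sup>2) * Z = ennreal C * Z * ennreal ((u x)\<^sup>2)"
      using C by (simp add: ennreal_mult mult_ac)
    finally show ?thesis .
  qed
  have "(\<Sum>i\<in>I. gform ?K \<Omega> (\<lambda>x. \<eta> i x * u x) B (\<lambda>x. \<eta> i x * u x))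
     = (\<integral>\<^sup>+x. (\<Sum>i\<in>I. (\<integral>\<^sup>+y. ennreal ((\<eta> i x * u x - \<eta> i y * u y)\<^sup>2 * ?K x y) * indicator B y \<partial>lborel) * indicator \<Omega> x) \<partial>lborel)"
    unfolding gform_def by (rule nn_integral_sum[symmetric]) measurable
  also have "\<dots> \<le> (\<integral>\<^sup>+x. ennreal (1 + \<delta>) * ((\<integral>\<^sup>+y. ennreal ((u x - u y)\<^sup>2 * ?K x y) * indicator B y \<partial>lborel) * indicator \<Omega> x)
        + ennreal C * Z * (ennreal ((u x)\<^sup>2) * indicator \<Omega> x) \<partial>lborel)"
  proof (rule nn_integral_mono)
    fix x
    show "(\<Sum>i\<in>I. (\<integral>\<^sup>+y. ennreal ((\<eta> i x * u x - \<eta> i y * u y)\<^sup>2 * ?K x y) * indicator B y \<partial>lborel) * indicator \<Omega> x)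
      \<le> ennreal (1 + \<delta>) * ((\<integral>\<^sup>+y. ennreal ((u x - u y)\<^sup>2 * ?K x y) * indicator B y \<partial>lborel) * indicator \<Omega> x)
        + ennreal C * Z * (ennreal ((u x)\<^sup>2) * indicator \<Omega> x)"
      using inner[of x] by (cases "x \<in> \<Omega>") simp_all
  qed
  also have "\<dots> = ennreal (1 + \<delta>) * gform ?K \<Omega> u B u + ennreal C * Z * (\<integral>\<^sup>+x. ennreal ((u x)\<^sup>2) * indicator \<Omega> x \<partial>lborel)"
    unfolding gform_def by (subst nn_integral_add) (auto simp: nn_integral_cmult)
  finally show ?thesis by (simp only: C_def Z_def T_def)
qed

text \<open>The two forms enter with weights 1 and 2, and so do their identical error terms, which
  gives the factor 3.\<close>

lemma localization_neumann:
  fixes \<Omega> :: "'a::euclidean_space set" and \<eta> :: "'i \<Rightarrow> 'a \<Rightarrow> real"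
  assumes \<Omega>: "\<Omega> \<in> sets borel" and u: "u \<in> borel_measurable borel"
    and I: "finite I" and \<eta>m: "\<And>i. i \<in> I \<Longrightarrow> \<eta> i \<in> borel_measurable borel"
    and \<eta>01: "\<And>i x. i \<in> I \<Longrightarrow> 0 \<le> \<eta> i x" "\<And>i x. i \<in> I \<Longrightarrow> \<eta> i x \<le> 1"
    and lip: "\<And>i x y. i \<in> I \<Longrightarrow> \<bar>\<eta> i x - \<eta> i y\<bar> \<le> L * norm (x - y)"
    and sum1: "\<And>x. (\<Sum>i\<in>I. (\<eta> i x)\<^sup>2) \<le> 1" and \<delta>: "0 < \<delta>"
  shows "(\<Sum>i\<in>I. neumann_form s \<Omega> (\<lambda>x. \<eta> i x * u x))
    \<le> ennreal (1 + \<delta>) * neumann_form s \<Omega> u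
      + 3 * (ennreal ((1 + 1 / \<delta>) * (real (card I) * max 1 (L\<^sup>2))) * (\<integral>\<^sup>+z. ennreal (min 1 ((norm z)\<^sup>2) * rker s (z::'a)) \<partial>lborel)
        * (\<integral>\<^sup>+x. ennreal ((u x)\<^sup>2) * indicator \<Omega> x \<partial>lborel))"
proof -
  let ?g = "\<lambda>B w. gform (\<lambda>x y. rker s (x - y)) \<Omega> w B w"
  let ?E = "ennreal ((1 + 1 / \<delta>) * (real (card I) * max 1 (L\<^sup>2))) * (\<integral>\<^sup>+z. ennreal (min 1 ((norm z)\<^sup>2) * rker s (z::'a)) \<partial>lborel)
        * (\<integral>\<^sup>+x. ennreal ((u x)\<^sup>2) * indicator \<Omega> x \<partial>lborel)"
  have \<Omega>': "- \<Omega> \<in> sets borel" using \<Omega> by auto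
  have le: "(\<Sum>i\<in>I. ?g B (\<lambda>x. \<eta> i x * u x)) \<le> ennreal (1 + \<delta>) * ?g B u + ?E" if "B \<in> sets borel" for B
    by (rule localization_form[OF \<Omega> that u I \<eta>m \<eta>01 lip sum1 \<delta>])
  have "(\<Sum>i\<in>I. neumann_form s \<Omega> (\<lambda>x. \<eta> i x * u x)) = (\<Sum>i\<in>I. ?g \<Omega> (\<lambda>x. \<eta> i x * u x)) + 2 * (\<Sum>i\<in>I. ?g (- \<Omega>) (\<lambda>x. \<eta> i x * u x))"
    by (simp add: neumann_form_def sum.distrib sum_distrib_left)
  also have "\<dots> \<le> (ennreal (1 + \<delta>) * ?g \<Omega> u + ?E) + 2 * (ennreal (1 + \<delta>) * ?g (- \<Omega>) u + ?E)"
    by (intro add_mono mult_left_mono le \<Omega> \<Omega>') simp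
  also have "\<dots> = ennreal (1 + \<delta>) * neumann_form s \<Omega> u + 3 * ?E"
  proof -
    have "(a * x + E) + 2 * (a * y + E) = a * (x + 2 * y) + 3 * E" for a x y E :: ennreal
    proof -
      have "(a * x + E) + 2 * (a * y + E) = (a * x + 2 * (a * y)) + (E + 2 * E)" by (simp only: distrib_left add_ac)
      moreover have "a * x + 2 * (a * y) = a * (x + 2 * y)" by (simp only: distrib_left mult.left_commute)
      moreover have "E + 2 * E = (1 + 2) * E" by (simp only: distrib_right mult_1_left)
      moreover have "(1 + 2::ennreal) = 3" by simp
      ultimately show ?thesis by (simp only:)
    qed
    then show ?thesis unfolding neumann_form_def .
  qed
  finally show ?thesis .
qed

text \<open>Compactness of the closure leaves finitely many local inequalities with a common energy
  constant \<open>c\<close>. Minkowski's inequality adds them, and the local energies together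
  exceed the full energy by only a factor 1 + delta.\<close>

lemma neumann_sobolev:
  fixes \<Omega> :: "'a::euclidean_space set" and s C0 :: real
  defines "n \<equiv> real DIM('a)"
  assumes \<Omega>: "open \<Omega>" "bounded \<Omega>" "C1_boundary \<Omega>"
    and s: "0 < s" "s < 1" "2 * s < n" and sob: "sobolev_bound TYPE('a) s C0" and C0: "0 \<le> C0" and eps: "0 < \<epsilon>"
  shows "\<exists>A>0. \<forall>u\<in>borel_measurable borel. \<forall>e\<ge>0. \<forall>m\<ge>0. neumann_form s \<Omega> u \<le> ennreal e \<longrightarrow>
     (\<integral>\<^sup>+x. ennreal ((u x)\<^sup>2) * indicator \<Omega> x \<partial>lborel) \<le> ennreal m \<longrightarrow>
     (\<integral>\<^sup>+x. ennreal (\<bar>u x\<bar> powr (2 * n / (n - 2 * s))) * indicator \<Omega> x \<partial>lborel)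
       \<le> ennreal (((2 powr (2 * s / n) * C0 + \<epsilon>) * e + A * m) powr (n / (n - 2 * s)))"
proof -
  have n: "0 < n" by (simp add: n_def)
  define B where "B = 2 powr (2 * s / n) * C0"
  have B: "C0 \<le> B" "0 \<le> B"
  proof -
    have "1 * C0 \<le> 2 powr (2 * s / n) * C0"
      using s n C0 by (intro mult_right_mono ge_one_powr_ge_zero) auto
    then show "C0 \<le> B" "0 \<le> B" using C0 by (simp_all add: B_def)
  qed
  define c where "c = B + \<epsilon> / 2"
  have c: "0 < c" "C0 \<le> c" using B eps by (simp_all add: c_def)
  define p where "p = n / (n - 2 * s)"
  have p: "1 \<le> p" using s n by (simp add: p_def)
  have \<Omega>m [measurable]: "\<Omega> \<in> sets borel" using \<Omega>(1) by simp
  have "\<exists>\<rho> A. 0 < \<rho> \<and> 0 \<le> A \<and> local_bound s \<Omega> (ball x \<rho>) c A" if x: "x \<in> closure \<Omega>" for x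
  proof (cases "x \<in> \<Omega>")
    case True
    then obtain \<rho> where \<rho>: "0 < \<rho>" "ball x \<rho> \<subseteq> \<Omega>" using \<Omega>(1) openE by blast
    have "local_bound s \<Omega> (ball x \<rho>) c 0"
      by (rule local_bound_interior[OF s(3)[unfolded n_def] \<Omega>m \<rho>(2) sob C0 c(2)])
    then show ?thesis using \<rho>(1) by blast
  next
    case False
    then have "x \<in> frontier \<Omega>" using x \<Omega>(1) by (simp add: frontier_def interior_open)
    from local_bound_boundary[OF \<Omega>(1,3) this s[unfolded n_def] sob C0, of "\<epsilon> / 2"] eps
    show ?thesis by (simp add: c_def B_def n_def)
  qed
  note ex = this
  have "\<forall>x\<in>closure \<Omega>. \<exists>r. 0 < fst r \<and> 0 \<le> snd r \<and> local_bound s \<Omega> (ball x (fst r)) c (snd r)"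
  proof
    fix x assume "x \<in> closure \<Omega>"
    from ex[OF this] obtain r1 r2 where "0 < r1 \<and> 0 \<le> r2 \<and> local_bound s \<Omega> (ball x r1) c r2" by (elim exE)
    then show "\<exists>r. 0 < fst r \<and> 0 \<le> snd r \<and> local_bound s \<Omega> (ball x (fst r)) c (snd r)"
      by (intro exI[of _ "(r1, r2)"]) simp
  qed
  from bchoice[OF this] obtain F
    where F: "\<forall>x\<in>closure \<Omega>. 0 < fst (F x) \<and> 0 \<le> snd (F x) \<and> local_bound s \<Omega> (ball x (fst (F x))) c (snd (F x))" by (elim exE)
  define \<rho> where "\<rho> x = fst (F x)" for x
  define AA where "AA x = snd (F x)" for x
  have \<rho>: "0 < \<rho> x" and AA: "0 \<le> AA x" and lb: "local_bound s \<Omega> (ball x (\<rho> x)) c (AA x)" if "x \<in> closure \<Omega>" for x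
    using F that by (simp_all add: \<rho>_def AA_def)
  have cpt: "compact (closure \<Omega>)" using \<Omega>(2) by (simp add: compact_closure)
  obtain I L \<eta> where I: "finite I" "I \<subseteq> closure \<Omega>" and L: "0 \<le> L"
    and \<eta>01: "\<And>i x. i \<in> I \<Longrightarrow> 0 \<le> \<eta> i x" "\<And>i x. i \<in> I \<Longrightarrow> \<eta> i x \<le> (1::real)"
    and supp: "\<And>i x. i \<in> I \<Longrightarrow> x \<notin> ball i (\<rho> i) \<Longrightarrow> \<eta> i x = 0"
    and lip: "\<And>i x y. i \<in> I \<Longrightarrow> \<bar>\<eta> i x - \<eta> i y\<bar> \<le> L * norm (x - y)"
    and sum1: "\<And>x. (\<Sum>i\<in>I. (\<eta> i x)\<^sup>2) \<le> 1" and sumK: "\<And>x. x \<in> closure \<Omega> \<Longrightarrow> (\<Sum>i\<in>I. (\<eta> i x)\<^sup>2) = 1"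
    by (rule lipschitz_partition[of _ \<rho>, OF cpt \<rho>]) (assumption, (rule that; assumption))
  have \<eta>m: "\<eta> i \<in> borel_measurable borel" if i: "i \<in> I" for i
  proof -
    have "L-lipschitz_on UNIV (\<eta> i)"
      using lip[OF i] L by (intro lipschitz_onI) (simp_all add: dist_norm)
    then show ?thesis by (intro borel_measurable_continuous_onI lipschitz_on_continuous_on)
  qed
  \<comment> \<open>Half of \<open>\<epsilon>\<close> is already spent in \<open>c\<close>; this
    choice spends the other half, so that c (1 + delta) = B + epsilon.\<close>
  define \<delta> where "\<delta> = \<epsilon> / (2 * c)"
  have \<delta>: "0 < \<delta>" using eps c by (simp add: \<delta>_def)
  have c\<delta>: "c * (1 + \<delta>) = B + \<epsilon>" using c by (simp add: \<delta>_def c_def field_simps)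
  define Z where "Z = enn2real (\<integral>\<^sup>+z. ennreal (min 1 ((norm z)\<^sup>2) * rker s (z::'a)) \<partial>lborel)"
  have Z: "(\<integral>\<^sup>+z. ennreal (min 1 ((norm z)\<^sup>2) * rker s (z::'a)) \<partial>lborel) = ennreal Z" "0 \<le> Z"
    using kernel_moment_finite[OF s(1,2), where 'a='a] by (simp_all add: Z_def)
  define D where "D = 3 * ((1 + 1 / \<delta>) * (real (card I) * max 1 (L\<^sup>2)) * Z)"
  have D: "0 \<le> D" unfolding D_def using \<delta> Z(2) by (intro mult_nonneg_nonneg) auto
  \<comment> \<open>\<open>D\<close> is the mass error of the localization, multiplied by
    \<open>c\<close> when the local inequalities are summed; the \<open>AA i\<close> are their own
    mass coefficients. The final 1 secures strict positivity.\<close>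
  define A where "A = c * D + (\<Sum>i\<in>I. AA i) + 1"
  have AAI: "0 \<le> AA i" if "i \<in> I" for i using AA I(2) that by auto
  have A: "0 < A" unfolding A_def using c D sum_nonneg[of I AA, OF AAI] by (simp add: add_nonneg_pos)
  have "(\<integral>\<^sup>+x. ennreal (\<bar>u x\<bar> powr (2 * n / (n - 2 * s))) * indicator \<Omega> x \<partial>lborel) \<le> ennreal (((B + \<epsilon>) * e + A * m) powr p)"
    if u [measurable]: "u \<in> borel_measurable borel" and e: "0 \<le> e" and m: "0 \<le> m"
      and E: "neumann_form s \<Omega> u \<le> ennreal e"
      and M: "(\<integral>\<^sup>+x. ennreal ((u x)\<^sup>2) * indicator \<Omega> x \<partial>lborel) \<le> ennreal m" for u e m
  proof -
    define w where "w i x = \<eta> i x * u x" for i x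
    have wm [measurable]: "w i \<in> borel_measurable borel" if "i \<in> I" for i
      unfolding w_def using \<eta>m[OF that] by measurable
    have "(\<Sum>i\<in>I. neumann_form s \<Omega> (w i)) \<le> ennreal (1 + \<delta>) * neumann_form s \<Omega> u
      + 3 * (ennreal ((1 + 1 / \<delta>) * (real (card I) * max 1 (L\<^sup>2))) * ennreal Z * (\<integral>\<^sup>+x. ennreal ((u x)\<^sup>2) * indicator \<Omega> x \<partial>lborel))"
      unfolding w_def Z(1)[symmetric] by (rule localization_neumann[OF \<Omega>m u I(1) \<eta>m \<eta>01 lip sum1 \<delta>])
    also have "\<dots> \<le> ennreal (1 + \<delta>) * ennreal e + 3 * (ennreal ((1 + 1 / \<delta>) * (real (card I) * max 1 (L\<^sup>2))) * ennreal Z * ennreal m)"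
      by (intro add_mono mult_left_mono E M) auto
    also have "\<dots> = ennreal ((1 + \<delta>) * e + D * m)"
    proof -
      have k: "0 \<le> (1 + 1 / \<delta>) * (real (card I) * max 1 (L\<^sup>2))" using \<delta> by (intro mult_nonneg_nonneg) auto
      have "3 * (ennreal ((1 + 1 / \<delta>) * (real (card I) * max 1 (L\<^sup>2))) * ennreal Z * ennreal m) = ennreal (D * m)"
      proof -
        have "ennreal (D * m) = ennreal (3 * (((1 + 1 / \<delta>) * (real (card I) * max 1 (L\<^sup>2))) * Z * m))"
          by (simp only: D_def mult.assoc)
        also have "\<dots> = ennreal 3 * (ennreal ((1 + 1 / \<delta>) * (real (card I) * max 1 (L\<^sup>2))) * ennreal Z * ennreal m)"
          using k Z(2) m by (simp only: ennreal_mult mult_nonneg_nonneg zero_le_numeral)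
        finally show ?thesis by simp
      qed
      moreover have "ennreal (1 + \<delta>) * ennreal e = ennreal ((1 + \<delta>) * e)"
        using \<delta> e by (intro ennreal_mult[symmetric]) auto
      ultimately show ?thesis using \<delta> e D m by (simp only: ennreal_plus mult_nonneg_nonneg add_nonneg_nonneg less_imp_le zero_le_one)
    qed
    finally have sumle: "(\<Sum>i\<in>I. neumann_form s \<Omega> (w i)) \<le> ennreal ((1 + \<delta>) * e + D * m)" .
    define E' where "E' i = enn2real (neumann_form s \<Omega> (w i))" for i
    have E'0: "0 \<le> E' i" for i by (simp add: E'_def)
    have E': "neumann_form s \<Omega> (w i) = ennreal (E' i)" if "i \<in> I" for i
    proof -
      have "neumann_form s \<Omega> (w i) \<le> (\<Sum>i\<in>I. neumann_form s \<Omega> (w i))"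
        using that I(1) by (intro member_le_sum) auto
      also note sumle
      finally have "neumann_form s \<Omega> (w i) < \<infinity>" by (rule le_less_trans) simp
      then show ?thesis by (simp add: E'_def)
    qed
    have sumE: "(\<Sum>i\<in>I. E' i) \<le> (1 + \<delta>) * e + D * m"
    proof -
      have "ennreal (\<Sum>i\<in>I. E' i) = (\<Sum>i\<in>I. neumann_form s \<Omega> (w i))"
        using E' E'0 by (subst sum_ennreal[symmetric]) auto
      then have "ennreal (\<Sum>i\<in>I. E' i) \<le> ennreal ((1 + \<delta>) * e + D * m)" using sumle by simp
      then show ?thesis using \<delta> e D m by (subst (asm) ennreal_le_iff) auto
    qed
    \<comment> \<open>\<open>N i\<close> bounds the L^p norm of the square of the i-th piece, with p
      = n/(n - 2s), as Minkowski's inequality requires.\<close>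
    define N where "N i = c * E' i + AA i * m" for i
    have N0: "0 \<le> N i" if "i \<in> I" for i using c E'0[of i] AAI[OF that] m by (simp add: N_def)
    define f where "f i x = (w i x)\<^sup>2 * indicator \<Omega> x" for i x
    have powf: "(t\<^sup>2 * indicator \<Omega> x) powr p = \<bar>t\<bar> powr (2 * n / (n - 2 * s)) * indicator \<Omega> x" for t :: real and x
    proof -
      have "(t\<^sup>2) powr p = \<bar>t\<bar> powr (2 * p)"
      proof (cases "t = 0")
        case False
        then have "t\<^sup>2 = \<bar>t\<bar> powr 2" by simp
        then show ?thesis by (simp only: powr_powr)
      qed simp
      then show ?thesis by (simp add: p_def indicator_def)
    qed
    have fi: "(\<integral>\<^sup>+x. ennreal (f i x powr p) \<partial>lborel) \<le> ennreal (N i powr p)" if i: "i \<in> I" for i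
    proof -
      have "(\<integral>\<^sup>+x. ennreal ((w i x)\<^sup>2) * indicator \<Omega> x \<partial>lborel) \<le> (\<integral>\<^sup>+x. ennreal ((u x)\<^sup>2) * indicator \<Omega> x \<partial>lborel)"
      proof (intro nn_integral_mono mult_right_mono ennreal_leI)
        fix x
        have "(\<eta> i x)\<^sup>2 \<le> 1" using \<eta>01[OF i, of x] by (simp add: power_le_one)
        then have "(\<eta> i x)\<^sup>2 * (u x)\<^sup>2 \<le> 1 * (u x)\<^sup>2" by (rule mult_right_mono) simp
        then show "(w i x)\<^sup>2 \<le> (u x)\<^sup>2" by (simp add: w_def power_mult_distrib)
      qed simp
      also note M
      finally have Mi: "(\<integral>\<^sup>+x. ennreal ((w i x)\<^sup>2) * indicator \<Omega> x \<partial>lborel) \<le> ennreal m" .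
      have iK: "i \<in> closure \<Omega>" using i I(2) by auto
      have sw: "\<forall>x. x \<notin> ball i (\<rho> i) \<longrightarrow> w i x = 0" using supp[OF i] by (simp add: w_def)
      have "(\<integral>\<^sup>+x. ennreal (\<bar>w i x\<bar> powr (2 * n / (n - 2 * s))) * indicator \<Omega> x \<partial>lborel) \<le> ennreal (N i powr p)"
        using lb[OF iK, unfolded local_bound_def n_def[symmetric], rule_format, of "w i" "E' i" m] wm[OF i] E'0[of i] m sw E'[OF i] Mi
        by (simp add: N_def p_def)
      moreover have "(\<integral>\<^sup>+x. ennreal (f i x powr p) \<partial>lborel) = (\<integral>\<^sup>+x. ennreal (\<bar>w i x\<bar> powr (2 * n / (n - 2 * s))) * indicator \<Omega> x \<partial>lborel)"
        unfolding f_def powf by (intro nn_integral_cong) (simp add: indicator_def)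
      ultimately show ?thesis by simp
    qed
    have "(\<integral>\<^sup>+x. ennreal (\<bar>u x\<bar> powr (2 * n / (n - 2 * s))) * indicator \<Omega> x \<partial>lborel) = (\<integral>\<^sup>+x. ennreal ((\<Sum>i\<in>I. f i x) powr p) \<partial>lborel)"
    proof (rule nn_integral_cong)
      fix x
      \<comment> \<open>The normalisation of the cutoffs recovers the square of \<open>u\<close>
        inside the domain; this is why their squares, and not the cutoffs, sum to 1.\<close>
      have "(\<Sum>i\<in>I. f i x) = (\<Sum>i\<in>I. (\<eta> i x)\<^sup>2) * ((u x)\<^sup>2 * indicator \<Omega> x)"
        unfolding sum_distrib_right f_def w_def by (simp add: power_mult_distrib mult.assoc)
      also have "\<dots> = (u x)\<^sup>2 * indicator \<Omega> x"
        using sumK[of x] closure_subset[of \<Omega>] by (cases "x \<in> \<Omega>") auto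
      finally have "(\<Sum>i\<in>I. f i x) powr p = \<bar>u x\<bar> powr (2 * n / (n - 2 * s)) * indicator \<Omega> x"
        by (simp only: powf)
      then show "ennreal (\<bar>u x\<bar> powr (2 * n / (n - 2 * s))) * indicator \<Omega> x = ennreal ((\<Sum>i\<in>I. f i x) powr p)"
        by (simp add: indicator_def)
    qed
    also have "\<dots> \<le> ennreal ((\<Sum>i\<in>I. N i) powr p)"
    proof (rule nn_integral_powr_sum_le[OF I(1) p _ _ N0 fi])
      show "f i \<in> borel_measurable lborel" if "i \<in> I" for i using wm[OF that] unfolding f_def by measurable
      show "0 \<le> f i x" for i x by (simp add: f_def)
    qed
    also have "\<dots> \<le> ennreal (((B + \<epsilon>) * e + A * m) powr p)"
    proof (intro ennreal_leI powr_mono2)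
      have "(\<Sum>i\<in>I. N i) = c * (\<Sum>i\<in>I. E' i) + (\<Sum>i\<in>I. AA i) * m"
        by (simp add: N_def sum.distrib sum_distrib_left sum_distrib_right)
      \<comment> \<open>As \<open>c\<close> is the same for all pieces it multiplies the sum of the
        energies, so the number of pieces affects only the mass coefficient.\<close>
      also have "\<dots> \<le> c * ((1 + \<delta>) * e + D * m) + (\<Sum>i\<in>I. AA i) * m"
        using c sumE by (intro add_right_mono mult_left_mono) auto
      also have "\<dots> = (c * (1 + \<delta>)) * e + (c * D + (\<Sum>i\<in>I. AA i)) * m" by (simp add: algebra_simps)
      also have "\<dots> \<le> (B + \<epsilon>) * e + A * m"
        unfolding c\<delta> A_def using m by (intro add_left_mono mult_right_mono) auto
      finally show "(\<Sum>i\<in>I. N i) \<le> (B + \<epsilon>) * e + A * m" .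
      show "0 \<le> (\<Sum>i\<in>I. N i)" by (intro sum_nonneg N0)
    qed (use p in simp)
    finally show ?thesis .
  qed
  note * = this
  show ?thesis
    unfolding B_def[symmetric] p_def[symmetric]
    by (intro exI[of _ A] conjI ballI allI impI A *)
qed

section \<open>The constants\<close>

text \<open>As \<open>inverse 0 = 0\<close> and a divergent Bochner integral is 0, the integral must
  be shown both finite and nonzero. Finiteness follows from 1 - cos t = 2 sin(t/2)^2 and the kernel
  moment.\<close>

lemma c_const_pos:
  fixes s :: real
  assumes s: "0 < s" "s < 1"
  shows "0 < c_const TYPE('n::{finite,linorder}) s"
proof -
  let ?k = "Min (UNIV :: 'n set)"
  define f where "f \<theta> = (1 - cos (\<theta> $ ?k)) / norm \<theta> powr (real CARD('n) + 2 * s)" for \<theta> :: "real^'n::{finite,linorder}"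
  have f_eq: "f \<theta> = (1 - cos (\<theta> $ ?k)) * rker s \<theta>" for \<theta>
    unfolding f_def rker_def DIM_cart DIM_real mult_1_right powr_minus divide_inverse by simp
  have fm [measurable]: "f \<in> borel_measurable borel" unfolding f_eq by measurable
  have f0: "0 \<le> f \<theta>" for \<theta> by (simp add: f_eq)
  have "(\<integral>\<^sup>+\<theta>. ennreal (f \<theta>) \<partial>lborel) \<le> (\<integral>\<^sup>+\<theta>. 2 * ennreal (min 1 ((norm \<theta>)\<^sup>2) * rker s (\<theta>::real^'n::{finite,linorder})) \<partial>lborel)"
  proof (rule nn_integral_mono)
    fix \<theta> :: "real^'n::{finite,linorder}"
    have "1 - cos (\<theta> $ ?k) \<le> 2 * min 1 ((norm \<theta>)\<^sup>2)"
    proof -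
      have "1 - cos (\<theta> $ ?k) = 2 * (sin (\<theta> $ ?k / 2))\<^sup>2"
        using cos_double_sin[of "\<theta> $ ?k / 2"] by simp
      also have "(sin (\<theta> $ ?k / 2))\<^sup>2 \<le> min 1 ((norm \<theta>)\<^sup>2)"
      proof (rule min.boundedI)
        have "\<bar>sin (\<theta> $ ?k / 2)\<bar> \<le> \<bar>\<theta> $ ?k / 2\<bar>" by (rule abs_sin_x_le_abs_x)
        also have "\<dots> \<le> \<bar>norm \<theta>\<bar>" using component_le_norm_cart[of \<theta> ?k] by simp
        finally show "(sin (\<theta> $ ?k / 2))\<^sup>2 \<le> (norm \<theta>)\<^sup>2" by (simp only: abs_le_square_iff)
        show "(sin (\<theta> $ ?k / 2))\<^sup>2 \<le> 1" by (simp add: abs_square_le_1)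
      qed
      finally show ?thesis by simp
    qed
    then have "f \<theta> \<le> 2 * min 1 ((norm \<theta>)\<^sup>2) * rker s \<theta>"
      unfolding f_eq by (rule mult_right_mono) simp
    also have "\<dots> = 2 * (min 1 ((norm \<theta>)\<^sup>2) * rker s \<theta>)" by simp
    finally have "ennreal (f \<theta>) \<le> ennreal (2 * (min 1 ((norm \<theta>)\<^sup>2) * rker s \<theta>))" by (rule ennreal_leI)
    also have "\<dots> = 2 * ennreal (min 1 ((norm \<theta>)\<^sup>2) * rker s \<theta>)" by (subst ennreal_mult) simp_all
    finally show "ennreal (f \<theta>) \<le> 2 * ennreal (min 1 ((norm \<theta>)\<^sup>2) * rker s \<theta>)" .
  qed
  also have "\<dots> = 2 * (\<integral>\<^sup>+\<theta>. ennreal (min 1 ((norm \<theta>)\<^sup>2) * rker s (\<theta>::real^'n::{finite,linorder})) \<partial>lborel)"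
    by (rule nn_integral_cmult) measurable
  also have "\<dots> < \<infinity>"
    using kernel_moment_finite[OF s, where 'a="real^'n::{finite,linorder}"] by (simp add: ennreal_mult_less_top)
  finally have fin: "(\<integral>\<^sup>+\<theta>. ennreal (f \<theta>) \<partial>lborel) < \<infinity>" .
  have "(\<integral>\<^sup>+\<theta>. ennreal (f \<theta>) \<partial>lborel) \<noteq> 0"
  proof
    assume "(\<integral>\<^sup>+\<theta>. ennreal (f \<theta>) \<partial>lborel) = 0"
    then have ae: "AE \<theta> in lborel. f \<theta> \<le> 0" by (subst (asm) nn_integral_0_iff_AE) (auto simp: ennreal_eq_0_iff)
    \<comment> \<open>On this open slab the first coordinate lies strictly between 0 and 1, so its
      cosine is below 1 and the integrand is strictly positive.\<close>
    define U where "U = {\<theta> :: real^'n::{finite,linorder}. 0 < \<theta> $ ?k} \<inter> {\<theta>. \<theta> $ ?k < 1}"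
    have "open U" unfolding U_def by (intro open_Int open_Collect_less continuous_intros)
    moreover have "(\<Sum>i\<in>UNIV. axis i (1 / 2)) \<in> U"
      by (simp add: U_def axis_def)
    then have "U \<noteq> {}" by blast
    ultimately have "\<not> negligible U" by (rule open_not_negligible)
    have pos: "0 < f \<theta>" if "\<theta> \<in> U" for \<theta>
    proof -
      have k: "0 < \<theta> $ ?k" "\<theta> $ ?k < 1" using that by (auto simp: U_def)
      then have "\<theta> \<noteq> 0" by auto
      have "cos (\<theta> $ ?k) < cos 0" using k pi_gt3 by (intro cos_monotone_0_pi) auto
      then show ?thesis using \<open>\<theta> \<noteq> 0\<close> by (simp add: f_def)
    qed
    have Um: "U \<in> sets borel" using \<open>open U\<close> by simp
    have "AE \<theta> in lborel. \<theta> \<notin> U" using ae by eventually_elim (use pos in force)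
    then have "U \<in> null_sets lborel" using Um by (subst AE_iff_null_sets) auto
    then have "U \<in> null_sets lebesgue" by (rule null_sets_completionI)
    then have "negligible U" by (simp add: negligible_iff_null_sets)
    with \<open>\<not> negligible U\<close> show False by blast
  qed
  then have "0 < enn2real (\<integral>\<^sup>+\<theta>. ennreal (f \<theta>) \<partial>lborel)"
    using fin by (simp add: enn2real_positive_iff zero_less_iff_neq_zero)
  also have "enn2real (\<integral>\<^sup>+\<theta>. ennreal (f \<theta>) \<partial>lborel) = (LINT \<theta>|lebesgue. f \<theta>)"
    by (subst integral_eq_nn_integral) (simp_all add: f0 nn_integral_completion measurable_completion)
  finally show ?thesis by (simp add: c_const_def f_def)
qed

section \<open>Borel representatives of functions in the energy space\<close>

text \<open>The exceptional pairs lie in the union of two products with a null factor, which is null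
  in the product measure.\<close>

lemma AE_prod_eq:
  fixes u u' :: "'a::euclidean_space \<Rightarrow> real"
  assumes "AE x in lborel. u x = u' x"
  shows "AE z in lborel. u (fst z) = u' (fst z) \<and> u (snd z) = u' (snd z)"
proof -
  obtain N where N: "{x. u x \<noteq> u' x} \<subseteq> N" "N \<in> sets lborel" "emeasure lborel N = 0"
    using AE_E[OF assms] by auto
  have "N \<times> UNIV \<in> null_sets (lborel \<Otimes>\<^sub>M lborel :: ('a \<times> 'a) measure)" "UNIV \<times> N \<in> null_sets (lborel \<Otimes>\<^sub>M lborel :: ('a \<times> 'a) measure)"
    using N(2,3) by (auto simp: null_sets_def lborel.emeasure_pair_measure_Times)
  then have "N \<times> UNIV \<union> UNIV \<times> N \<in> null_sets (lborel :: ('a \<times> 'a) measure)" by (auto simp: lborel_prod)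
  then have "AE z in lborel. z \<notin> N \<times> UNIV \<union> UNIV \<times> N" by (rule AE_not_in)
  then show ?thesis by eventually_elim (use N(1) in auto)
qed

lemma neumann_form_eq_nn_integral:
  fixes u :: "real^'n::finite \<Rightarrow> real"
  assumes u [measurable]: "u \<in> borel_measurable borel" and \<Omega> [measurable]: "\<Omega> \<in> sets borel"
  shows "(\<integral>\<^sup>+z\<in>T_region \<Omega>. ennreal (diff_quot s u z) \<partial>lborel) = neumann_form s \<Omega> u"
proof -
  let ?K = "\<lambda>x y. rker s (x - y)"
  let ?F = "\<lambda>p. ennreal ((u (fst p) - u (snd p))\<^sup>2 * ?K (fst p) (snd p))"
  have dq: "diff_quot s u p = (u (fst p) - u (snd p))\<^sup>2 * ?K (fst p) (snd p)" for p
    unfolding diff_quot_def rker_def case_prod_beta' DIM_cart DIM_real mult_1_right powr_minus divide_inverse by simp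
  have \<Omega>' [measurable]: "- \<Omega> \<in> sets borel" using \<Omega> by auto
  have Fm [measurable]: "?F \<in> borel_measurable lborel"
    unfolding lborel_prod[symmetric] by measurable
  have sets [measurable]: "A \<times> B \<in> sets lborel" if [measurable]: "A \<in> sets borel" "B \<in> sets borel" for A B :: "(real^'n) set"
    unfolding lborel_prod[symmetric] by measurable
  \<comment> \<open>T is the disjoint union of three rectangles, which turns its energy into a sum
    of forms.\<close>
  have T: "indicator (T_region \<Omega>) p = (indicator (\<Omega> \<times> \<Omega>) p + indicator (\<Omega> \<times> (- \<Omega>)) p + indicator ((- \<Omega>) \<times> \<Omega>) p :: ennreal)" for p
    by (cases p) (auto simp: T_region_def indicator_def)
  have "(\<integral>\<^sup>+z\<in>T_region \<Omega>. ennreal (diff_quot s u z) \<partial>lborel)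
     = (\<integral>\<^sup>+p. ?F p * indicator (\<Omega> \<times> \<Omega>) p + ?F p * indicator (\<Omega> \<times> (- \<Omega>)) p + ?F p * indicator ((- \<Omega>) \<times> \<Omega>) p \<partial>lborel)"
    by (simp only: dq T distrib_left)
  also have "\<dots> = (\<integral>\<^sup>+p. ?F p * indicator (\<Omega> \<times> \<Omega>) p \<partial>lborel) + (\<integral>\<^sup>+p. ?F p * indicator (\<Omega> \<times> (- \<Omega>)) p \<partial>lborel) + (\<integral>\<^sup>+p. ?F p * indicator ((- \<Omega>) \<times> \<Omega>) p \<partial>lborel)"
    by (subst nn_integral_add, measurable, subst nn_integral_add, measurable)
  also have "\<dots> = gform ?K \<Omega> u \<Omega> u + gform ?K \<Omega> u (- \<Omega>) u + gform ?K (- \<Omega>) u \<Omega> u"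
    by (simp only: gform_eq_nn_integral_prod[OF u u \<Omega> \<Omega> measurable_rker_diff] gform_eq_nn_integral_prod[OF u u \<Omega> \<Omega>' measurable_rker_diff]
      gform_eq_nn_integral_prod[OF u u \<Omega>' \<Omega> measurable_rker_diff])
  also have "gform ?K (- \<Omega>) u \<Omega> u = gform ?K \<Omega> u (- \<Omega>) u" by (rule gform_rker_swap[OF u \<Omega>' \<Omega>])
  finally show ?thesis by (simp add: neumann_form_def mult_2 add.assoc)
qed

text \<open>Integrals of a Lebesgue measurable function are those of its Borel representative. The
  last claim needs no finiteness: for an infinite \<open>X\<close> both the Bochner integral and
  \<open>enn2real\<close> are 0.\<close>

lemma set_lebesgue_integral_representative:
  fixes u u' :: "'a::euclidean_space \<Rightarrow> real" and h :: "real \<Rightarrow> real"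
  assumes u: "u \<in> borel_measurable lebesgue" and u' [measurable]: "u' \<in> borel_measurable borel"
    and ae: "AE x in lborel. u x = u' x" and A: "A \<in> sets borel"
    and h [measurable]: "h \<in> borel_measurable borel" and h0: "\<And>t. 0 \<le> h t"
  defines "X \<equiv> (\<integral>\<^sup>+x. ennreal (h (u' x)) * indicator A x \<partial>lborel)"
  shows "(\<integral>\<^sup>+x\<in>A. ennreal (h (u x)) \<partial>lebesgue) = X"
    and "X < \<infinity> \<Longrightarrow> set_integrable lebesgue A (\<lambda>x. h (u x))"
    and "(LINT x:A|lebesgue. h (u x)) = enn2real X"
proof -
  have m: "(\<lambda>x. indicator A x *\<^sub>R h (u x)) \<in> borel_measurable lebesgue"
    using A by (intro borel_measurable_scaleR borel_measurable_indicator measurable_compose[OF u h]) auto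
  show 1: "(\<integral>\<^sup>+x\<in>A. ennreal (h (u x)) \<partial>lebesgue) = X"
    unfolding X_def nn_integral_completion using ae by (intro nn_integral_cong_AE) auto
  have 2: "(\<integral>\<^sup>+x. ennreal (indicator A x *\<^sub>R h (u x)) \<partial>lebesgue) = X"
    unfolding 1[symmetric] by (intro nn_integral_cong) (simp add: indicator_def)
  show "set_integrable lebesgue A (\<lambda>x. h (u x))" if "X < \<infinity>"
    unfolding set_integrable_def using m h0 that 2 by (intro integrableI_nonneg) auto
  show "(LINT x:A|lebesgue. h (u x)) = enn2real X"
    unfolding set_lebesgue_integral_def using m h0 2 by (subst integral_eq_nn_integral) auto
qed

text \<open>The bridge between the definitions, over Lebesgue measurable functions, and the
  estimates, over Borel functions. Finiteness of the norm is what allows the real-valued energy and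
  mass to be read back as the extended ones.\<close>

lemma Hs_space_representative:
  fixes u :: "real^'n::finite \<Rightarrow> real"
  assumes \<Omega>: "\<Omega> \<in> sets borel" and u: "u \<in> Hs_space s \<Omega>"
  obtains u' where "u' \<in> borel_measurable borel" "AE x in lborel. u x = u' x"
    "neumann_form s \<Omega> u' = ennreal (energy s \<Omega> u)" "0 \<le> energy s \<Omega> u"
    "(\<integral>\<^sup>+x. ennreal ((u' x)\<^sup>2) * indicator \<Omega> x \<partial>lborel) = ennreal (LINT x:\<Omega>|lebesgue. (u x)\<^sup>2)"
    "0 \<le> (LINT x:\<Omega>|lebesgue. (u x)\<^sup>2)"
proof -
  have um: "u \<in> borel_measurable lebesgue" and fin: "Hs_norm_sq s \<Omega> u < \<infinity>"
    using u by (auto simp: Hs_space_def)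
  from completion_ex_borel_measurable_real[OF um]
  obtain u' where u' [measurable]: "u' \<in> borel_measurable borel" and ae: "AE x in lborel. u x = u' x" by auto
  have dq_ae: "AE z in lborel. diff_quot s u z = diff_quot s u' z"
    using AE_prod_eq[OF ae] by eventually_elim (simp add: diff_quot_def case_prod_beta')
  have T: "T_region \<Omega> \<in> sets borel"
  proof -
    have "(UNIV - \<Omega>) \<times> (UNIV - \<Omega>) \<in> sets (borel \<Otimes>\<^sub>M borel)" using \<Omega> by (intro pair_measureI) auto
    then have "(UNIV - \<Omega>) \<times> (UNIV - \<Omega>) \<in> sets borel" by (simp only: borel_prod)
    then show ?thesis unfolding T_region_def by (intro sets.Diff) auto
  qed
  have dqm': "diff_quot s u' \<in> borel_measurable borel"
    unfolding diff_quot_def borel_prod[symmetric] by measurable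
  have dqm: "diff_quot s u \<in> borel_measurable lebesgue"
  proof (rule borel_measurable_AE)
    show "diff_quot s u' \<in> borel_measurable lebesgue" using dqm' by (intro measurable_completion) simp
    show "AE z in lebesgue. diff_quot s u' z = diff_quot s u z"
      using dq_ae by (intro AE_completion) (auto elim: eventually_mono)
  qed
  have en: "(\<integral>\<^sup>+z\<in>T_region \<Omega>. ennreal (diff_quot s u z) \<partial>lebesgue) = neumann_form s \<Omega> u'"
    unfolding nn_integral_completion neumann_form_eq_nn_integral[OF u' \<Omega>, symmetric]
    using dq_ae by (intro nn_integral_cong_AE) auto
  note sq = set_lebesgue_integral_representative[OF um u' ae \<Omega>, of "\<lambda>t. t\<^sup>2"]
  have sum: "(\<integral>\<^sup>+x. ennreal ((u' x)\<^sup>2) * indicator \<Omega> x \<partial>lborel) + neumann_form s \<Omega> u' < \<infinity>"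
    using fin unfolding Hs_norm_sq_def en using sq(1) by simp
  have energy: "energy s \<Omega> u = enn2real (neumann_form s \<Omega> u')"
  proof -
    have "(\<lambda>z. indicator (T_region \<Omega>) z *\<^sub>R diff_quot s u z) \<in> borel_measurable lebesgue"
      using T dqm by (intro borel_measurable_scaleR borel_measurable_indicator) auto
    then have "energy s \<Omega> u = enn2real (\<integral>\<^sup>+z. ennreal (indicator (T_region \<Omega>) z *\<^sub>R diff_quot s u z) \<partial>lebesgue)"
      unfolding energy_def set_lebesgue_integral_def
      by (intro integral_eq_nn_integral) (auto simp: diff_quot_def case_prod_beta')
    also have "(\<integral>\<^sup>+z. ennreal (indicator (T_region \<Omega>) z *\<^sub>R diff_quot s u z) \<partial>lebesgue) = (\<integral>\<^sup>+z\<in>T_region \<Omega>. ennreal (diff_quot s u z) \<partial>lebesgue)"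
      by (intro nn_integral_cong) (simp add: indicator_def)
    finally show ?thesis unfolding en .
  qed
  show ?thesis
  proof (rule that[OF u' ae])
    show "neumann_form s \<Omega> u' = ennreal (energy s \<Omega> u)" "0 \<le> energy s \<Omega> u"
      using sum unfolding energy by simp_all
    show "(\<integral>\<^sup>+x. ennreal ((u' x)\<^sup>2) * indicator \<Omega> x \<partial>lborel) = ennreal (LINT x:\<Omega>|lebesgue. (u x)\<^sup>2)"
      "0 \<le> (LINT x:\<Omega>|lebesgue. (u x)\<^sup>2)"
      using sq(3) sum by simp_all
  qed
qed

lemma neumann_form_UNIV: "neumann_form s UNIV u = seminorm_sq s u"
  by (simp add: neumann_form_def gform_def)

lemma critical_exponent:
  fixes s :: real
  assumes "0 < s" "2 * s < real d"
  shows "crit_exp d s + 1 = 2 * real d / (real d - 2 * s)"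
    and "2 / (crit_exp d s + 1) = (real d - 2 * s) / real d"
proof -
  show *: "crit_exp d s + 1 = 2 * real d / (real d - 2 * s)"
    using assms by (simp add: crit_exp_def field_simps)
  show "2 / (crit_exp d s + 1) = (real d - 2 * s) / real d"
    unfolding * using assms by (simp add: field_simps)
qed

lemma powr_critical_inverse:
  fixes s t :: real
  assumes "0 < s" "2 * s < real d" "0 \<le> t"
  shows "(t powr (real d / (real d - 2 * s))) powr ((real d - 2 * s) / real d) = t"
    and "(t powr ((real d - 2 * s) / real d)) powr (real d / (real d - 2 * s)) = t"
  using assms by (simp_all add: powr_powr)

section \<open>The best constant is positive, finite and attained as a bound\<close>

definition tent :: "'a::euclidean_space \<Rightarrow> real" where
  "tent x = max 0 (1 - norm x)"

lemma measurable_tent [measurable]: "tent \<in> borel_measurable borel"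
  unfolding tent_def by measurable

text \<open>The function is 1-Lipschitz with values in [0, 1], so its squared differences are at
  most min(1, |x - y|^2); as it vanishes off the unit ball, only pairs with a point in that ball
  count.\<close>

lemma tent_seminorm_finite:
  fixes s :: real
  assumes s: "0 < s" "s < 1"
  shows "seminorm_sq s (tent :: 'a::euclidean_space \<Rightarrow> real) < \<infinity>"
proof -
  let ?B = "cball (0::'a) 1" and ?K = "\<lambda>x y::'a. rker s (x - y)"
  define T where "T z = ennreal (min 1 ((norm z)\<^sup>2) * rker s (z::'a))" for z
  have [measurable]: "T \<in> borel_measurable borel" unfolding T_def by measurable
  have Teven: "T (- z) = T z" for z by (simp add: T_def)
  have sq: "(tent x - tent y)\<^sup>2 \<le> min 1 ((norm (x - y))\<^sup>2)" for x y :: 'a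
  proof (rule min.boundedI)
    have "0 \<le> tent z" "tent z \<le> 1" for z :: 'a by (simp_all add: tent_def)
    from this[of x] this[of y] have "\<bar>tent x - tent y\<bar> \<le> 1" by linarith
    then show "(tent x - tent y)\<^sup>2 \<le> 1" by (simp add: abs_square_le_1)
    have "\<bar>tent x - tent y\<bar> \<le> \<bar>norm x - norm y\<bar>" by (auto simp: tent_def max_def)
    also have "\<dots> \<le> \<bar>norm (x - y)\<bar>" using norm_triangle_ineq3[of x y] by simp
    finally show "(tent x - tent y)\<^sup>2 \<le> (norm (x - y))\<^sup>2" by (simp only: abs_le_square_iff)
  qed
  have bound: "gform ?K ?B tent A tent \<le> (\<integral>\<^sup>+z. T z \<partial>lborel) * emeasure lborel ?B" for A
  proof -
    have "gform ?K ?B tent A tent \<le> (\<integral>\<^sup>+x. (\<integral>\<^sup>+z. T z \<partial>lborel) * indicator ?B x \<partial>lborel)"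
      unfolding gform_def
    proof (rule nn_integral_mono, rule mult_right_mono)
      fix x :: 'a
      have "(\<integral>\<^sup>+y. ennreal ((tent x - tent y)\<^sup>2 * ?K x y) * indicator A y \<partial>lborel) \<le> (\<integral>\<^sup>+y. T (x - y) \<partial>lborel)"
      proof (rule nn_integral_mono)
        fix y
        have "(tent x - tent y)\<^sup>2 * ?K x y \<le> min 1 ((norm (x - y))\<^sup>2) * ?K x y"
          by (rule mult_right_mono[OF sq]) simp
        then show "ennreal ((tent x - tent y)\<^sup>2 * ?K x y) * indicator A y \<le> T (x - y)"
          by (auto simp: T_def indicator_def intro: ennreal_leI)
      qed
      also have "\<dots> = (\<integral>\<^sup>+z. T z \<partial>lborel)"
        by (rule nn_integral_translate_even(1)[of T, OF _ Teven]) measurable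
      finally show "(\<integral>\<^sup>+y. ennreal ((tent x - tent y)\<^sup>2 * ?K x y) * indicator A y \<partial>lborel) \<le> (\<integral>\<^sup>+z. T z \<partial>lborel)" .
    qed simp
    also have "\<dots> = (\<integral>\<^sup>+z. T z \<partial>lborel) * emeasure lborel ?B"
      by (rule nn_integral_cmult_indicator) simp
    finally show ?thesis .
  qed
  have "(\<integral>\<^sup>+z. T z \<partial>lborel) * emeasure lborel ?B < \<infinity>"
    using kernel_moment_finite[OF s, where 'a='a] emeasure_bounded_finite[of ?B]
    by (simp add: T_def ennreal_mult_less_top)
  then have fin: "gform ?K ?B tent A tent < \<infinity>" for A by (rule le_less_trans[OF bound])
  have "seminorm_sq s (tent :: 'a \<Rightarrow> real) = neumann_form s ?B tent"
    by (rule seminorm_eq_neumann_form) (auto simp: tent_def)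
  also have "\<dots> < \<infinity>"
    unfolding neumann_form_def using fin[of ?B] fin[of "- ?B"] by (simp add: ennreal_mult_less_top)
  finally show ?thesis .
qed

text \<open>The set of admissible constants contains a positive number by the crude inequality and
  is bounded by testing with the tent. Its supremum is then admissible, because for a fixed function
  the condition is a closed upper bound on the constant.\<close>

lemma sobolev_const_bound:
  fixes s :: real
  assumes s: "0 < s" "s < 1" and ns: "2 * s < real CARD('n::{finite,linorder})"
  shows "0 < sobolev_const TYPE('n) s"
    and "sobolev_bound TYPE(real^'n::{finite,linorder}) s (c_const TYPE('n) s / (2 * sobolev_const TYPE('n) s))"
proof -
  let ?n = "real CARD('n)"
  define q where "q = 2 * ?n / (?n - 2 * s)"
  define r where "r = (?n - 2 * s) / ?n"
  define c where "c = c_const TYPE('n) s"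
  define X where "X = {C::real. \<forall>u :: real^'n::{finite,linorder} \<Rightarrow> real. u \<in> Hs_space s UNIV \<longrightarrow>
     integrable lebesgue (\<lambda>x. \<bar>u x\<bar> powr q) \<and>
     C * (LINT x|lebesgue. \<bar>u x\<bar> powr q) powr r \<le> c / 2 * energy s UNIV u}"
  have S: "sobolev_const TYPE('n) s = Sup X"
    unfolding sobolev_const_def X_def critical_exponent(2)[OF s(1) ns]
    unfolding critical_exponent(1)[OF s(1) ns] q_def r_def c_def ..
  have c: "0 < c" unfolding c_def by (rule c_const_pos[OF s])
  have UNIVm: "(UNIV :: (real^'n::{finite,linorder}) set) \<in> sets borel" by simp
  have dim: "DIM(real^'n::{finite,linorder}) = CARD('n)" by simp
  obtain C0 where C0: "0 < C0" and sob: "sobolev_bound TYPE(real^'n::{finite,linorder}) s C0"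
    using sobolev_bound_exists[of s, where 'a="real^'n::{finite,linorder}"] s ns by auto
  \<comment> \<open>The crude constant bounds the L^q norm by the bare double integral; c / (2 C0)
    is the same constant in the normalisation of the best-constant inequality.\<close>
  have inX: "c / (2 * C0) \<in> X"
    unfolding X_def
  proof (intro CollectI allI impI)
    fix u :: "real^'n::{finite,linorder} \<Rightarrow> real" assume u: "u \<in> Hs_space s UNIV"
    then have um: "u \<in> borel_measurable lebesgue" by (simp add: Hs_space_def)
    obtain u' where u': "u' \<in> borel_measurable borel" "AE x in lborel. u x = u' x"
      and E: "neumann_form s UNIV u' = ennreal (energy s UNIV u)" "0 \<le> energy s UNIV u"
      and M: "(\<integral>\<^sup>+x. ennreal ((u' x)\<^sup>2) * indicator UNIV x \<partial>lborel) = ennreal (LINT x:UNIV|lebesgue. (u x)\<^sup>2)"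
      by (rule Hs_space_representative[OF UNIVm u])
    have le: "(\<integral>\<^sup>+x. ennreal (\<bar>u' x\<bar> powr q) * indicator UNIV x \<partial>lborel) \<le> ennreal ((C0 * energy s UNIV u) powr (?n / (?n - 2 * s)))"
      using sob[unfolded sobolev_bound_def dim, rule_format, of u' "energy s UNIV u"] u'(1) E M
      by (simp add: q_def neumann_form_UNIV)
    note rep = set_lebesgue_integral_representative[OF um u' UNIVm, of "\<lambda>t. \<bar>t\<bar> powr q", simplified]
    let ?J = "LINT x|lebesgue. \<bar>u x\<bar> powr q"
    have fin: "(\<integral>\<^sup>+x. ennreal (\<bar>u' x\<bar> powr q) \<partial>lborel) < top" using le_less_trans[OF le ennreal_less_top] by simp
    have int: "integrable lebesgue (\<lambda>x. \<bar>u x\<bar> powr q)" using rep(2)[OF fin] by (simp add: set_integrable_def)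
    have J: "?J = enn2real (\<integral>\<^sup>+x. ennreal (\<bar>u' x\<bar> powr q) \<partial>lborel)"
      using rep(3) by (simp add: set_lebesgue_integral_def)
    have "?J \<le> (C0 * energy s UNIV u) powr (?n / (?n - 2 * s))"
      unfolding J using le by (intro enn2real_leI) simp_all
    then have "?J powr r \<le> ((C0 * energy s UNIV u) powr (?n / (?n - 2 * s))) powr r"
      using s ns by (intro powr_mono2) (auto simp: r_def J)
    also have "\<dots> = C0 * energy s UNIV u"
      unfolding r_def using C0 E(2) by (intro powr_critical_inverse(1)[OF s(1) ns]) simp
    finally have "c / (2 * C0) * ?J powr r \<le> c / (2 * C0) * (C0 * energy s UNIV u)"
      using c C0 by (intro mult_left_mono) auto
    then show "integrable lebesgue (\<lambda>x. \<bar>u x\<bar> powr q) \<and> c / (2 * C0) * ?J powr r \<le> c / 2 * energy s UNIV u"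
      using int C0 by simp
  qed
  have to_Hs: "u \<in> Hs_space s UNIV" "seminorm_sq s u = ennreal (energy s UNIV u)" "0 \<le> energy s UNIV u"
    if u: "u \<in> borel_measurable borel" and L2: "(\<integral>\<^sup>+x. ennreal ((u x)\<^sup>2) \<partial>lborel) < \<infinity>" and E: "seminorm_sq s u < \<infinity>"
    for u :: "real^'n::{finite,linorder} \<Rightarrow> real"
  proof -
    have um: "u \<in> borel_measurable lebesgue" using u by (intro measurable_completion) simp
    have "Hs_norm_sq s UNIV u = (\<integral>\<^sup>+x. ennreal ((u x)\<^sup>2) \<partial>lborel) + seminorm_sq s u"
      unfolding Hs_norm_sq_def nn_integral_completion neumann_form_eq_nn_integral[OF u UNIVm] by (simp add: neumann_form_UNIV)
    then show Hs: "u \<in> Hs_space s UNIV" using um L2 E by (simp add: Hs_space_def)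
    obtain u' where u': "u' \<in> borel_measurable borel" "AE x in lborel. u x = u' x"
      and E: "neumann_form s UNIV u' = ennreal (energy s UNIV u)" "0 \<le> energy s UNIV u"
      by (rule Hs_space_representative[OF UNIVm Hs])
    have "AE z in lborel. diff_quot s u z = diff_quot s u' z"
      using AE_prod_eq[OF u'(2)] by eventually_elim (simp add: diff_quot_def case_prod_beta')
    then have "neumann_form s UNIV u = neumann_form s UNIV u'"
      unfolding neumann_form_eq_nn_integral[OF u UNIVm, symmetric] neumann_form_eq_nn_integral[OF u'(1) UNIVm, symmetric]
      by (intro nn_integral_cong_AE) auto
    then show "seminorm_sq s u = ennreal (energy s UNIV u)" "0 \<le> energy s UNIV u"
      using E by (simp_all add: neumann_form_UNIV)
  qed
  have Lq: "(\<integral>\<^sup>+x. ennreal (\<bar>u x\<bar> powr q) \<partial>lborel) = ennreal (LINT x|lebesgue. \<bar>u x\<bar> powr q)"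
    if u: "u \<in> Hs_space s UNIV" for u :: "real^'n::{finite,linorder} \<Rightarrow> real"
  proof -
    have "integrable lebesgue (\<lambda>x. \<bar>u x\<bar> powr q)" using inX u by (simp add: X_def)
    then have "(\<integral>\<^sup>+x. ennreal (\<bar>u x\<bar> powr q) \<partial>lebesgue) = ennreal (LINT x|lebesgue. \<bar>u x\<bar> powr q)"
      by (intro nn_integral_eq_integral) auto
    then show ?thesis by (simp add: nn_integral_completion)
  qed
  \<comment> \<open>The tent has finite energy and a strictly positive L^q norm, so its quotient
    bounds every admissible constant.\<close>
  have bdd: "bdd_above X"
  proof -
    let ?t = "tent :: real^'n::{finite,linorder} \<Rightarrow> real"
    have "(\<integral>\<^sup>+x. ennreal ((?t x)\<^sup>2) \<partial>lborel) \<le> (\<integral>\<^sup>+x. indicator (cball 0 1) x \<partial>(lborel :: (real^'n::{finite,linorder}) measure))"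
      by (intro nn_integral_mono) (auto simp: tent_def indicator_def max_def ennreal_le_1 power_le_one)
    also have "\<dots> = emeasure lborel (cball (0::real^'n::{finite,linorder}) 1)" by simp
    also have "\<dots> < \<infinity>" using emeasure_bounded_finite[of "cball (0::real^'n::{finite,linorder}) 1"] by simp
    finally have "(\<integral>\<^sup>+x. ennreal ((?t x)\<^sup>2) \<partial>lborel) < \<infinity>" .
    note t = to_Hs[OF measurable_tent this tent_seminorm_finite[OF s]]
    let ?J = "LINT x|lebesgue. \<bar>?t x\<bar> powr q"
    have "0 < ennreal ((1 / 2) powr q) * emeasure lborel (ball (0::real^'n::{finite,linorder}) (1 / 2))"
      by (simp add: emeasure_ball ennreal_zero_less_mult_iff)
    also have "\<dots> = (\<integral>\<^sup>+x. ennreal ((1 / 2) powr q) * indicator (ball 0 (1 / 2)) x \<partial>(lborel :: (real^'n::{finite,linorder}) measure))"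
      by (rule nn_integral_cmult_indicator[symmetric]) simp
    also have "\<dots> \<le> (\<integral>\<^sup>+x. ennreal (\<bar>?t x\<bar> powr q) \<partial>lborel)"
    proof (rule nn_integral_mono)
      fix x :: "real^'n::{finite,linorder}"
      have "(1 / 2) powr q \<le> \<bar>?t x\<bar> powr q" if "norm x < 1 / 2"
        using that s ns by (intro powr_mono2) (auto simp: tent_def q_def)
      then show "ennreal ((1 / 2) powr q) * indicator (ball 0 (1 / 2)) x \<le> ennreal (\<bar>?t x\<bar> powr q)"
        by (auto simp: indicator_def intro: ennreal_leI)
    qed
    finally have "0 < ?J" unfolding Lq[OF t(1)] by simp
    then have pos: "0 < ?J powr r" by simp
    show ?thesis
    proof (rule bdd_aboveI)
      fix C assume "C \<in> X"
      then have "C * ?J powr r \<le> c / 2 * energy s UNIV ?t" using t(1) by (simp add: X_def)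
      then show "C \<le> c / 2 * energy s UNIV ?t / ?J powr r" using pos by (simp only: pos_le_divide_eq)
    qed
  qed
  have "c / (2 * C0) \<le> Sup X" by (rule cSup_upper[OF inX bdd])
  then show Spos: "0 < sobolev_const TYPE('n) s"
    unfolding S using c C0 by (smt (verit) divide_pos_pos mult_pos_pos)
  have SX: "Sup X * (LINT x|lebesgue. \<bar>u x\<bar> powr q) powr r \<le> c / 2 * energy s UNIV u"
    if u: "u \<in> Hs_space s UNIV" for u :: "real^'n::{finite,linorder} \<Rightarrow> real"
  proof (cases "(LINT x|lebesgue. \<bar>u x\<bar> powr q) powr r = 0")
    \<comment> \<open>When the norm vanishes only nonnegativity of the energy is left to prove,
      which any admissible constant provides.\<close>
    case True
    then show ?thesis using inX u unfolding X_def by auto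
  next
    case False
    then have pos: "0 < (LINT x|lebesgue. \<bar>u x\<bar> powr q) powr r" using powr_ge_zero by (simp add: less_le)
    have "Sup X \<le> c / 2 * energy s UNIV u / (LINT x|lebesgue. \<bar>u x\<bar> powr q) powr r"
    proof (rule cSup_least)
      show "X \<noteq> {}" using inX by blast
      fix C assume "C \<in> X"
      then have "C * (LINT x|lebesgue. \<bar>u x\<bar> powr q) powr r \<le> c / 2 * energy s UNIV u" using u by (simp add: X_def)
      then show "C \<le> c / 2 * energy s UNIV u / (LINT x|lebesgue. \<bar>u x\<bar> powr q) powr r" using pos by (simp only: pos_le_divide_eq)
    qed
    then show ?thesis using pos by (simp only: pos_le_divide_eq)
  qed
  show "sobolev_bound TYPE(real^'n::{finite,linorder}) s (c_const TYPE('n) s / (2 * sobolev_const TYPE('n) s))"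
    unfolding sobolev_bound_def dim q_def[symmetric] c_def[symmetric]
  proof (intro ballI allI impI)
    fix u :: "real^'n::{finite,linorder} \<Rightarrow> real" and e :: real
    assume u: "u \<in> borel_measurable borel" and e: "0 \<le> e"
      and L2: "(\<integral>\<^sup>+x. ennreal ((u x)\<^sup>2) \<partial>lborel) < \<infinity>" and E: "seminorm_sq s u \<le> ennreal e"
    have "seminorm_sq s u < \<infinity>" using le_less_trans[OF E ennreal_less_top] by simp
    note Hs = to_Hs[OF u L2 this]
    let ?J = "LINT x|lebesgue. \<bar>u x\<bar> powr q"
    have J0: "0 \<le> ?J" by (intro integral_nonneg_AE AE_I2) simp
    have en: "energy s UNIV u \<le> e" using E e unfolding Hs(2) by simp
    have "sobolev_const TYPE('n) s * ?J powr r \<le> c / 2 * energy s UNIV u" unfolding S by (rule SX[OF Hs(1)])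
    also have "\<dots> \<le> c / 2 * e" using c en by (intro mult_left_mono) auto
    finally have "?J powr r \<le> c / (2 * sobolev_const TYPE('n) s) * e"
      using Spos by (simp add: field_simps)
    then have "(?J powr r) powr (?n / (?n - 2 * s)) \<le> (c / (2 * sobolev_const TYPE('n) s) * e) powr (?n / (?n - 2 * s))"
      using ns by (intro powr_mono2) auto
    also have "(?J powr r) powr (?n / (?n - 2 * s)) = ?J"
      unfolding r_def by (rule powr_critical_inverse(2)[OF s(1) ns J0])
    finally show "(\<integral>\<^sup>+x. ennreal (\<bar>u x\<bar> powr q) \<partial>lborel) \<le> ennreal ((c / (2 * sobolev_const TYPE('n) s) * e) powr (?n / (?n - 2 * s)))"
      unfolding Lq[OF Hs(1)] by (rule ennreal_leI)
  qed
qed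

theorem theorem1p2:
  fixes s p :: real and \<Omega> :: "(real^'n::{finite,linorder}) set"
  assumes "0 < s" and "s < 1"
    and "real CARD('n) > 2 * s"
    and "p = crit_exp CARD('n) s"
    and "bounded_C1_domain \<Omega>"
  shows "\<forall>\<epsilon>>0. \<exists>A>0. \<forall>u \<in> Hs_space s \<Omega>.
    set_integrable lebesgue \<Omega> (\<lambda>x. \<bar>u x\<bar> powr (p + 1)) \<and>
    (LINT x:\<Omega>|lebesgue. \<bar>u x\<bar> powr (p + 1)) powr (2 / (p + 1))
      \<le> (2 powr (2 * s / real CARD('n)) / sobolev_const TYPE('n) s + \<epsilon>)
            * (c_const TYPE('n) s / 2) * energy s \<Omega> u
        + A * (LINT x:\<Omega>|lebesgue. (u x)\<^sup>2)"
proof (intro allI impI)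
  fix \<epsilon> :: real assume eps: "0 < \<epsilon>"
  let ?n = "real CARD('n)" and ?S = "sobolev_const TYPE('n) s" and ?c = "c_const TYPE('n) s"
  have \<Omega>: "open \<Omega>" "bounded \<Omega>" "C1_boundary \<Omega>" using assms(5) by (auto simp: bounded_C1_domain_def)
  have \<Omega>m: "\<Omega> \<in> sets borel" using \<Omega>(1) by simp
  note S = sobolev_const_bound[OF assms(1,2,3)]
  have c: "0 < ?c" by (rule c_const_pos[OF assms(1,2)])
  have dim: "DIM(real^'n::{finite,linorder}) = CARD('n)" by simp
  \<comment> \<open>The tolerance is taken as epsilon times c/2 because the final inequality carries
    the factor c/2 in front of the whole bracket.\<close>
  have "0 \<le> ?c / (2 * ?S)" "0 < \<epsilon> * (?c / 2)" using c S(1) eps by simp_all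
  from neumann_sobolev[OF \<Omega> assms(1,2) _ S(2) this, unfolded dim, OF assms(3)]
  obtain A where A: "0 < A" and main: "\<And>u e m. u \<in> borel_measurable borel \<Longrightarrow> 0 \<le> e \<Longrightarrow> 0 \<le> m \<Longrightarrow> neumann_form s \<Omega> u \<le> ennreal e \<Longrightarrow>
     (\<integral>\<^sup>+x. ennreal ((u x)\<^sup>2) * indicator \<Omega> x \<partial>lborel) \<le> ennreal m \<Longrightarrow>
     (\<integral>\<^sup>+x. ennreal (\<bar>u x\<bar> powr (2 * ?n / (?n - 2 * s))) * indicator \<Omega> x \<partial>lborel)
       \<le> ennreal (((2 powr (2 * s / ?n) * (?c / (2 * ?S)) + \<epsilon> * (?c / 2)) * e + A * m) powr (?n / (?n - 2 * s)))"
    by auto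
  have p: "p + 1 = 2 * ?n / (?n - 2 * s)" "2 / (p + 1) = (?n - 2 * s) / ?n"
    unfolding assms(4) by (rule critical_exponent[OF assms(1,3)])+
  have coeff: "2 powr (2 * s / ?n) * (?c / (2 * ?S)) + \<epsilon> * (?c / 2) = (2 powr (2 * s / ?n) / ?S + \<epsilon>) * (?c / 2)"
    by (simp add: field_simps)
  have coeff0: "0 \<le> (2 powr (2 * s / ?n) / ?S + \<epsilon>) * (?c / 2)" using c S(1) eps by simp
  show "\<exists>A>0. \<forall>u \<in> Hs_space s \<Omega>.
    set_integrable lebesgue \<Omega> (\<lambda>x. \<bar>u x\<bar> powr (p + 1)) \<and>
    (LINT x:\<Omega>|lebesgue. \<bar>u x\<bar> powr (p + 1)) powr (2 / (p + 1))
      \<le> (2 powr (2 * s / ?n) / ?S + \<epsilon>) * (?c / 2) * energy s \<Omega> u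
        + A * (LINT x:\<Omega>|lebesgue. (u x)\<^sup>2)"
  proof (intro exI[of _ A] conjI[OF A] ballI)
    fix u :: "real^'n::{finite,linorder} \<Rightarrow> real" assume u: "u \<in> Hs_space s \<Omega>"
    then have um: "u \<in> borel_measurable lebesgue" by (simp add: Hs_space_def)
    let ?e = "energy s \<Omega> u" and ?m = "LINT x:\<Omega>|lebesgue. (u x)\<^sup>2"
    obtain u' where u': "u' \<in> borel_measurable borel" "AE x in lborel. u x = u' x"
      and E: "neumann_form s \<Omega> u' = ennreal ?e" "0 \<le> ?e"
      and M: "(\<integral>\<^sup>+x. ennreal ((u' x)\<^sup>2) * indicator \<Omega> x \<partial>lborel) = ennreal ?m" "0 \<le> ?m"
      by (rule Hs_space_representative[OF \<Omega>m u])
    let ?R = "(2 powr (2 * s / ?n) / ?S + \<epsilon>) * (?c / 2) * ?e + A * ?m"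
    have R: "0 \<le> ?R" by (intro add_nonneg_nonneg mult_nonneg_nonneg[OF coeff0 E(2)] mult_nonneg_nonneg[OF less_imp_le[OF A] M(2)])
    have le: "(\<integral>\<^sup>+x. ennreal (\<bar>u' x\<bar> powr (p + 1)) * indicator \<Omega> x \<partial>lborel) \<le> ennreal (?R powr (?n / (?n - 2 * s)))"
      using main[OF u'(1) E(2) M(2)] E(1) M(1) unfolding p(1) coeff by simp
    have pm: "(\<lambda>t::real. \<bar>t\<bar> powr (p + 1)) \<in> borel_measurable borel" by measurable
    note rep = set_lebesgue_integral_representative[OF um u' \<Omega>m pm powr_ge_zero]
    have "set_integrable lebesgue \<Omega> (\<lambda>x. \<bar>u x\<bar> powr (p + 1))"
      by (rule rep(2)) (use le_less_trans[OF le ennreal_less_top] in simp)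
    moreover have "(LINT x:\<Omega>|lebesgue. \<bar>u x\<bar> powr (p + 1)) powr (2 / (p + 1)) \<le> ?R"
    proof -
      have "(LINT x:\<Omega>|lebesgue. \<bar>u x\<bar> powr (p + 1)) \<le> ?R powr (?n / (?n - 2 * s))"
        unfolding rep(3) using le by (intro enn2real_leI) simp_all
      then have "(LINT x:\<Omega>|lebesgue. \<bar>u x\<bar> powr (p + 1)) powr (2 / (p + 1)) \<le> (?R powr (?n / (?n - 2 * s))) powr ((?n - 2 * s) / ?n)"
        unfolding p(2) using assms(3) by (intro powr_mono2) (simp_all add: rep(3))
      also have "\<dots> = ?R" by (rule powr_critical_inverse(1)[OF assms(1,3) R])
      finally show ?thesis .
    qed
    ultimately show "set_integrable lebesgue \<Omega> (\<lambda>x. \<bar>u x\<bar> powr (p + 1)) \<and>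
      (LINT x:\<Omega>|lebesgue. \<bar>u x\<bar> powr (p + 1)) powr (2 / (p + 1)) \<le> ?R" by blast
  qed
qed

end
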